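(* Let $p$ be an odd prime and let $G$ be a group of order $p^6$ belonging to the isoclinism family $\Phi_{15}$. Then $c(G)=2p^3$.
   Context: Two finite groups $G,H$ are isoclinic if there exist isomorphisms $\theta:G/Z(G)\to H/Z(H)$ and $\phi:G'\to H'$ such that $\phi([g_1,g_2])=[h_1,h_2]$ whenever $g_1,g_2\in G$, $h_1,h_2\in H$ and $\theta(g_iZ(G))=h_iZ(H)$ for $i=1,2$; here $[x,y]=x^{-1}y^{-1}xy$. In James's classification, the groups of order $p^6$ ($p$ odd) are divided into isoclinism families $\Phi_1,\dots,\Phi_{43}$; $\Phi_{15}$ is the family of groups of order $p^6$ isoclinic to $$\phi_{15}(1^6)=\langle \alpha_1,\alpha_2,\alpha_3,\alpha_4,\beta_1,\beta_2 \mid [\alpha_1,\alpha_2]=[\alpha_3,\alpha_4]=\beta_1,\ [\alpha_1,\alpha_3]=\beta_2,\ [\alpha_2,\alpha_4]=\beta_2^{\,q},\ \alpha_1^p=\alpha_2^p=\alpha_3^p=\alpha_4^p=\beta_1^p=\beta_2^p=1\rangle,$$ where $q$ is the smallest positive integer which is a primitive root modulo $p$, and where, by convention, all commutators of pairs of generators not listed are trivial. A quasi-permutation matrix is a square complex matrix whose trace is a non-negative integer; $c(G)$ is the minimal degree of a faithful representation of $G$ by complex quasi-permutation matrices. *)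

theory Defs
  imports
    Complex_Main
    "HOL-Algebra.Generated_Groups"
    "HOL-Number_Theory.Residue_Primitive_Roots"
    "Jordan_Normal_Form.Matrix"
begin

definition center :: "('a, 'b) monoid_scheme \<Rightarrow> 'a set" where
  "center G = {z \<in> carrier G. \<forall>g\<in>carrier G. z \<otimes>\<^bsub>G\<^esub> g = g \<otimes>\<^bsub>G\<^esub> z}"

definition commutator :: "('a, 'b) monoid_scheme \<Rightarrow> 'a \<Rightarrow> 'a \<Rightarrow> 'a" where
  "commutator G x y = inv\<^bsub>G\<^esub> x \<otimes>\<^bsub>G\<^esub> inv\<^bsub>G\<^esub> y \<otimes>\<^bsub>G\<^esub> x \<otimes>\<^bsub>G\<^esub> y"

text \<open>The library's \<^const>\<open>derived\<close> is generated by the elements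
  \<open>x y x\<^sup>-\<^sup>1 y\<^sup>-\<^sup>1\<close>; as \<open>x\<close> and \<open>y\<close> range over the whole group this is the same
  subgroup as the one generated by all \<open>x\<^sup>-\<^sup>1 y\<^sup>-\<^sup>1 x y\<close>. The library's cosets
  \<open>Z #> g\<close> are right cosets, which agree with left cosets for central \<open>Z\<close>.\<close>

definition isoclinic :: "('a, 'c) monoid_scheme \<Rightarrow> ('b, 'd) monoid_scheme \<Rightarrow> bool" where
  "isoclinic G H \<longleftrightarrow>
    (\<exists>\<theta> \<in> iso (G Mod center G) (H Mod center H).
     \<exists>\<phi> \<in> iso (G\<lparr>carrier := derived G (carrier G)\<rparr>) (H\<lparr>carrier := derived H (carrier H)\<rparr>).
       \<forall>g1 \<in> carrier G. \<forall>g2 \<in> carrier G. \<forall>h1 \<in> carrier H. \<forall>h2 \<in> carrier H.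
         \<theta> (center G #>\<^bsub>G\<^esub> g1) = center H #>\<^bsub>H\<^esub> h1 \<longrightarrow>
         \<theta> (center G #>\<^bsub>G\<^esub> g2) = center H #>\<^bsub>H\<^esub> h2 \<longrightarrow>
         \<phi> (commutator G g1 g2) = commutator H h1 h2)"

text \<open>A word is a list of letters \<open>(x, e)\<close>, where \<open>(x, True)\<close> stands for the generator
  \<open>x\<close> and \<open>(x, False)\<close> for its formal inverse. The generators are all elements of the
  type \<open>'g\<close>; a pair \<open>(u, v)\<close> of words in \<open>R\<close> is the relation \<open>u = v\<close>. The group is the
  set of words modulo the least congruence that contains \<open>R\<close> and free cancellation.\<close>

type_synonym 'g word = "('g \<times> bool) list"

inductive word_eq :: "('g word \<times> 'g word) set \<Rightarrow> 'g word \<Rightarrow> 'g word \<Rightarrow> bool"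
  for R :: "('g word \<times> 'g word) set" where
  refl: "word_eq R u u"
| sym: "word_eq R u v \<Longrightarrow> word_eq R v u"
| trans: "word_eq R u v \<Longrightarrow> word_eq R v w \<Longrightarrow> word_eq R u w"
| append: "word_eq R u u' \<Longrightarrow> word_eq R v v' \<Longrightarrow> word_eq R (u @ v) (u' @ v')"
| cancel: "word_eq R [(x, e), (x, \<not> e)] []"
| relation: "(u, v) \<in> R \<Longrightarrow> word_eq R u v"

definition word_class :: "('g word \<times> 'g word) set \<Rightarrow> 'g word \<Rightarrow> 'g word set" where
  "word_class R u = {v. word_eq R u v}"

definition presented_group :: "('g word \<times> 'g word) set \<Rightarrow> 'g word set monoid" where
  "presented_group R =
    \<lparr>carrier = range (word_class R),
     monoid.mult = (\<lambda>A B. \<Union>u\<in>A. \<Union>v\<in>B. word_class R (u @ v)),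
     one = word_class R []\<rparr>"

definition gen_word :: "'g \<Rightarrow> 'g word" where
  "gen_word x = [(x, True)]"

definition inv_word :: "'g word \<Rightarrow> 'g word" where
  "inv_word u = rev (map (\<lambda>(x, e). (x, \<not> e)) u)"

definition pow_word :: "'g word \<Rightarrow> nat \<Rightarrow> 'g word" where
  "pow_word u n = concat (replicate n u)"

definition comm_word :: "'g word \<Rightarrow> 'g word \<Rightarrow> 'g word" where
  "comm_word u v = inv_word u @ inv_word v @ u @ v"

lemma word_class_eq_iff: "word_class R u = word_class R v \<longleftrightarrow> word_eq R u v"
  by (auto simp: word_class_def intro: word_eq.intros)

lemma presented_group_mult:
  "word_class R u \<otimes>\<^bsub>presented_group R\<^esub> word_class R v = word_class R (u @ v)"
  by (auto simp: presented_group_def word_class_def intro: word_eq.intros)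

lemma word_eq_inv_word: "word_eq R (inv_word u @ u) []"
proof (induction u)
  case Nil
  show ?case by (simp add: inv_word_def word_eq.refl)
next
  case (Cons a u)
  obtain x e where a: "a = (x, e)" by (cases a)
  have "word_eq R ([(x, \<not> e), (x, \<not> \<not> e)] @ u) ([] @ u)"
    by (intro word_eq.append word_eq.cancel word_eq.refl)
  then have "word_eq R (inv_word u @ ([(x, \<not> e), (x, e)] @ u)) (inv_word u @ u)"
    by (intro word_eq.append word_eq.refl) simp
  then have "word_eq R (inv_word u @ ([(x, \<not> e), (x, e)] @ u)) []"
    using Cons word_eq.trans by blast
  then show ?case by (simp add: a inv_word_def)
qed

lemma group_presented_group: "group (presented_group R)"
proof (rule groupI)
  fix A assume "A \<in> carrier (presented_group R)"
  then obtain u where "A = word_class R u" by (auto simp: presented_group_def)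
  then have "word_class R (inv_word u) \<otimes>\<^bsub>presented_group R\<^esub> A = \<one>\<^bsub>presented_group R\<^esub>"
    by (simp add: presented_group_mult word_class_eq_iff word_eq_inv_word)
      (simp add: presented_group_def word_class_eq_iff word_eq_inv_word)
  then show "\<exists>B\<in>carrier (presented_group R). B \<otimes>\<^bsub>presented_group R\<^esub> A = \<one>\<^bsub>presented_group R\<^esub>"
    by (auto simp: presented_group_def)
next
  have carr: "carrier (presented_group R) = range (word_class R)"
    and one: "\<one>\<^bsub>presented_group R\<^esub> = word_class R []"
    by (simp_all add: presented_group_def)
  show "\<one>\<^bsub>presented_group R\<^esub> \<in> carrier (presented_group R)"
    by (simp add: carr one)
  fix A B C
  assume "A \<in> carrier (presented_group R)"
  then show "\<one>\<^bsub>presented_group R\<^esub> \<otimes>\<^bsub>presented_group R\<^esub> A = A"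
    by (auto simp: carr one presented_group_mult)
  assume "B \<in> carrier (presented_group R)"
  with \<open>A \<in> _\<close> show "A \<otimes>\<^bsub>presented_group R\<^esub> B \<in> carrier (presented_group R)"
    by (auto simp: carr presented_group_mult)
  assume "C \<in> carrier (presented_group R)"
  with \<open>A \<in> _\<close> \<open>B \<in> _\<close>
  show "A \<otimes>\<^bsub>presented_group R\<^esub> B \<otimes>\<^bsub>presented_group R\<^esub> C
      = A \<otimes>\<^bsub>presented_group R\<^esub> (B \<otimes>\<^bsub>presented_group R\<^esub> C)"
    by (auto simp: carr presented_group_mult)
qed

definition least_primroot :: "nat \<Rightarrow> nat" where
  "least_primroot p = (LEAST q. 0 < q \<and> residue_primroot p q)"

datatype gen15 = \<alpha>1 | \<alpha>2 | \<alpha>3 | \<alpha>4 | \<beta>1 | \<beta>2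

text \<open>The last set makes the convention explicit that the commutators of all pairs of
  generators not listed are trivial.\<close>

definition phi15_relations :: "nat \<Rightarrow> (gen15 word \<times> gen15 word) set" where
  "phi15_relations p =
    (let c = (\<lambda>x y. comm_word (gen_word x) (gen_word y)) in
      {(c \<alpha>1 \<alpha>2, gen_word \<beta>1),
       (c \<alpha>3 \<alpha>4, gen_word \<beta>1),
       (c \<alpha>1 \<alpha>3, gen_word \<beta>2),
       (c \<alpha>2 \<alpha>4, pow_word (gen_word \<beta>2) (least_primroot p))}
      \<union> {(pow_word (gen_word x) p, []) | x. True}
      \<union> {(c x y, []) | x y. {x, y} \<notin> {{\<alpha>1, \<alpha>2}, {\<alpha>3, \<alpha>4}, {\<alpha>1, \<alpha>3}, {\<alpha>2, \<alpha>4}}})"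

definition phi15_group :: "nat \<Rightarrow> gen15 word set monoid" where
  "phi15_group p = presented_group (phi15_relations p)"

definition in_Phi15 :: "nat \<Rightarrow> ('a, 'b) monoid_scheme \<Rightarrow> bool" where
  "in_Phi15 p G \<longleftrightarrow> group G \<and> Coset.order G = p ^ 6 \<and> isoclinic G (phi15_group p)"

definition mat_trace :: "'a :: comm_monoid_add mat \<Rightarrow> 'a" where
  "mat_trace A = (\<Sum>i<dim_row A. A $$ (i, i))"

definition quasi_permutation_mat :: "complex mat \<Rightarrow> bool" where
  "quasi_permutation_mat A \<longleftrightarrow> square_mat A \<and> mat_trace A \<in> \<nat>"

definition GL :: "nat \<Rightarrow> complex mat monoid" where
  "GL n = units_of (ring_mat TYPE(complex) n ())"

definition faithful_quasi_permutation_rep ::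
    "('a, 'b) monoid_scheme \<Rightarrow> nat \<Rightarrow> ('a \<Rightarrow> complex mat) \<Rightarrow> bool" where
  "faithful_quasi_permutation_rep G n \<rho> \<longleftrightarrow>
    \<rho> \<in> hom G (GL n) \<and> inj_on \<rho> (carrier G) \<and>
    (\<forall>g\<in>carrier G. quasi_permutation_mat (\<rho> g))"

text \<open>Every finite group has a faithful representation by permutation matrices, so the
  minimum exists.\<close>

definition quasi_permutation_degree :: "('a, 'b) monoid_scheme \<Rightarrow> nat" where
  "quasi_permutation_degree G =
    (LEAST n. 0 < n \<and> (\<exists>\<rho>. faithful_quasi_permutation_rep G n \<rho>))"

end

theory Submission
  imports
    Defs
    "HOL-Computational_Algebra.Polynomial"
    "HOL-Algebra.Zassenhaus"
    "Jordan_Normal_Form.Schur_Decomposition"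
begin

text \<open>
  A group \<open>G\<close> of the family is semi-extraspecial: \<open>Z = Z(G) = G'\<close> is elementary abelian of order
  \<open>p\<^sup>2\<close>, and \<open>y \<mapsto> [x, y]\<close> maps \<open>G\<close> onto \<open>Z\<close> for every \<open>x\<close> outside \<open>Z\<close>. This is a property of the
  commutator map alone, so it is invariant under isoclinism; for the presented group it says that
  the pencil spanned by the two commutator forms contains no degenerate form, because its Pfaffian
  \<open>s\<^sup>2 - q t\<^sup>2\<close> has no nontrivial zero when \<open>q\<close> is not a square.

  For a subgroup \<open>K\<close> of order \<open>p\<close> of \<open>Z\<close> there is a subgroup \<open>B\<close> of order \<open>p\<^sup>3\<close> with \<open>B \<inter> Z = K\<close>. If
  \<open>K\<^sub>1 \<noteq> K\<^sub>2\<close>, the permutation representation on the cosets of \<open>B\<^sub>1\<close> and \<open>B\<^sub>2\<close> is faithful of degree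
  \<open>2p\<^sup>3\<close>.

  Conversely let \<open>\<chi>\<close> be the character of a faithful quasi-permutation representation of degree \<open>n\<close>.
  It is constant on \<open>g Z\<close> for \<open>g\<close> outside \<open>Z\<close>. The multiplicities of the characters of \<open>B Z\<close> that are
  trivial on \<open>B\<close> are therefore determined by the sums of \<open>\<chi>\<close> over the cosets of \<open>K\<close> in \<open>Z\<close>, and since
  \<open>\<chi>\<close> has integer values they agree for all such characters except the trivial one. With \<open>N\<^sub>K\<close> their
  common value, \<open>p \<Sum>\<^bsub>z\<in>K\<^esub> \<chi>(z) = \<Sum>\<^bsub>z\<in>Z\<^esub> \<chi>(z) + (p - 1) p\<^sup>4 N\<^sub>K\<close>. Summing over all \<open>K\<close> and using that \<open>\<chi>\<close>
  is nonnegative on some fixed \<open>K\<^sub>3\<close> gives \<open>n \<ge> p\<^sup>3 \<Sum>\<^bsub>K \<noteq> K\<^sub>3\<^esub> N\<^sub>K\<close>, and faithfulness forces \<open>N\<^sub>K > 0\<close> for at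
  least two \<open>K\<close>, from which \<open>K\<^sub>3\<close> may be chosen different.\<close>

section \<open>Integer combinations of roots of unity\<close>

definition unity_root :: "nat \<Rightarrow> int \<Rightarrow> complex" where
  "unity_root p k = cis (2 * pi * of_int k / of_nat p)"

lemma unity_root_0 [simp]: "unity_root p 0 = 1"
  by (simp add: unity_root_def)

lemma unity_root_add: "unity_root p (j + k) = unity_root p j * unity_root p k"
  by (simp add: unity_root_def cis_mult distrib_left add_divide_distrib)

lemma unity_root_power: "unity_root p k ^ n = unity_root p (int n * k)"
  by (induction n) (simp_all add: unity_root_add distrib_right)

lemma unity_root_eq_1_iff:
  assumes "p > 0"
  shows "unity_root p k = 1 \<longleftrightarrow> int p dvd k"
proof
  assume "unity_root p k = 1"
  then have "cos (2 * pi * of_int k / of_nat p) = 1"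
    by (simp add: unity_root_def complex_eq_iff)
  then obtain m :: int where "2 * pi * of_int k / of_nat p = of_int m * 2 * pi"
    by (auto simp: cos_one_2pi_int)
  then have "of_int k = (of_int (m * int p) :: real)"
    using assms by (simp add: field_simps)
  then have "k = m * int p" by linarith
  then show "int p dvd k" by simp
next
  assume "int p dvd k"
  then obtain m where "k = int p * m" by auto
  then have "2 * pi * of_int k / of_nat p = 2 * pi * of_int m"
    using assms by simp
  then show "unity_root p k = 1"
    unfolding unity_root_def by (simp add: cis.code complex_eq_iff)
qed

lemma unity_root_cong:
  assumes "p > 0" "[j = k] (mod int p)"
  shows "unity_root p j = unity_root p k"
proof -
  have "unity_root p (j - k) = 1"
    using assms by (simp add: unity_root_eq_1_iff cong_iff_dvd_diff)
  then show ?thesis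
    using unity_root_add[of p "j - k" k] by simp
qed

lemma sum_unity_root:
  assumes "p > 0"
  shows "(\<Sum>r<p. unity_root p (int r * k)) = (if int p dvd k then of_nat p else 0)"
proof (cases "int p dvd k")
  case True
  then have "unity_root p (int r * k) = 1" for r
    using assms by (simp add: unity_root_eq_1_iff)
  then show ?thesis using True by simp
next
  case False
  have "(\<Sum>r<p. unity_root p k ^ r) = (unity_root p k ^ p - 1) / (unity_root p k - 1)"
    using False assms by (intro geometric_sum) (simp add: unity_root_eq_1_iff)
  moreover have "unity_root p k ^ p = 1"
    using assms by (simp add: unity_root_power unity_root_eq_1_iff)
  ultimately show ?thesis using False by (simp add: unity_root_power)
qed

section \<open>Integer sequences whose finite Fourier transform is integral\<close>

lemma coeff_power_Ints:
  fixes P :: "'a :: comm_ring_1 poly"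
  assumes "\<And>i. coeff P i \<in> \<int>"
  shows "coeff (P ^ n) i \<in> \<int>"
proof (induction n arbitrary: i)
  case 0
  show ?case by (cases i) (simp_all add: coeff_pCons)
next
  case (Suc n)
  then show ?case using assms by (auto simp: coeff_mult intro!: Ints_sum Ints_mult)
qed

text \<open>The sum of an integer polynomial over all \<open>p\<close>-th roots of unity is divisible by \<open>p\<close>.
  Applied to a \<open>(p - 1)\<close>-st power, Fermat turns it into a count of the nonzero residues.\<close>

lemma integer_transform_cong:
  fixes a u :: "nat \<Rightarrow> int"
  assumes p: "Factorial_Ring.prime p"
    and u: "\<And>r. r < p \<Longrightarrow> (\<Sum>k<p. of_int (a k) * unity_root p (int r * int k)) = of_int (u r)"
    and r: "r < p"
  shows "int p dvd u r - u 0"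
proof -
  have p0: "p > 0" and p1: "p > 1" using prime_gt_1_nat[OF p] by auto
  \<comment> \<open>Subtracting \<open>u 0\<close> forces a zero of \<open>P\<close> at the root of
    unity \<open>1\<close>, that is at \<open>r = 0\<close>. This zero keeps the count of nonzero
    residues below \<open>p\<close>, so that divisibility by \<open>p\<close> makes it
    vanish.\<close>
  define P :: "complex poly" where "P = (\<Sum>k<p. monom (of_int (a k)) k) - [:of_int (u 0):]"
  have Pint: "coeff P i \<in> \<int>" for i
    by (auto simp: P_def coeff_sum coeff_pCons split: nat.split intro!: Ints_diff Ints_sum)
  have Pval: "poly P (unity_root p (int r)) = of_int (u r - u 0)" if "r < p" for r
    using u[OF that]
    by (simp add: P_def poly_sum poly_monom unity_root_power mult.commute)
  define Q where "Q = P ^ (p - 1)"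
  have "\<exists>m. coeff Q i = of_int m" for i
    using coeff_power_Ints[of P "p - 1" i] Pint by (auto simp: Q_def Ints_def)
  then obtain q where q: "\<And>i. coeff Q i = of_int (q i)" by metis
  have "(of_int (\<Sum>r<p. (u r - u 0) ^ (p - 1)) :: complex) = (\<Sum>r<p. poly Q (unity_root p (int r)))"
    by (simp add: Q_def Pval)
  also have "\<dots> = (\<Sum>r<p. \<Sum>i\<le>degree Q. of_int (q i) * unity_root p (int r * int i))"
    by (simp add: poly_altdef q unity_root_power mult.commute)
  also have "\<dots> = (\<Sum>i\<le>degree Q. of_int (q i) * (\<Sum>r<p. unity_root p (int r * int i)))"
    by (subst sum.swap) (simp add: sum_distrib_left)
  also have "\<dots> = of_int (\<Sum>i\<le>degree Q. q i * (if int p dvd int i then int p else 0))"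
    unfolding of_int_sum using p0 by (intro sum.cong) (auto simp: sum_unity_root)
  finally have "(\<Sum>r<p. (u r - u 0) ^ (p - 1)) = (\<Sum>i\<le>degree Q. q i * (if int p dvd int i then int p else 0))"
    using of_int_eq_iff by blast
  then have dvd: "int p dvd (\<Sum>r<p. (u r - u 0) ^ (p - 1))"
    by (auto intro!: dvd_sum)
  have fermat: "[(u r - u 0) ^ (p - 1) = (if int p dvd u r - u 0 then 0 else 1)] (mod int p)" for r
  proof (cases "int p dvd u r - u 0")
    case True
    then show ?thesis using p1 by (auto simp: cong_0_iff intro: dvd_power_same dvd_trans[OF _ dvd_power])
  next
    case False
    then have cop: "coprime (u r - u 0) (int p)"
      using p by (metis coprime_commute prime_imp_coprime prime_nat_int_transfer)
    have "residues (int p)" using p1 by unfold_locales simp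
    from residues.euler_theorem[OF this cop]
    have "[(u r - u 0) ^ totient p = 1] (mod int p)" by simp
    then show ?thesis using False p by (simp add: totient_prime)
  qed
  define S where "S = {r\<in>{..<p}. \<not> int p dvd u r - u 0}"
  have "[(\<Sum>r<p. (u r - u 0) ^ (p - 1)) = (\<Sum>r<p. if int p dvd u r - u 0 then 0 else 1)] (mod int p)"
    by (intro cong_sum fermat)
  also have "(\<Sum>r<p. if int p dvd u r - u 0 then 0 else 1 :: int) = int (card S)"
    by (simp add: S_def sum.If_cases Collect_neg_eq Diff_eq Int_def)
  finally have "int p dvd int (card S)"
    using dvd by (simp add: cong_dvd_iff)
  moreover have "card S < p"
  proof -
    have "S \<subseteq> {1..<p}" by (auto simp: S_def intro!: Suc_leI gr0I)
    then have "card S \<le> p - 1" using card_mono[of "{1..<p}" S] by simp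
    then show ?thesis using p0 by simp
  qed
  ultimately have "card S = 0" using nat_dvd_not_less by fastforce
  then have "S = {}" by (simp add: S_def)
  then show ?thesis using r by (auto simp: S_def)
qed

text \<open>Infinite descent: the previous lemma, applied to the transform and to its inverse transform,
  shows that \<open>p\<close> divides the differences \<open>c i - c 1\<close>, and the quotients again have an integer transform.\<close>

lemma integer_transform_const:
  fixes c u :: "nat \<Rightarrow> int"
  assumes p: "Factorial_Ring.prime p"
    and u: "\<And>r. r < p \<Longrightarrow> (\<Sum>k<p. of_int (c k) * unity_root p (int r * int k)) = of_int (u r)"
    and "0 < i" "i < p"
  shows "c i = c 1"
proof -
  have p0: "p > 0" and p1: "p > 1" using prime_gt_1_nat[OF p] by auto
  \<comment> \<open>The claim is first proved for sequences normalised by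
    \<open>d 0 = d 1 = 0\<close>, by induction on the sum of the absolute values, which drops when a
    nonzero sequence is divided by \<open>p\<close>.\<close>
  have key: "d i = 0"
    if "d 0 = 0" "d 1 = 0"
      "\<And>r. r < p \<Longrightarrow> (\<Sum>k<p. of_int (d k) * unity_root p (int r * int k)) = of_int (v r)" "i < p"
    for d v :: "nat \<Rightarrow> int" and i
    using that
  proof (induction "\<Sum>i<p. nat \<bar>d i\<bar>" arbitrary: d v i rule: less_induct)
    case less
    show ?case
    proof (cases "\<forall>i<p. d i = 0")
      case True
      then show ?thesis using less.prems by auto
    next
      case False
      have "int p dvd v r - v 0" if "r < p" for r
        using integer_transform_cong[OF p less.prems(3)] that by blast
      then have "\<exists>m. v r = v 0 + int p * m" if "r < p" for r
        using that by (metis add.commute diff_add_cancel dvdE)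
      then obtain m where m: "\<And>r. r < p \<Longrightarrow> v r = v 0 + int p * m r" by metis
      \<comment> \<open>Fourier inversion: the transform of \<open>m\<close> at \<open>j\<close> is
        the entry of \<open>d\<close> at the residue of \<open>- j\<close>, corrected by
        \<open>v 0\<close> at \<open>j = 0\<close>. It is integral, so the congruence lemma applies
        to \<open>m\<close> too.\<close>
      have inv: "(\<Sum>r<p. of_int (m r) * unity_root p (int j * int r))
          = of_int (d (if j = 0 then 0 else p - j) - (if j = 0 then v 0 else 0))" if j: "j < p" for j
      proof -
        define j' where "j' = (if j = 0 then 0 else p - j)"
        have j': "j' < p" using j p0 by (auto simp: j'_def)
        have dv: "int p dvd int k + int j \<longleftrightarrow> k = j'" if k: "k < p" for k
        proof
          assume "int p dvd int k + int j"
          then have "p dvd k + j" using of_nat_dvd_iff by fastforce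
          then obtain t where t: "k + j = p * t" by auto
          have "p * t < p * 2" using t j k by linarith
          then have "t = 0 \<or> t = 1" by auto
          then show "k = j'" using t j k by (auto simp: j'_def)
        next
          assume "k = j'"
          then show "int p dvd int k + int j" using j by (auto simp: j'_def)
        qed
        have "(\<Sum>r<p. of_int (v r) * unity_root p (int j * int r))
            = (\<Sum>r<p. \<Sum>k<p. of_int (d k) * (unity_root p (int r * int k) * unity_root p (int j * int r)))"
        proof (rule sum.cong[OF HOL.refl])
          fix r assume "r \<in> {..<p}"
          then have "of_int (v r) = (\<Sum>k<p. of_int (d k) * unity_root p (int r * int k))"
            using less.prems(3) by simp
          then show "of_int (v r) * unity_root p (int j * int r)
            = (\<Sum>k<p. of_int (d k) * (unity_root p (int r * int k) * unity_root p (int j * int r)))"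
            by (simp add: sum_distrib_right mult.assoc)
        qed
        also have "\<dots> = (\<Sum>k<p. of_int (d k) * (\<Sum>r<p. unity_root p (int r * (int k + int j))))"
        proof -
          have "unity_root p (int r * int k) * unity_root p (int j * int r) = unity_root p (int r * (int k + int j))" for r k
            unfolding unity_root_add[symmetric] by (simp add: distrib_left mult.commute)
          then show ?thesis by (subst sum.swap) (simp only: sum_distrib_left)
        qed
        also have "\<dots> = (\<Sum>k<p. if k = j' then of_int (d k) * of_nat p else 0)"
          by (intro sum.cong HOL.refl) (use p0 dv in \<open>auto simp: sum_unity_root\<close>)
        also have "\<dots> = of_int (d j') * of_nat p" using j' by simp
        finally have 1: "(\<Sum>r<p. of_int (v r) * unity_root p (int j * int r)) = of_int (d j') * of_nat p" .
        have "(\<Sum>r<p. of_int (v r) * unity_root p (int j * int r))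
            = of_int (v 0) * (\<Sum>r<p. unity_root p (int r * int j))
              + of_nat p * (\<Sum>r<p. of_int (m r) * unity_root p (int j * int r))"
        proof -
          have "of_int (v r) * unity_root p (int j * int r) = of_int (v 0) * unity_root p (int r * int j)
              + of_nat p * (of_int (m r) * unity_root p (int j * int r))" if "r < p" for r
            unfolding m[OF that] by (simp add: algebra_simps)
          then have "(\<Sum>r<p. of_int (v r) * unity_root p (int j * int r)) = (\<Sum>r<p. of_int (v 0) * unity_root p (int r * int j)
              + of_nat p * (of_int (m r) * unity_root p (int j * int r)))"
            by (intro sum.cong) auto
          then show ?thesis by (simp add: sum.distrib sum_distrib_left)
        qed
        also have "(\<Sum>r<p. unity_root p (int r * int j)) = (if j = 0 then of_nat p else 0)"
        proof -
          have "int p dvd int j \<longleftrightarrow> j = 0" using j by (auto dest: zdvd_imp_le)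
          then show ?thesis using p0 by (simp add: sum_unity_root)
        qed
        finally have "of_nat p * (\<Sum>r<p. of_int (m r) * unity_root p (int j * int r))
           = of_int (d j') * of_nat p - of_int (v 0) * (if j = 0 then of_nat p else 0)"
          using 1 by (metis add_diff_cancel_left')
        also have "\<dots> = of_nat p * of_int (d j' - (if j = 0 then v 0 else 0))"
          by (simp add: right_diff_distrib mult.commute)
        finally show ?thesis using p0 by (simp only: mult_cancel_left j'_def) auto
      qed
      note dv = integer_transform_cong[OF p inv]
      \<comment> \<open>The index \<open>p - 1\<close> picks out \<open>d 1\<close>, which is zero,
        so the congruence is a statement about \<open>v 0\<close> alone. The other indices then give
        divisibility of the remaining \<open>d j\<close>.\<close>
      have v0: "int p dvd v 0"
        using dv[of "p - 1"] p1 less.prems(1,2) by simp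
      have dvdd: "int p dvd d j" if j: "j < p" for j
      proof (cases "j = 0")
        case True
        then show ?thesis using less.prems(1) by simp
      next
        case False
        then have "int p dvd d j + v 0"
          using dv[of "p - j"] j less.prems(1) by simp
        then show ?thesis using v0 by (simp add: dvd_add_left_iff)
      qed
      \<comment> \<open>The entries of \<open>d\<close> and the values of \<open>v\<close> are all
        multiples of \<open>p\<close>, so the quotients satisfy the same hypotheses.\<close>
      define d' where "d' = (\<lambda>j. d j div int p)"
      have d': "d j = int p * d' j" if "j < p" for j
        using dvdd[OF that] by (simp add: d'_def)
      have v: "v r = int p * (v r div int p)" if "r < p" for r
      proof -
        have "int p dvd v r" unfolding m[OF that] using v0 by simp
        then show ?thesis by simp
      qed
      have "of_nat p * (\<Sum>k<p. of_int (d' k) * unity_root p (int r * int k)) = of_nat p * (of_int (v r div int p) :: complex)"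
        if "r < p" for r
      proof -
        have "of_nat p * (\<Sum>k<p. of_int (d' k) * unity_root p (int r * int k))
           = (\<Sum>k<p. of_int (d k) * unity_root p (int r * int k))"
          by (auto simp: sum_distrib_left d' mult.assoc intro!: sum.cong)
        also have "\<dots> = of_int (int p * (v r div int p))"
          using less.prems(3)[OF that] v[OF that] by simp
        finally show ?thesis by simp
      qed
      then have tr: "(\<Sum>k<p. of_int (d' k) * unity_root p (int r * int k)) = of_int (v r div int p)" 
        if "r < p" for r
        using that p0 by simp
      have le: "nat \<bar>d' i\<bar> \<le> nat \<bar>d i\<bar>" if "i < p" for i
        using d'[OF that] p1 by (simp add: abs_mult mult_le_cancel_right1 nat_le_eq_zle)
      obtain i0 where i0: "i0 < p" "d i0 \<noteq> 0" using False by auto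
      have "nat \<bar>d' i0\<bar> < nat \<bar>d i0\<bar>"
        using d'[OF i0(1)] i0(2) p1 by (simp add: abs_mult)
      then have "(\<Sum>i<p. nat \<bar>d' i\<bar>) < (\<Sum>i<p. nat \<bar>d i\<bar>)"
        using le i0 by (intro sum_strict_mono_ex1) auto
      then have "d' j = 0" if "j < p" for j
        using less.hyps[OF _ _ _ tr that] less.prems(1,2) by (simp add: d'_def)
      then show ?thesis using d' less.prems(4) by simp
    qed
  qed
  \<comment> \<open>Subtracting the constant \<open>c 1\<close> changes the transform only at
    \<open>r = 0\<close>, and replacing the entry at \<open>0\<close> shifts it by a constant;
    integrality survives both.\<close>
  define d where "d = (\<lambda>k. if k = 0 then 0 else c k - c 1)"
  define v where "v = (\<lambda>r. u r - (c 0 - c 1) - (if r = 0 then int p * c 1 else 0))"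
  have tr: "(\<Sum>k<p. of_int (d k) * unity_root p (int r * int k)) = of_int (v r)" if r: "r < p" for r
  proof -
    have "(\<Sum>k<p. of_int (d k) * unity_root p (int r * int k))
      = (\<Sum>k<p. of_int (c k) * unity_root p (int r * int k) - of_int (c 1) * unity_root p (int k * int r)
          - (if k = 0 then of_int (c 0 - c 1) else 0))"
      by (intro sum.cong HOL.refl) (auto simp: d_def algebra_simps)
    also have "\<dots> = of_int (u r) - of_int (c 1) * (\<Sum>k<p. unity_root p (int k * int r)) - of_int (c 0 - c 1)"
      using p0 u[OF r] by (simp add: sum_subtractf sum_distrib_left)
    also have "(\<Sum>k<p. unity_root p (int k * int r)) = (if r = 0 then of_nat p else 0)"
    proof -
      have "int p dvd int r \<longleftrightarrow> r = 0" using r by (auto dest: zdvd_imp_le)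
      then show ?thesis using p0 by (simp add: sum_unity_root)
    qed
    finally show ?thesis by (simp add: v_def)
  qed
  have "d i = 0" by (rule key[OF _ _ tr assms(4)]) (simp_all add: d_def)
  then show ?thesis using assms(3) by (simp add: d_def)
qed

section \<open>Averages of matrix representations\<close>

lemma mat_trace_mult_commute:
  fixes A B :: "'a :: comm_semiring_0 mat"
  assumes "A \<in> carrier_mat n m" "B \<in> carrier_mat m n"
  shows "mat_trace (A * B) = mat_trace (B * A)"
proof -
  have "mat_trace (A * B) = (\<Sum>i<n. \<Sum>k<m. A $$ (i, k) * B $$ (k, i))"
    using assms by (auto simp: mat_trace_def scalar_prod_def atLeast0LessThan intro!: sum.cong)
  also have "\<dots> = (\<Sum>k<m. \<Sum>i<n. B $$ (k, i) * A $$ (i, k))"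
    by (subst sum.swap) (simp add: mult.commute)
  also have "\<dots> = mat_trace (B * A)"
    using assms by (auto simp: mat_trace_def scalar_prod_def atLeast0LessThan intro!: sum.cong)
  finally show ?thesis .
qed

text \<open>The Schur triangular form of \<open>E\<close> is again idempotent, so its diagonal
  entries are 0 or 1 and the trace counts the ones. If the diagonal is zero, a triangular idempotent
  is nilpotent and hence zero.\<close>

lemma idempotent_trace:
  fixes E :: "complex mat"
  assumes E: "E \<in> carrier_mat n n" and idem: "E * E = E"
  shows "\<exists>k. mat_trace E = of_nat k" and "mat_trace E = 0 \<Longrightarrow> E = 0\<^sub>m n n"
proof -
  obtain as where as: "char_poly E = (\<Prod>a\<leftarrow>as. [:- a, 1:])"
    using char_poly_factorized[OF E] by auto
  obtain B P Q where "schur_decomposition E as = (B, P, Q)"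
    by (cases "schur_decomposition E as")
  from schur_decomposition[OF E as this]
  have wit: "similar_mat_wit E B P Q" and ut: "upper_triangular B" by auto
  have [simp]: "B \<in> carrier_mat n n" "P \<in> carrier_mat n n" "Q \<in> carrier_mat n n"
    and PQ: "P * Q = 1\<^sub>m n" and QP: "Q * P = 1\<^sub>m n" and EB: "E = P * B * Q"
    using wit E by (auto simp: similar_mat_wit_def Let_def)
  have dim: "dim_row B = n" "dim_col B = n"
    using \<open>B \<in> carrier_mat n n\<close> by (simp_all del: \<open>B \<in> carrier_mat n n\<close>)
  have B_eq: "B = Q * E * P"
  proof -
    have "Q * E * P = (Q * P) * B * (Q * P)"
      unfolding EB by (simp add: mult_carrier_mat[of _ n n _ n] assoc_mult_mat[of _ n n _ n _ n])
    then show ?thesis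
      by (simp add: QP left_mult_one_mat[of B n n] right_mult_one_mat[of B n n])
  qed
  have "B * B = Q * E * (P * Q) * E * P"
    unfolding B_eq using E by (simp add: mult_carrier_mat[of _ n n _ n] assoc_mult_mat[of _ n n _ n _ n])
  also have "\<dots> = Q * (E * E) * P"
    using E by (simp add: PQ mult_carrier_mat[of _ n n _ n] assoc_mult_mat[of _ n n _ n _ n])
  finally have BB: "B * B = B" by (simp add: idem B_eq)
  have entry: "B $$ (i, j) = (\<Sum>k<n. B $$ (i, k) * B $$ (k, j))" if "i < n" "j < n" for i j
  proof -
    have "(B * B) $$ (i, j) = (\<Sum>k<n. B $$ (i, k) * B $$ (k, j))"
      using that dim by (simp add: scalar_prod_def atLeast0LessThan)
    then show ?thesis by (simp add: BB)
  qed
  have low: "B $$ (i, j) = 0" if "j < i" "i < n" for i j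
    using ut that dim by (simp add: upper_triangular_def)
  have diag: "B $$ (i, i) = 0 \<or> B $$ (i, i) = 1" if i: "i < n" for i
  proof -
    have "B $$ (i, k) * B $$ (k, i) = (if k = i then B $$ (i, i) * B $$ (i, i) else 0)" if "k < n" for k
      using low[of k i] low[of i k] i that by (cases k i rule: linorder_cases) auto
    then have "(\<Sum>k<n. B $$ (i, k) * B $$ (k, i)) = (\<Sum>k<n. if k = i then B $$ (i, i) * B $$ (i, i) else 0)"
      by (intro sum.cong) auto
    then have "B $$ (i, i) = B $$ (i, i) * B $$ (i, i)"
      using entry[OF i i] i by (simp only: sum.delta finite_lessThan) simp
    then show ?thesis by simp
  qed
  have tr: "mat_trace E = (\<Sum>i<n. B $$ (i, i))"
  proof -
    have "mat_trace E = mat_trace (P * (B * Q))"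
      unfolding EB by (simp add: mult_carrier_mat[of _ n n _ n] assoc_mult_mat[of _ n n _ n _ n])
    also have "\<dots> = mat_trace (B * Q * P)"
      by (rule mat_trace_mult_commute[of _ n n]) (simp_all add: mult_carrier_mat[of _ n n _ n])
    also have "B * Q * P = B"
      by (simp add: mult_carrier_mat[of _ n n _ n] assoc_mult_mat[of _ n n _ n _ n] QP right_mult_one_mat[of B n n])
    finally show ?thesis by (simp add: mat_trace_def dim)
  qed
  also have "\<dots> = (\<Sum>i<n. if B $$ (i, i) = 1 then 1 else 0)"
    using diag by (intro sum.cong) auto
  also have "\<dots> = of_nat (card {i\<in>{..<n}. B $$ (i, i) = 1})"
    by (simp flip: sum.inter_filter)
  finally have card: "mat_trace E = of_nat (card {i\<in>{..<n}. B $$ (i, i) = 1})" .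
  then show "\<exists>k. mat_trace E = of_nat k" by blast
  assume "mat_trace E = 0"
  then have diag0: "B $$ (i, i) = 0" if "i < n" for i
    using card diag[OF that] that by auto
  \<comment> \<open>Induction on the distance from the diagonal: in the product formula for the
    entry \<open>(i, j)\<close> only indices strictly between \<open>i\<close> and \<open>j\<close>
    could contribute, and there \<open>B $$ (i, k)\<close> is closer to the diagonal.\<close>
  have "B $$ (i, j) = 0" if "i < n" "j < n" for i j
    using that
  proof (induction "j - i" arbitrary: i j rule: less_induct)
    case less
    have "B $$ (i, k) * B $$ (k, j) = 0" if "k < n" for k
    proof (cases "k \<le> i \<or> j \<le> k")
      case True
      then show ?thesis
        using low[of k i] low[of j k] diag0 less.prems that by (auto simp: le_less)
    next
      case False
      then show ?thesis using less.hyps[of k i] that less.prems by auto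
    qed
    then have "(\<Sum>k<n. B $$ (i, k) * B $$ (k, j)) = 0" by (intro sum.neutral) auto
    then show ?case using entry[OF less.prems] by simp
  qed
  then have "B = 0\<^sub>m n n" using dim by auto
  then show "E = 0\<^sub>m n n" unfolding EB
    by (simp add: right_mult_zero_mat[of P n n] left_mult_zero_mat[of Q n n])
qed

locale finite_matrix_rep = group I for I (structure) +
  fixes \<sigma> :: "'a \<Rightarrow> complex mat" and n :: nat
  assumes finite_carrier: "finite (carrier I)"
    and rep_carrier: "x \<in> carrier I \<Longrightarrow> \<sigma> x \<in> carrier_mat n n"
    and rep_mult: "x \<in> carrier I \<Longrightarrow> y \<in> carrier I \<Longrightarrow> \<sigma> (x \<otimes> y) = \<sigma> x * \<sigma> y"
begin

text \<open>The projection onto the vectors fixed by all \<open>\<sigma> x\<close>; its trace is the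
  multiplicity of the trivial character.\<close>

definition average :: "complex mat" where
  "average = mat n n (\<lambda>(i, j). (\<Sum>x\<in>carrier I. \<sigma> x $$ (i, j)) / of_nat (Coset.order I))"

lemma average_carrier [simp]: "average \<in> carrier_mat n n"
  by (simp add: average_def)

lemma order_pos: "Coset.order I > 0"
  using finite_carrier order_gt_0_iff_finite by blast

lemma rep_dim [simp]:
  "x \<in> carrier I \<Longrightarrow> dim_row (\<sigma> x) = n" "x \<in> carrier I \<Longrightarrow> dim_col (\<sigma> x) = n"
  using rep_carrier by auto

lemma bij_left_mult: "x \<in> carrier I \<Longrightarrow> bij_betw (\<lambda>y. x \<otimes> y) (carrier I) (carrier I)"
  using inj_on_cmult surj_const_mult by (auto simp: bij_betw_def)

lemma rep_mult_average:
  assumes x: "x \<in> carrier I"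
  shows "\<sigma> x * average = average"
proof (rule eq_matI)
  fix i j assume "i < dim_row average" "j < dim_col average"
  then have ij: "i < n" "j < n" by (simp_all add: average_def)
  have "(\<sigma> x * average) $$ (i, j) = (\<Sum>k<n. \<sigma> x $$ (i, k) * ((\<Sum>y\<in>carrier I. \<sigma> y $$ (k, j)) / of_nat (Coset.order I)))"
    using ij x by (simp add: average_def scalar_prod_def atLeast0LessThan)
  also have "\<dots> = (\<Sum>y\<in>carrier I. \<Sum>k<n. \<sigma> x $$ (i, k) * \<sigma> y $$ (k, j)) / of_nat (Coset.order I)"
    by (subst sum.swap) (simp add: sum_distrib_left sum_divide_distrib)
  also have "(\<Sum>y\<in>carrier I. \<Sum>k<n. \<sigma> x $$ (i, k) * \<sigma> y $$ (k, j)) = (\<Sum>y\<in>carrier I. \<sigma> (x \<otimes> y) $$ (i, j))"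
    using ij x by (intro sum.cong HOL.refl) (simp add: rep_mult scalar_prod_def atLeast0LessThan)
  also have "\<dots> = (\<Sum>y\<in>carrier I. \<sigma> y $$ (i, j))"
    by (rule sum.reindex_bij_betw[OF bij_left_mult[OF x]])
  finally show "(\<sigma> x * average) $$ (i, j) = average $$ (i, j)"
    using ij by (simp add: average_def)
qed (use x in \<open>simp_all add: average_def\<close>)

lemma average_idempotent: "average * average = average"
proof (rule eq_matI)
  fix i j assume "i < dim_row average" "j < dim_col average"
  then have ij: "i < n" "j < n" by (simp_all add: average_def)
  have "(average * average) $$ (i, j) = (\<Sum>k<n. (\<Sum>x\<in>carrier I. \<sigma> x $$ (i, k)) / of_nat (Coset.order I) * average $$ (k, j))"
    using ij by (simp add: average_def scalar_prod_def atLeast0LessThan)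
  also have "\<dots> = (\<Sum>x\<in>carrier I. (\<Sum>k<n. \<sigma> x $$ (i, k) * average $$ (k, j))) / of_nat (Coset.order I)"
    by (subst sum.swap) (simp add: sum_distrib_right sum_divide_distrib)
  also have "(\<Sum>x\<in>carrier I. (\<Sum>k<n. \<sigma> x $$ (i, k) * average $$ (k, j))) = (\<Sum>x\<in>carrier I. (\<sigma> x * average) $$ (i, j))"
    using ij by (intro sum.cong HOL.refl) (simp add: scalar_prod_def atLeast0LessThan average_def)
  also have "\<dots> = of_nat (Coset.order I) * average $$ (i, j)"
    by (simp add: rep_mult_average Coset.order_def)
  finally show "(average * average) $$ (i, j) = average $$ (i, j)"
    using order_pos by simp
qed (simp_all add: average_def)

lemma trace_average: "mat_trace average = (\<Sum>x\<in>carrier I. mat_trace (\<sigma> x)) / of_nat (Coset.order I)"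
proof -
  have "mat_trace average = (\<Sum>i<n. \<Sum>x\<in>carrier I. \<sigma> x $$ (i, i)) / of_nat (Coset.order I)"
    by (simp add: mat_trace_def average_def sum_divide_distrib)
  also have "(\<Sum>i<n. \<Sum>x\<in>carrier I. \<sigma> x $$ (i, i)) = (\<Sum>x\<in>carrier I. mat_trace (\<sigma> x))"
    by (subst sum.swap) (simp add: mat_trace_def)
  finally show ?thesis .
qed

text \<open>The trace of the idempotent \<open>average\<close> is a natural number. Applied to a
  representation twisted by a linear character, this says that the multiplicity of the inverse
  character is a natural number.\<close>

lemma sum_trace_eq_order_mult:
  "\<exists>k. (\<Sum>x\<in>carrier I. mat_trace (\<sigma> x)) = of_nat (Coset.order I * k)"
proof -
  obtain k where "mat_trace average = of_nat k"
    using idempotent_trace(1)[OF average_carrier average_idempotent] by blast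
  then have "(\<Sum>x\<in>carrier I. mat_trace (\<sigma> x)) = of_nat (Coset.order I * k)"
    using order_pos by (simp add: trace_average field_simps)
  then show ?thesis ..
qed

text \<open>The complement \<open>1\<^sub>m n - average\<close> is an idempotent of trace zero, so
  it vanishes and every vector is fixed.\<close>

lemma trivial_if_sum_trace_maximal:
  assumes "(\<Sum>x\<in>carrier I. mat_trace (\<sigma> x)) = of_nat (Coset.order I * n)" and x: "x \<in> carrier I"
  shows "\<sigma> x = 1\<^sub>m n"
proof -
  have tr: "mat_trace average = of_nat n"
    using assms(1) order_pos by (simp add: trace_average)
  define F where "F = 1\<^sub>m n - average"
  have F: "F \<in> carrier_mat n n" by (simp add: F_def minus_carrier_mat)
  have "F * F = F * 1\<^sub>m n - F * average"
    unfolding F_def by (rule mult_minus_distrib_mat[of _ n n _ n]) (simp_all add: minus_carrier_mat)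
  also have "F * average = 1\<^sub>m n * average - average * average"
    unfolding F_def by (rule minus_mult_distrib_mat[of _ n n _ _ n]) simp_all
  also have "\<dots> = 0\<^sub>m n n"
    by (simp add: average_idempotent left_mult_one_mat[OF average_carrier] minus_r_inv_mat[OF average_carrier])
  also have "F * 1\<^sub>m n - 0\<^sub>m n n = F"
    unfolding right_mult_one_mat[OF F] using F by (intro eq_matI) auto
  finally have "F * F = F" .
  moreover have "mat_trace F = 0"
  proof -
    have "mat_trace F = (\<Sum>i<n. 1 - average $$ (i, i))"
      by (simp add: F_def mat_trace_def average_def)
    also have "\<dots> = of_nat n - mat_trace average"
      by (simp add: sum_subtractf mat_trace_def average_def)
    finally show ?thesis by (simp add: tr)
  qed
  ultimately have F0: "F = 0\<^sub>m n n" using idempotent_trace(2)[OF F] by blast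
  have "average = 1\<^sub>m n"
  proof (rule eq_matI)
    fix i j assume ij: "i < dim_row (1\<^sub>m n :: complex mat)" "j < dim_col (1\<^sub>m n :: complex mat)"
    have "F $$ (i, j) = 0" using ij F0 by simp
    then show "average $$ (i, j) = 1\<^sub>m n $$ (i, j)"
      using ij by (simp add: F_def average_def)
  qed (simp_all add: average_def)
  then show ?thesis using rep_mult_average[OF x] rep_carrier[OF x] by simp
qed

end

section \<open>Commutators in groups\<close>

context group
begin

lemma center_carrier: "z \<in> center G \<Longrightarrow> z \<in> carrier G"
  by (simp add: center_def)

lemma center_commute: "z \<in> center G \<Longrightarrow> x \<in> carrier G \<Longrightarrow> z \<otimes> x = x \<otimes> z"
  by (simp add: center_def)

lemma subgroup_center: "subgroup (center G) G"
proof (rule subgroupI)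
  have "\<one> \<in> center G" by (simp add: center_def)
  then show "center G \<noteq> {}" by blast
  show "center G \<subseteq> carrier G" using center_carrier by blast
  fix a assume a: "a \<in> center G"
  show "inv a \<in> center G"
    unfolding center_def
  proof (intro CollectI conjI ballI)
    fix g assume g: "g \<in> carrier G"
    have "a \<otimes> inv g = inv g \<otimes> a" using g by (intro center_commute[OF a]) simp
    then have "inv (a \<otimes> inv g) = inv (inv g \<otimes> a)" by simp
    then show "inv a \<otimes> g = g \<otimes> inv a" using a g by (simp add: center_carrier inv_mult_group)
  qed (use a center_carrier in simp)
  fix b assume b: "b \<in> center G"
  have "a \<otimes> b \<otimes> g = g \<otimes> (a \<otimes> b)" if g: "g \<in> carrier G" for g
  proof -
    have "a \<otimes> b \<otimes> g = a \<otimes> (g \<otimes> b)"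
      using a b g by (simp add: m_assoc center_carrier center_commute[OF b])
    also have "\<dots> = g \<otimes> a \<otimes> b"
      using a b g by (simp add: m_assoc[symmetric] center_carrier center_commute[OF a])
    finally show ?thesis using a b g by (simp add: m_assoc center_carrier)
  qed
  then show "a \<otimes> b \<in> center G"
    unfolding center_def using a b center_carrier by simp
qed

lemma normal_if_central:
  assumes "subgroup K G" "K \<subseteq> center G"
  shows "K \<lhd> G"
  unfolding normal_inv_iff
proof (intro conjI ballI)
  fix x h assume x: "x \<in> carrier G" and h: "h \<in> K"
  then have hc: "h \<in> center G" using assms by blast
  have "x \<otimes> h \<otimes> inv x = h \<otimes> x \<otimes> inv x"
    using center_commute[OF hc x] by simp
  also have "\<dots> = h" using x center_carrier[OF hc] by (simp add: m_assoc)
  finally show "x \<otimes> h \<otimes> inv x \<in> K" using h by simp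
qed (rule assms)

lemma normal_center: "center G \<lhd> G"
  by (simp add: normal_if_central subgroup_center)

lemma mult_inv_cancel_left:
  "a \<in> carrier G \<Longrightarrow> b \<in> carrier G \<Longrightarrow> a \<otimes> (inv a \<otimes> b) = b"
  by (simp add: m_assoc[symmetric])

lemma commutator_closed [simp, intro]:
  "x \<in> carrier G \<Longrightarrow> y \<in> carrier G \<Longrightarrow> commutator G x y \<in> carrier G"
  by (simp add: commutator_def)

lemma mult_commutator:
  assumes "x \<in> carrier G" "y \<in> carrier G"
  shows "y \<otimes> x \<otimes> commutator G x y = x \<otimes> y"
proof -
  have "commutator G x y = inv (y \<otimes> x) \<otimes> (x \<otimes> y)"
    using assms by (simp add: commutator_def inv_mult_group m_assoc)
  then show ?thesis using assms by (simp only: mult_inv_cancel_left m_closed)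
qed

lemma commutator_eqI:
  assumes "x \<in> carrier G" "y \<in> carrier G" "z \<in> carrier G" "x \<otimes> y = y \<otimes> x \<otimes> z"
  shows "commutator G x y = z"
  using assms mult_commutator[of x y] Units_l_cancel[of "y \<otimes> x" "commutator G x y" z]
  by simp

lemma commutator_eq_one_iff:
  assumes "x \<in> carrier G" "y \<in> carrier G"
  shows "commutator G x y = \<one> \<longleftrightarrow> x \<otimes> y = y \<otimes> x"
proof
  assume "commutator G x y = \<one>"
  then show "x \<otimes> y = y \<otimes> x" using mult_commutator[OF assms] assms by simp
next
  assume "x \<otimes> y = y \<otimes> x"
  then show "commutator G x y = \<one>" using assms by (intro commutator_eqI) simp_all
qed

lemma center_iff_commutator:
  "x \<in> center G \<longleftrightarrow> x \<in> carrier G \<and> (\<forall>y\<in>carrier G. commutator G x y = \<one>)"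
  by (auto simp: center_def commutator_eq_one_iff)

lemma commutator_in_derived:
  assumes "x \<in> carrier G" "y \<in> carrier G"
  shows "commutator G x y \<in> derived G (carrier G)"
proof -
  have "inv x \<otimes> inv y \<otimes> inv (inv x) \<otimes> inv (inv y) \<in> derived_set G (carrier G)"
    using assms inv_closed[OF assms(1)] inv_closed[OF assms(2)] by (intro UN_I[of "inv x"] UN_I[of "inv y"] singletonI)
  then show ?thesis
    using assms by (simp add: derived_def commutator_def generate.incl)
qed

lemma derived_subset:
  assumes "subgroup N G" "\<And>x y. x \<in> carrier G \<Longrightarrow> y \<in> carrier G \<Longrightarrow> commutator G x y \<in> N"
  shows "derived G (carrier G) \<subseteq> N"
  unfolding derived_def
proof (rule generate_subgroup_incl[OF _ assms(1)], safe)
  fix x y assume "x \<in> carrier G" "y \<in> carrier G"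
  then show "x \<otimes> y \<otimes> inv x \<otimes> inv y \<in> N"
    using assms(2)[of "inv x" "inv y"] by (simp add: commutator_def)
qed

text \<open>This rule and the next two are phrased with an explicit central factor instead of
  \<open>commutator\<close>. In this form they serve both semi-extraspecial groups and the presented
  group, where the central factor is a product of powers of the two \<beta> generators.\<close>

lemma commutation_mult_left:
  assumes "x \<in> carrier G" "x' \<in> carrier G" "y \<in> carrier G" "z \<in> center G" "z' \<in> center G"
    and 1: "x \<otimes> y = y \<otimes> x \<otimes> z" and 2: "x' \<otimes> y = y \<otimes> x' \<otimes> z'"
  shows "x \<otimes> x' \<otimes> y = y \<otimes> (x \<otimes> x') \<otimes> (z \<otimes> z')"
proof -
  note [simp] = center_carrier
  have "x \<otimes> x' \<otimes> y = x \<otimes> (y \<otimes> x' \<otimes> z')"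
    unfolding 2[symmetric] using assms(1-5) by (simp add: m_assoc)
  also have "\<dots> = (x \<otimes> y) \<otimes> (x' \<otimes> z')"
    using assms(1-5) by (simp add: m_assoc)
  also have "\<dots> = y \<otimes> x \<otimes> (z \<otimes> x') \<otimes> z'"
    unfolding 1 using assms(1-5) by (simp add: m_assoc)
  also have "z \<otimes> x' = x' \<otimes> z" using assms(2,4) by (intro center_commute)
  finally show ?thesis using assms(1-5) by (simp add: m_assoc)
qed

lemma commutation_swap:
  assumes "x \<in> carrier G" "y \<in> carrier G" "z \<in> center G" and 1: "x \<otimes> y = y \<otimes> x \<otimes> z"
  shows "y \<otimes> x = x \<otimes> y \<otimes> inv z"
  unfolding 1 using assms(1-3) by (simp add: m_assoc center_carrier)

lemma commutation_inv_left:
  assumes "x \<in> carrier G" "y \<in> carrier G" "z \<in> center G" and 1: "x \<otimes> y = y \<otimes> x \<otimes> z"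
  shows "inv x \<otimes> y = y \<otimes> inv x \<otimes> inv z"
proof -
  note [simp] = center_carrier
  have "x \<otimes> (y \<otimes> inv x \<otimes> inv z) = (x \<otimes> y) \<otimes> (inv x \<otimes> inv z)"
    using assms(1-3) by (simp add: m_assoc)
  also have "\<dots> = y \<otimes> x \<otimes> (z \<otimes> inv x) \<otimes> inv z"
    unfolding 1 using assms(1-3) by (simp add: m_assoc)
  also have "z \<otimes> inv x = inv x \<otimes> z" using assms(1,3) by (intro center_commute) simp_all
  also have "y \<otimes> x \<otimes> (inv x \<otimes> z) \<otimes> inv z = y \<otimes> (x \<otimes> (inv x \<otimes> (z \<otimes> inv z)))"
    using assms(1-3) by (simp only: m_assoc m_closed inv_closed center_carrier)
  also have "\<dots> = y"
    using assms(1-3) by (simp only: mult_inv_cancel_left r_inv m_closed inv_closed center_carrier r_one one_closed)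
  finally show ?thesis
    using assms(1-3) by (simp add: inv_solve_left' center_carrier)
qed

end

lemma (in group) rcoset_eq_iff:
  assumes "subgroup K G" "x \<in> carrier G" "y \<in> carrier G"
  shows "K #> x = K #> y \<longleftrightarrow> x \<otimes> inv y \<in> K"
proof
  assume "K #> x = K #> y"
  then have "x \<in> K #> y" using rcos_self[OF assms(2,1)] by simp
  then obtain k where "k \<in> K" "x = k \<otimes> y" by (auto simp: r_coset_def)
  then show "x \<otimes> inv y \<in> K"
    using assms subgroup.mem_carrier[OF assms(1)] by (simp add: m_assoc)
next
  assume "x \<otimes> inv y \<in> K"
  moreover have "x = x \<otimes> inv y \<otimes> y" using assms by (simp add: m_assoc)
  ultimately have "x \<in> K #> y" by (auto simp: r_coset_def)
  then show "K #> x = K #> y" using repr_independence[of x K y] assms by simp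
qed

section \<open>Semi-extraspecial groups\<close>

locale semi_extraspecial = group G for G (structure) +
  fixes p :: nat
  assumes prime: "Factorial_Ring.prime p" and odd: "odd p"
    and order_G: "Coset.order G = p ^ 6"
    and card_center: "card (center G) = p\<^sup>2"
    and center_exponent: "z \<in> center G \<Longrightarrow> z [^] p = \<one>"
    and commutator_central: "x \<in> carrier G \<Longrightarrow> y \<in> carrier G \<Longrightarrow> commutator G x y \<in> center G"
    and commutator_surjective:
      "x \<in> carrier G \<Longrightarrow> x \<notin> center G \<Longrightarrow> z \<in> center G \<Longrightarrow> \<exists>y\<in>carrier G. commutator G x y = z"

lemma (in group) subgroup_if_finite_closed:
  assumes "finite (carrier G)" "S \<subseteq> carrier G" "S \<noteq> {}"
    and closed: "\<And>a b. a \<in> S \<Longrightarrow> b \<in> S \<Longrightarrow> a \<otimes> b \<in> S"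
  shows "subgroup S G"
proof (rule subgroupI)
  fix a assume a: "a \<in> S"
  then have ac: "a \<in> carrier G" using assms(2) by blast
  have pow: "a [^] Suc n \<in> S" for n :: nat
    by (induction n) (use a ac closed in auto)
  have "Coset.order G > 0" using assms(1) order_gt_0_iff_finite by blast
  then obtain n where n: "Coset.order G = Suc n" by (cases "Coset.order G") auto
  have "a [^] n \<otimes> a = \<one>" using pow_order_eq_1[OF ac] by (simp add: n)
  then have "inv a = a [^] n" using ac by (intro inv_equality) auto
  also have "\<dots> = a [^] n \<otimes> (a [^] n \<otimes> a)"
    using \<open>a [^] n \<otimes> a = \<one>\<close> ac by simp
  also have "\<dots> = a [^] Suc (n + n)"
    using ac by (simp add: nat_pow_mult[symmetric] m_assoc)
  finally show "inv a \<in> S" using pow by simp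
qed (use assms in auto)

text \<open>By Bezout. It is applied with \<open>e = p\<close>: if \<open>x\<close> lies outside
  \<open>S\<close> but its \<open>p\<close>-th power lies inside, then only powers with exponent
  divisible by \<open>p\<close> lie in \<open>S\<close>.\<close>

lemma (in group) mem_if_coprime_pows_mem:
  fixes d e :: int
  assumes S: "subgroup S G" and x: "x \<in> carrier G"
    and mem: "x [^] d \<in> S" "x [^] e \<in> S" and "coprime d e"
  shows "x \<in> S"
proof -
  obtain u v where uv: "d * u + e * v = 1"
    using bezout_int[of d e] \<open>coprime d e\<close> by (metis coprime_imp_gcd_eq_1 mult.commute)
  have "x = x [^] (d * u + e * v)" unfolding uv using x by simp
  also have "\<dots> = (x [^] d) [^] u \<otimes> (x [^] e) [^] v"
    using x by (simp only: int_pow_mult int_pow_pow)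
  also have "\<dots> \<in> S"
    by (intro subgroup.m_closed[OF S] subgroup_int_pow_closed[OF S] mem)
  finally show ?thesis .
qed

context semi_extraspecial
begin

lemma p_gt_2: "p > 2"
  using prime_ge_2_nat[OF prime] odd by (cases "p = 2") auto

lemma finite_G: "finite (carrier G)"
  using order_G p_gt_2 by (metis Coset.order_def card.infinite not_less_zero power_eq_0_iff)

lemma finite_center: "finite (center G)"
  using finite_G center_carrier by (meson finite_subset subsetI)

lemma commutator_mult_left:
  assumes "x \<in> carrier G" "x' \<in> carrier G" "y \<in> carrier G"
  shows "commutator G (x \<otimes> x') y = commutator G x y \<otimes> commutator G x' y"
proof (rule commutator_eqI)
  show "x \<otimes> x' \<otimes> y = y \<otimes> (x \<otimes> x') \<otimes> (commutator G x y \<otimes> commutator G x' y)"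
    using assms commutation_mult_left[of x x' y "commutator G x y" "commutator G x' y"]
    by (simp add: commutator_central mult_commutator)
qed (use assms in auto)

lemma commutator_inv_left:
  assumes "x \<in> carrier G" "y \<in> carrier G"
  shows "commutator G (inv x) y = inv (commutator G x y)"
proof (rule commutator_eqI)
  show "inv x \<otimes> y = y \<otimes> inv x \<otimes> inv (commutator G x y)"
    using assms by (intro commutation_inv_left) (simp_all add: commutator_central mult_commutator)
qed (use assms in auto)

lemma commutator_swap:
  assumes "x \<in> carrier G" "y \<in> carrier G"
  shows "commutator G y x = inv (commutator G x y)"
proof (rule commutator_eqI)
  show "y \<otimes> x = x \<otimes> y \<otimes> inv (commutator G x y)"
    using assms by (intro commutation_swap) (simp_all add: commutator_central mult_commutator)
qed (use assms in auto)

lemma commutator_pow_left: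
  assumes "x \<in> carrier G" "y \<in> carrier G"
  shows "commutator G (x [^] (n :: nat)) y = commutator G x y [^] n"
proof (induction n)
  case 0
  show ?case using assms by (simp add: commutator_eq_one_iff)
next
  case (Suc n)
  then show ?case using assms by (simp add: commutator_mult_left)
qed

lemma pow_p_central:
  assumes "x \<in> carrier G"
  shows "x [^] p \<in> center G"
  using assms center_exponent[OF commutator_central[OF assms]]
  by (simp add: center_iff_commutator commutator_pow_left)

text \<open>The collection formula in class 2: moving one more \<open>x\<close> to the left past
  \<open>y [^] n\<close> costs \<open>n\<close> central commutators.\<close>

lemma mult_pow:
  fixes n :: nat
  assumes "x \<in> carrier G" "y \<in> carrier G"
  shows "(x \<otimes> y) [^] n = x [^] n \<otimes> y [^] n \<otimes> commutator G y x [^] (\<Sum>i<n. i)"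
proof (induction n)
  case (Suc n)
  define c where "c = commutator G y x"
  define s where "s = (\<Sum>i<n. i)"
  have c: "c \<in> center G" "c \<in> carrier G" using assms by (simp_all add: c_def commutator_central)
  have cn: "c [^] k \<in> center G" for k :: nat
    using subgroup_int_pow_closed[OF subgroup_center c(1), of "int k"] by (simp add: int_pow_int)
  have yx: "y [^] n \<otimes> x = x \<otimes> y [^] n \<otimes> c [^] n"
    using mult_commutator[of "y [^] n" x] assms by (simp add: commutator_pow_left c_def)
  have "(x \<otimes> y) [^] Suc n = x [^] n \<otimes> y [^] n \<otimes> c [^] s \<otimes> (x \<otimes> y)"
    by (simp add: Suc c_def s_def)
  also have "\<dots> = x [^] n \<otimes> y [^] n \<otimes> (c [^] s \<otimes> (x \<otimes> y))"
    using assms c by (simp add: m_assoc)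
  also have "c [^] s \<otimes> (x \<otimes> y) = x \<otimes> y \<otimes> c [^] s"
    using assms by (intro center_commute cn) simp
  also have "x [^] n \<otimes> y [^] n \<otimes> (x \<otimes> y \<otimes> c [^] s) = x [^] n \<otimes> (y [^] n \<otimes> x) \<otimes> (y \<otimes> c [^] s)"
    using assms c by (simp add: m_assoc)
  also have "\<dots> = x [^] n \<otimes> x \<otimes> y [^] n \<otimes> (c [^] n \<otimes> (y \<otimes> c [^] s))"
    unfolding yx using assms c by (simp add: m_assoc)
  also have "c [^] n \<otimes> (y \<otimes> c [^] s) = y \<otimes> c [^] s \<otimes> c [^] n"
    using assms c by (intro center_commute cn) simp
  also have "x [^] n \<otimes> x \<otimes> y [^] n \<otimes> (y \<otimes> c [^] s \<otimes> c [^] n) = x [^] Suc n \<otimes> y [^] Suc n \<otimes> (c [^] s \<otimes> c [^] n)"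
    using assms c by (simp add: m_assoc)
  also have "c [^] s \<otimes> c [^] n = c [^] (\<Sum>i<Suc n. i)"
    using c by (simp add: nat_pow_mult s_def)
  finally show ?case by (simp only: c_def)
qed simp

text \<open>The exponent of the commutator is \<open>p * (p - 1) / 2\<close>, a multiple of
  \<open>p\<close> because \<open>p\<close> is odd, and central elements have exponent
  \<open>p\<close>. So taking \<open>p\<close>-th powers is a homomorphism from \<open>G\<close> to
  its center.\<close>

lemma mult_pow_p:
  assumes "x \<in> carrier G" "y \<in> carrier G"
  shows "(x \<otimes> y) [^] p = x [^] p \<otimes> y [^] p"
proof -
  have "2 * (\<Sum>i<p. i) = p * (p - 1)"
    using Sum_Ico_nat[of 0 p] odd by (simp add: atLeast0LessThan)
  then have "p dvd 2 * (\<Sum>i<p. i)" by simp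
  moreover have "coprime p 2" using odd by simp
  ultimately have "p dvd (\<Sum>i<p. i)" using coprime_dvd_mult_right_iff by blast
  then obtain k where k: "(\<Sum>i<p. i) = p * k" by (elim dvdE)
  have "commutator G y x [^] (p * k) = \<one>"
    using assms by (simp add: nat_pow_pow[symmetric] commutator_central center_exponent)
  then show ?thesis using mult_pow[OF assms, of p] assms by (simp add: k)
qed

end

section \<open>Subgroups of order \<open>p ^ 3\<close> with prescribed intersection with the
  center\<close>

locale central_subgroup = semi_extraspecial G p for G (structure) and p +
  fixes K
  assumes subgroup_K: "subgroup K G" and K_central: "K \<subseteq> center G" and card_K: "card K = p"
begin

lemma K_carrier: "k \<in> K \<Longrightarrow> k \<in> carrier G"
  using K_central center_carrier by blast

text \<open>The kernel of the homomorphism from \<open>G\<close> to two copies of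
  \<open>center G / K\<close> given by the \<open>p\<close>-th power and by the commutator with
  \<open>x\<close>. Its elements are the candidates for extending a subgroup generated by
  \<open>K\<close> and \<open>x\<close>.\<close>

definition isotropic :: "'a \<Rightarrow> 'a set" where
  "isotropic x = {g \<in> carrier G. g [^] p \<in> K \<and> commutator G g x \<in> K}"

lemma card_center_cosets: "card ((\<lambda>z. K #> z) ` center G) = p"
proof -
  let ?Z = "G\<lparr>carrier := center G\<rparr>"
  interpret Z: group ?Z by (rule subgroup_imp_group[OF subgroup_center])
  have "subgroup K ?Z" by (rule subgroup_incl[OF subgroup_K subgroup_center K_central])
  from Z.lagrange[OF this] have "card (rcosets\<^bsub>?Z\<^esub> K) * p = p * p"
    by (simp add: card_K card_center Coset.order_def power2_eq_square)
  moreover have "rcosets\<^bsub>?Z\<^esub> K = (\<lambda>z. K #> z) ` center G"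
    by (auto simp: RCOSETS_def r_coset_def)
  ultimately show ?thesis using p_gt_2 by simp
qed

text \<open>The homomorphism \<open>F\<close> takes at most \<open>p\<^sup>2\<close> values, and
  translation by an element of a fibre embeds that fibre into the kernel.\<close>

lemma card_isotropic:
  assumes x: "x \<in> carrier G"
  shows "p ^ 4 \<le> card (isotropic x)"
proof -
  define F where "F = (\<lambda>g. (K #> (g [^] p), K #> commutator G g x))"
  let ?S = "(\<lambda>z. K #> z) ` center G"
  have sub: "F ` carrier G \<subseteq> ?S \<times> ?S"
    using pow_p_central commutator_central x by (auto simp: F_def)
  have "card (F ` carrier G) \<le> card (?S \<times> ?S)"
    by (rule card_mono[OF _ sub]) (simp add: finite_center)
  then have imF: "card (F ` carrier G) \<le> p\<^sup>2"
    by (simp add: card_cartesian_product card_center_cosets power2_eq_square)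
  have fin: "finite (isotropic x)" using finite_G by (simp add: isotropic_def)
  have fiber: "card {g \<in> carrier G. F g = s} \<le> card (isotropic x)" if "s \<in> F ` carrier G" for s
  proof -
    obtain h where h: "h \<in> carrier G" "s = F h" using \<open>s \<in> F ` carrier G\<close> by blast
    show ?thesis
    proof (rule card_inj_on_le[OF _ _ fin])
      show "inj_on (\<lambda>g. g \<otimes> inv h) {g \<in> carrier G. F g = s}"
        using h by (auto simp: inj_on_def)
      show "(\<lambda>g. g \<otimes> inv h) ` {g \<in> carrier G. F g = s} \<subseteq> isotropic x"
      proof
        fix y assume "y \<in> (\<lambda>g. g \<otimes> inv h) ` {g \<in> carrier G. F g = s}"
        then obtain g where g: "g \<in> carrier G" "F g = F h" "y = g \<otimes> inv h" using h by blast
        have "K #> (g [^] p) = K #> (h [^] p)" "K #> commutator G g x = K #> commutator G h x"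
          using g(2) by (simp_all add: F_def)
        then have "g [^] p \<otimes> inv (h [^] p) \<in> K" "commutator G g x \<otimes> inv (commutator G h x) \<in> K"
          using g h x rcoset_eq_iff[OF subgroup_K] by simp_all
        moreover have "(g \<otimes> inv h) [^] p = g [^] p \<otimes> inv (h [^] p)"
          using g h by (simp add: mult_pow_p nat_pow_inv)
        moreover have "commutator G (g \<otimes> inv h) x = commutator G g x \<otimes> inv (commutator G h x)"
          using g h x by (simp add: commutator_mult_left commutator_inv_left)
        ultimately show "y \<in> isotropic x" using g h by (simp add: isotropic_def)
      qed
    qed
  qed
  have "card (carrier G) = card (\<Union>s\<in>F ` carrier G. {g \<in> carrier G. F g = s})"
    by (rule arg_cong[where f = card]) blast
  also have "\<dots> \<le> (\<Sum>s\<in>F ` carrier G. card {g \<in> carrier G. F g = s})"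
    by (rule card_UN_le) (simp add: finite_G)
  also have "\<dots> \<le> card (F ` carrier G) * card (isotropic x)"
    using sum_bounded_above[OF fiber, of "F ` carrier G"] by simp
  also have "\<dots> \<le> p\<^sup>2 * card (isotropic x)" using imF by simp
  finally have "p\<^sup>2 * p ^ 4 \<le> p\<^sup>2 * card (isotropic x)"
    using order_G by (simp add: Coset.order_def flip: power_add)
  then show ?thesis using p_gt_2 by (simp only: mult_le_cancel1) simp
qed

definition cyclic_ext :: "'a set \<Rightarrow> 'a \<Rightarrow> 'a set" where
  "cyclic_ext B x = (\<lambda>(b, i). b \<otimes> x [^] (i :: nat)) ` (B \<times> UNIV)"

text \<open>One extension step. Since \<open>x\<close> commutes with \<open>B\<close> modulo
  \<open>K\<close>, the products \<open>b \<otimes> x [^] i\<close> form a subgroup. Since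
  \<open>x\<close> has order exactly \<open>p\<close> modulo \<open>center G <#> B\<close>, the
  order grows by the factor \<open>p\<close> and no new central elements appear.\<close>

lemma cyclic_ext_properties:
  assumes B: "subgroup B G" "K \<subseteq> B" "B \<inter> center G = K"
    and x: "x \<in> carrier G" "x [^] p \<in> K" "x \<notin> center G <#> B"
    and comm: "\<And>b. b \<in> B \<Longrightarrow> commutator G x b \<in> K"
  shows "subgroup (cyclic_ext B x) G" "K \<subseteq> cyclic_ext B x" "cyclic_ext B x \<inter> center G = K" "card (cyclic_ext B x) = p * card B"
proof -
  have Bc: "b \<in> carrier G" if "b \<in> B" for b using subgroup.mem_carrier[OF B(1) that] .
  have ZB: "subgroup (center G <#> B) G"
    using mult_norm_subgroup[OF normal_center B(1)] .
  have B_ZB: "b \<in> center G <#> B" if "b \<in> B" for b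
    using that subgroup.one_closed[OF subgroup_center] Bc[OF that] by (force simp: set_mult_def)
  have pow_in: "a [^] (n :: nat) \<in> S" if "subgroup S G" "a \<in> S" for a n S
    using subgroup_int_pow_closed[OF that, of "int n"] by (simp add: int_pow_int)
  have xp_B: "x [^] p \<in> B" using x(2) B(2) by blast
  have pow_dvd: "p dvd d" if "x [^] d \<in> center G <#> B" for d :: nat
  proof (rule ccontr)
    assume "\<not> p dvd d"
    then have cop: "coprime (int d) (int p)"
      using prime_imp_coprime[OF prime] coprime_commute coprime_int_iff by blast
    have "x [^] p \<in> center G <#> B" using x(2) B(2) B_ZB by blast
    then have "x \<in> center G <#> B"
      using mem_if_coprime_pows_mem[OF ZB x(1) _ _ cop] that by (simp add: int_pow_int)
    then show False using x(3) by blast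
  qed
  have swap: "\<exists>b'\<in>B. x [^] (i :: nat) \<otimes> b = b' \<otimes> x [^] i" if "b \<in> B" for b i
    using that
  proof (induction i arbitrary: b)
    case 0
    then show ?case using Bc by auto
  next
    case (Suc i)
    define c where "c = commutator G x b"
    have c: "c \<in> K" "c \<in> center G" "c \<in> carrier G" "c \<in> B"
      using comm[OF Suc.prems] K_central B(2) K_carrier by (auto simp: c_def)
    have b: "b \<in> carrier G" using Bc Suc.prems .
    obtain b' where b': "b' \<in> B" "x [^] i \<otimes> (b \<otimes> c) = b' \<otimes> x [^] i"
      using Suc.IH[of "b \<otimes> c"] subgroup.m_closed[OF B(1) Suc.prems c(4)] by blast
    have "x [^] Suc i \<otimes> b = x [^] i \<otimes> (x \<otimes> b)" using x(1) b by (simp add: m_assoc)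
    also have "x \<otimes> b = b \<otimes> x \<otimes> c" using mult_commutator[OF x(1) b] by (simp add: c_def)
    also have "\<dots> = b \<otimes> (c \<otimes> x)"
      using center_commute[OF c(2) x(1)] x(1) b c by (simp add: m_assoc)
    also have "x [^] i \<otimes> (b \<otimes> (c \<otimes> x)) = x [^] i \<otimes> (b \<otimes> c) \<otimes> x"
      using x(1) b c by (simp add: m_assoc)
    also have "\<dots> = b' \<otimes> x [^] Suc i" unfolding b'(2) using x(1) Bc[OF b'(1)] by (simp add: m_assoc)
    finally show ?case using b'(1) by blast
  qed
  have extI: "b \<otimes> x [^] (i :: nat) \<in> cyclic_ext B x" if "b \<in> B" for b i using that by (auto simp: cyclic_ext_def)
  have extE: "\<exists>b\<in>B. \<exists>i::nat. g = b \<otimes> x [^] i" if "g \<in> cyclic_ext B x" for g using that by (auto simp: cyclic_ext_def)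
  have B_ext: "b \<in> cyclic_ext B x" if "b \<in> B" for b using extI[OF that, of 0] Bc[OF that] by simp
  show sub: "subgroup (cyclic_ext B x) G"
  proof (rule subgroup_if_finite_closed[OF finite_G])
    show "cyclic_ext B x \<subseteq> carrier G" using extE Bc x(1) by fastforce
    show "cyclic_ext B x \<noteq> {}" using B_ext subgroup.one_closed[OF B(1)] by blast
    fix g h assume "g \<in> cyclic_ext B x" "h \<in> cyclic_ext B x"
    then obtain b i b' j where g: "b \<in> B" "g = b \<otimes> x [^] (i :: nat)" and h: "b' \<in> B" "h = b' \<otimes> x [^] (j :: nat)"
      using extE by metis
    obtain b'' where b'': "b'' \<in> B" "x [^] i \<otimes> b' = b'' \<otimes> x [^] i" using swap[OF h(1)] by blast
    have "g \<otimes> h = b \<otimes> (x [^] i \<otimes> b') \<otimes> x [^] j"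
      using g h Bc x(1) by (simp add: m_assoc)
    also have "\<dots> = b \<otimes> b'' \<otimes> x [^] (i + j)"
      unfolding b''(2) using g(1) b''(1) Bc x(1) by (simp add: m_assoc nat_pow_mult[symmetric])
    finally show "g \<otimes> h \<in> cyclic_ext B x"
      using extI[OF subgroup.m_closed[OF B(1) g(1) b''(1)]] by simp
  qed
  show "K \<subseteq> cyclic_ext B x" using B(2) B_ext by blast
  show "cyclic_ext B x \<inter> center G = K"
  proof
    show "K \<subseteq> cyclic_ext B x \<inter> center G" using B(2) B_ext K_central by blast
    show "cyclic_ext B x \<inter> center G \<subseteq> K"
    proof
      fix z assume z: "z \<in> cyclic_ext B x \<inter> center G"
      then obtain b i where b: "b \<in> B" "z = b \<otimes> x [^] (i :: nat)" using extE by blast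
      have zc: "z \<in> center G" "z \<in> carrier G" using z center_carrier by auto
      \<comment> \<open>Centrality of \<open>z\<close> places \<open>x [^] i\<close> in
        \<open>center G <#> B\<close>. Then \<open>p\<close> divides \<open>i\<close>, so
        \<open>x [^] i\<close> and \<open>z\<close> already lie in \<open>B\<close>.\<close>
      have "x [^] i = inv b \<otimes> z" using b Bc x(1) by (simp add: m_assoc[symmetric])
      also have "\<dots> = z \<otimes> inv b" using center_commute[OF zc(1)] Bc[OF b(1)] by simp
      also have "\<dots> \<in> center G <#> B"
        using zc subgroup.m_inv_closed[OF B(1) b(1)] by (auto simp: set_mult_def)
      finally obtain k where "i = p * k" using pow_dvd by blast
      then have "x [^] i = (x [^] p) [^] k" using x(1) by (simp add: nat_pow_pow)
      also have "\<dots> \<in> B" using pow_in[OF B(1) xp_B] .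
      finally have "z \<in> B" using b subgroup.m_closed[OF B(1)] by blast
      then show "z \<in> K" using zc B(3) by blast
    qed
  qed
  have "bij_betw (\<lambda>(b, i). b \<otimes> x [^] (i :: nat)) (B \<times> {..<p}) (cyclic_ext B x)"
    unfolding bij_betw_def
  proof
    have le: "i = j" if "b \<in> B" "b' \<in> B" "i \<le> j" "j < p" "b \<otimes> x [^] i = b' \<otimes> x [^] j" for b b' and i j :: nat
    proof -
      have bb: "b \<in> carrier G" "b' \<in> carrier G" using that Bc by auto
      have "b \<otimes> x [^] i = b' \<otimes> x [^] (j - i) \<otimes> x [^] i"
        using that x(1) bb by (simp add: m_assoc nat_pow_mult)
      then have "b = b' \<otimes> x [^] (j - i)"
        using bb x(1) by simp
      then have "x [^] (j - i) = inv b' \<otimes> b"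
        using bb x(1) by (simp add: m_assoc[symmetric])
      then have "x [^] (j - i) \<in> center G <#> B"
        using that subgroup.m_closed[OF B(1) subgroup.m_inv_closed[OF B(1)]] B_ZB by simp
      then have "p dvd j - i" by (rule pow_dvd)
      then show "i = j" using that(3,4) nat_dvd_not_less[of "j - i" p] by (cases "i = j") simp_all
    qed
    show "inj_on (\<lambda>(b, i). b \<otimes> x [^] (i :: nat)) (B \<times> {..<p})"
    proof (rule inj_onI)
      fix s t assume st: "s \<in> B \<times> {..<p}" "t \<in> B \<times> {..<p}"
        "(case s of (b, i) \<Rightarrow> b \<otimes> x [^] (i :: nat)) = (case t of (b, i) \<Rightarrow> b \<otimes> x [^] i)"
      obtain b i b' j where s: "s = (b, i)" and t: "t = (b', j)" by (cases s, cases t)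
      have *: "b \<in> B" "b' \<in> B" "i < p" "j < p" "b \<otimes> x [^] i = b' \<otimes> x [^] j"
        using st by (simp_all add: s t)
      have "i = j"
      proof (cases "i \<le> j")
        case True
        then show ?thesis using le[OF *(1,2) True _ *(5)] *(4) by simp
      next
        case False
        then show ?thesis using le[OF *(2,1) _ _ HOL.sym[OF *(5)]] *(3) by simp
      qed
      moreover have "b = b'" using *(5) Bc[OF *(1)] Bc[OF *(2)] x(1) unfolding \<open>i = j\<close> by simp
      ultimately show "s = t" by (simp add: s t)
    qed
    show "(\<lambda>(b, i). b \<otimes> x [^] (i :: nat)) ` (B \<times> {..<p}) = cyclic_ext B x"
    proof
      show "(\<lambda>(b, i). b \<otimes> x [^] (i :: nat)) ` (B \<times> {..<p}) \<subseteq> cyclic_ext B x" by (auto simp: cyclic_ext_def)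
      show "cyclic_ext B x \<subseteq> (\<lambda>(b, i). b \<otimes> x [^] (i :: nat)) ` (B \<times> {..<p})"
      proof
        fix g assume "g \<in> cyclic_ext B x"
        then obtain b i where b: "b \<in> B" "g = b \<otimes> x [^] (i :: nat)" using extE by blast
        have "x [^] i = x [^] (p * (i div p) + i mod p)" by simp
        also have "\<dots> = (x [^] p) [^] (i div p) \<otimes> x [^] (i mod p)"
          using x(1) by (simp only: nat_pow_pow nat_pow_mult[symmetric])
        finally have "g = b \<otimes> (x [^] p) [^] (i div p) \<otimes> x [^] (i mod p)"
          using b Bc x(1) by (simp add: m_assoc)
        moreover have "b \<otimes> (x [^] p) [^] (i div p) \<in> B"
          using subgroup.m_closed[OF B(1) b(1) pow_in[OF B(1) xp_B]] .
        ultimately show "g \<in> (\<lambda>(b, i). b \<otimes> x [^] (i :: nat)) ` (B \<times> {..<p})"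
          using p_gt_2 by (intro image_eqI[of _ _ "(b \<otimes> (x [^] p) [^] (i div p), i mod p)"]) auto
      qed
    qed
  qed
  from bij_betw_same_card[OF this] show "card (cyclic_ext B x) = p * card B"
    by (simp add: card_cartesian_product mult.commute)
qed

text \<open>Two extension steps starting from \<open>K\<close>, first by \<open>x\<close> and then
  by \<open>y\<close>. Suitable elements exist by counting: the candidate set has at least
  \<open>p ^ 4\<close> elements, whereas the set to be avoided has at most \<open>p\<^sup>2\<close>
  in the first step and \<open>p ^ 3\<close> in the second.\<close>

lemma exists_large_subgroup:
  "\<exists>B. subgroup B G \<and> K \<subseteq> B \<and> B \<inter> center G = K \<and> card B = p ^ 3"
proof -
  have lt: "p ^ i < p ^ j" if "i < j" for i j using that p_gt_2 by (simp add: power_strict_increasing)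
  \<comment> \<open>Every commutator with \<open>\<one>\<close> is trivial, so this set only
    prescribes that the \<open>p\<close>-th power lies in \<open>K\<close>.\<close>
  have "card (center G) < card (isotropic \<one>)"
    using card_isotropic[of \<one>] lt[of 2 4] card_center by simp
  then have "\<not> isotropic \<one> \<subseteq> center G" using finite_center by (meson card_mono not_le)
  then obtain x where x: "x \<in> isotropic \<one>" "x \<notin> center G" by blast
  have xc: "x \<in> carrier G" "x [^] p \<in> K" using x by (auto simp: isotropic_def)
  have KZ: "center G <#> K \<subseteq> center G"
    using K_central subgroup.m_closed[OF subgroup_center] by (auto simp: set_mult_def)
  have "commutator G x k \<in> K" if "k \<in> K" for k
    using that K_central xc(1) K_carrier center_commute[of k x] subgroup.one_closed[OF subgroup_K]
    by (subst commutator_eq_one_iff[THEN iffD2]) auto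
  note E = cyclic_ext_properties[OF subgroup_K subset_refl _ xc _ this]
  define B where "B = cyclic_ext K x"
  have B: "subgroup B G" "K \<subseteq> B" "B \<inter> center G = K" "card B = p * p"
    unfolding B_def using E K_central KZ x(2) card_K by auto
  \<comment> \<open>The factors from \<open>K\<close> and the powers of \<open>x [^] p\<close> are
    central, so each product can be written with an exponent of \<open>x\<close> below
    \<open>p\<close>. This bounds the set by \<open>p\<^sup>2 * p\<close>.\<close>
  have "center G <#> B \<subseteq> (\<lambda>(z, i). z \<otimes> x [^] (i :: nat)) ` (center G \<times> {..<p})"
  proof
    fix g assume "g \<in> center G <#> B"
    then obtain z b where zb: "z \<in> center G" "b \<in> B" "g = z \<otimes> b" by (auto simp: set_mult_def)
    then obtain k i where k: "k \<in> K" "b = k \<otimes> x [^] (i :: nat)" by (auto simp: B_def cyclic_ext_def)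
    have "x [^] i = x [^] (p * (i div p) + i mod p)" by simp
    also have "\<dots> = (x [^] p) [^] (i div p) \<otimes> x [^] (i mod p)"
      using xc(1) by (simp only: nat_pow_pow nat_pow_mult[symmetric])
    finally have "g = z \<otimes> (k \<otimes> (x [^] p) [^] (i div p)) \<otimes> x [^] (i mod p)"
      using zb k xc(1) center_carrier K_carrier by (simp add: m_assoc)
    moreover have "(x [^] p) [^] (i div p) \<in> K"
      using subgroup_int_pow_closed[OF subgroup_K xc(2), of "int (i div p)"] by (simp add: int_pow_int)
    then have "z \<otimes> (k \<otimes> (x [^] p) [^] (i div p)) \<in> center G"
      using zb(1) k(1) K_central by (intro subgroup.m_closed[OF subgroup_center]) auto
    ultimately show "g \<in> (\<lambda>(z, i). z \<otimes> x [^] (i :: nat)) ` (center G \<times> {..<p})"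
      using p_gt_2
      by (intro image_eqI[of _ _ "(z \<otimes> (k \<otimes> (x [^] p) [^] (i div p)), i mod p)"]) auto
  qed
  then have "card (center G <#> B) \<le> card ((\<lambda>(z, i). z \<otimes> x [^] (i :: nat)) ` (center G \<times> {..<p}))"
    using finite_center by (intro card_mono) auto
  also have "\<dots> \<le> card (center G \<times> {..<p})" using finite_center by (intro card_image_le) auto
  also have "\<dots> = p ^ 3" by (simp add: card_cartesian_product card_center power2_eq_square power3_eq_cube)
  also have "\<dots> < card (isotropic x)" using card_isotropic[OF xc(1)] lt[of 3 4] by simp
  finally have "card (center G <#> B) < card (isotropic x)" .
  moreover have "finite (center G <#> B)"
    using set_mult_closed[of "center G" B] center_carrier subgroup.subset[OF B(1)] finite_G
    by (meson finite_subset subsetI)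
  ultimately have "\<not> isotropic x \<subseteq> center G <#> B" by (meson card_mono not_le)
  then obtain y where y: "y \<in> isotropic x" "y \<notin> center G <#> B" by blast
  have yc: "y \<in> carrier G" "y [^] p \<in> K" "commutator G y x \<in> K" using y by (auto simp: isotropic_def)
  \<comment> \<open>The condition on \<open>y\<close> concerns \<open>x\<close> only;
    multiplicativity of the commutator extends it to all of \<open>B\<close>.\<close>
  have comm: "commutator G y b \<in> K" if b: "b \<in> B" for b
  proof -
    obtain k i where k: "k \<in> K" "b = k \<otimes> x [^] (i :: nat)" using b unfolding B_def cyclic_ext_def by (elim imageE SigmaE) simp
    have "commutator G k y = \<one>"
      using k(1) K_central yc(1) center_iff_commutator by blast
    then have "commutator G b y = commutator G x y [^] i"
      using k xc(1) yc(1) K_carrier by (simp add: commutator_mult_left commutator_pow_left)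
    moreover have "commutator G x y \<in> K"
      using commutator_swap[OF yc(1) xc(1)] subgroup.m_inv_closed[OF subgroup_K yc(3)] by simp
    ultimately have "commutator G b y \<in> K"
      using subgroup_int_pow_closed[OF subgroup_K, of "commutator G x y" "int i"] by (simp add: int_pow_int)
    then show ?thesis
      using commutator_swap[of b y] subgroup.m_inv_closed[OF subgroup_K]
        subgroup.mem_carrier[OF B(1) b] yc(1) by simp
  qed
  show ?thesis
    using cyclic_ext_properties[OF B(1-3) yc(1,2) y(2) comm] B(4)
    by (intro exI[of _ "cyclic_ext B y"]) (simp add: power3_eq_cube)
qed

end

section \<open>The representation of degree \<open>2p\<^sup>3\<close>\<close>

text \<open>\<open>X\<close> is an arbitrary family of subsets, so that cosets of two different
  subgroups can be permuted together. Letting rows index the source makes the right action a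
  homomorphism, and the trace counts the fixed members of \<open>X\<close>.\<close>

lemma (in group) coset_permutation_rep:
  assumes X: "finite X" "\<And>C. C \<in> X \<Longrightarrow> C \<subseteq> carrier G"
    and act: "\<And>C g. C \<in> X \<Longrightarrow> g \<in> carrier G \<Longrightarrow> C #> g \<in> X"
    and faithful: "\<And>g. g \<in> carrier G \<Longrightarrow> (\<And>C. C \<in> X \<Longrightarrow> C #> g = C) \<Longrightarrow> g = \<one>"
  shows "\<exists>\<rho>. faithful_quasi_permutation_rep G (card X) \<rho>"
proof -
  define n where "n = card X"
  obtain h where h: "bij_betw h {0..<n} X"
    using ex_bij_betw_nat_finite[OF X(1)] n_def by blast
  have hX: "h i \<in> X" if "i < n" for i using bij_betwE[OF h] that by simp
  have h_eq: "h i = h j \<longleftrightarrow> i = j" if "i < n" "j < n" for i j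
    using bij_betw_imp_inj_on[OF h] that by (auto simp: inj_on_def)
  have h_surj: "\<exists>j<n. h j = C" if "C \<in> X" for C
    using bij_betw_imp_surj_on[OF h] that by (metis atLeastLessThan_iff imageE)
  define \<rho> :: "'a \<Rightarrow> complex mat" where
    "\<rho> g = mat n n (\<lambda>(i, j). if h i #> g = h j then 1 else 0)" for g
  have \<rho>_carrier: "\<rho> g \<in> carrier_mat n n" for g by (simp add: \<rho>_def)
  have \<rho>_mult: "\<rho> (g \<otimes> g') = \<rho> g * \<rho> g'" if g: "g \<in> carrier G" "g' \<in> carrier G" for g g'
  proof (rule eq_matI)
    fix i k assume "i < dim_row (\<rho> g * \<rho> g')" "k < dim_col (\<rho> g * \<rho> g')"
    then have ik: "i < n" "k < n" by (simp_all add: \<rho>_def)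
    obtain j where j: "j < n" "h j = h i #> g" using h_surj act[OF hX[OF ik(1)] g(1)] by blast
    have "(\<rho> g * \<rho> g') $$ (i, k) = (\<Sum>l = 0..<n. \<rho> g $$ (i, l) * \<rho> g' $$ (l, k))"
      using ik by (simp add: \<rho>_def scalar_prod_def)
    also have "\<dots> = (\<Sum>l = 0..<n. if l = j then \<rho> g' $$ (j, k) else 0)"
    proof (rule sum.cong[OF HOL.refl])
      fix l assume "l \<in> {0..<n}"
      then show "\<rho> g $$ (i, l) * \<rho> g' $$ (l, k) = (if l = j then \<rho> g' $$ (j, k) else 0)"
        using ik j h_eq[of j l] by (auto simp: \<rho>_def)
    qed
    also have "\<dots> = \<rho> g' $$ (j, k)" using j by simp
    also have "\<dots> = \<rho> (g \<otimes> g') $$ (i, k)"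
      using ik j g X(2)[OF hX[OF ik(1)]] by (simp add: \<rho>_def coset_mult_assoc)
    finally show "\<rho> (g \<otimes> g') $$ (i, k) = (\<rho> g * \<rho> g') $$ (i, k)" by (rule HOL.sym)
  qed (simp_all add: \<rho>_def)
  have \<rho>_one: "\<rho> \<one> = 1\<^sub>m n"
    by (rule eq_matI) (simp_all add: \<rho>_def X(2)[OF hX] h_eq coset_mult_one)
  have unit: "\<rho> g \<in> Units (ring_mat TYPE(complex) n ())" if g: "g \<in> carrier G" for g
  proof -
    have "\<rho> (inv g) * \<rho> g = 1\<^sub>m n" "\<rho> g * \<rho> (inv g) = 1\<^sub>m n"
      using \<rho>_mult[of "inv g" g] \<rho>_mult[of g "inv g"] g \<rho>_one by simp_all
    then show ?thesis using \<rho>_carrier unfolding Units_def ring_mat_simps by blast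
  qed
  have "\<rho> \<in> hom G (GL n)"
    unfolding hom_def GL_def units_of_def using unit \<rho>_mult by (simp add: ring_mat_simps)
  moreover have "inj_on \<rho> (carrier G)"
  proof (rule inj_onI)
    fix g g' assume g: "g \<in> carrier G" "g' \<in> carrier G" and eq: "\<rho> g = \<rho> g'"
    have "g \<otimes> inv g' = \<one>"
    proof (rule faithful)
      fix C assume C: "C \<in> X"
      obtain i where i: "i < n" "h i = C" using h_surj[OF C] by blast
      obtain j where j: "j < n" "h j = C #> g" using h_surj[OF act[OF C g(1)]] by blast
      have "\<rho> g $$ (i, j) = 1" using i j by (simp add: \<rho>_def)
      then have "\<rho> g' $$ (i, j) = 1" by (simp add: eq)
      then have "C #> g' = C #> g" using i j by (simp add: \<rho>_def split: if_splits)
      then have "C #> g #> inv g' = C #> g' #> inv g'" by simp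
      then show "C #> (g \<otimes> inv g') = C"
        using g X(2)[OF C] by (simp add: coset_mult_assoc coset_mult_one)
    qed (use g in simp)
    then show "g = g'" using g by (simp add: inv_solve_right')
  qed
  moreover have "quasi_permutation_mat (\<rho> g)" for g
  proof -
    have "mat_trace (\<rho> g) = of_nat (\<Sum>i<n. if h i #> g = h i then 1 else 0)"
      unfolding of_nat_sum mat_trace_def by (auto simp: \<rho>_def intro!: sum.cong)
    then have "mat_trace (\<rho> g) \<in> \<nat>" by (simp only: of_nat_in_Nats)
    then show ?thesis by (simp add: quasi_permutation_mat_def \<rho>_def)
  qed
  ultimately show ?thesis unfolding faithful_quasi_permutation_rep_def n_def by blast
qed

text \<open>A common coset makes \<open>A\<close> a right coset of \<open>B\<close>; it contains
  \<open>\<one>\<close>, so it is \<open>B\<close>. The lemma ensures that the degrees of the two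
  coset actions add up.\<close>

lemma (in group) rcosets_disjoint_if_neq:
  assumes "subgroup A G" "subgroup B G" "A \<noteq> B"
  shows "rcosets A \<inter> rcosets B = {}"
proof (rule ccontr)
  assume "rcosets A \<inter> rcosets B \<noteq> {}"
  then obtain x y where xy: "x \<in> carrier G" "y \<in> carrier G" "A #> x = B #> y"
    by (auto simp: RCOSETS_def)
  have sub: "A \<subseteq> carrier G" "B \<subseteq> carrier G" using assms subgroup.subset by auto
  have "A #> x #> inv x = A" using xy(1) sub(1) by (simp add: coset_mult_assoc)
  moreover have "B #> y #> inv x = B #> (y \<otimes> inv x)" using xy(1,2) sub(2) by (simp add: coset_mult_assoc)
  ultimately have A: "A = B #> (y \<otimes> inv x)" using xy(3) by simp
  then have "\<one> \<in> B #> (y \<otimes> inv x)" using subgroup.one_closed[OF assms(1)] by simp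
  then have "B #> (y \<otimes> inv x) = B #> \<one>"
    using repr_independence[OF _ _ assms(2), of \<one> "y \<otimes> inv x"] xy by simp
  then show False using A assms(3) sub by (simp add: coset_mult_one)
qed

context semi_extraspecial
begin

lemma ord_center:
  assumes "z \<in> center G" "z \<noteq> \<one>"
  shows "group.ord G z = p"
proof -
  have "group.ord G z dvd p"
    using center_exponent[OF assms(1)] pow_eq_id[OF center_carrier[OF assms(1)]] by simp
  moreover have "group.ord G z \<noteq> 1"
    using assms ord_eq_1[OF center_carrier[OF assms(1)]] by simp
  ultimately show ?thesis using prime by (auto simp: prime_nat_iff)
qed

lemma central_subgroup_generate:
  assumes z: "z \<in> center G" "z \<noteq> \<one>"
  shows "central_subgroup G p (generate G {z})"
proof (intro central_subgroup.intro central_subgroup_axioms.intro semi_extraspecial_axioms)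
  show "subgroup (generate G {z}) G"
    using center_carrier[OF z(1)] by (intro generate_is_subgroup) simp
  show "generate G {z} \<subseteq> center G"
    using z(1) by (intro generate_subgroup_incl subgroup_center) simp
  show "card (generate G {z}) = p"
    using generate_pow_card[OF center_carrier[OF z(1)]] ord_center[OF z] by simp
qed

lemma generate_eq:
  assumes z: "z \<in> center G" "z \<noteq> \<one>" and y: "y \<in> generate G {z}" "y \<noteq> \<one>"
  shows "generate G {y} = generate G {z}"
proof (rule card_subset_eq)
  interpret z: central_subgroup G p "generate G {z}" by (rule central_subgroup_generate[OF z])
  interpret y: central_subgroup G p "generate G {y}"
    using y z.K_central by (intro central_subgroup_generate) auto
  show "finite (generate G {z})" using z.card_K p_gt_2 by (intro card_ge_0_finite) simp
  show "generate G {y} \<subseteq> generate G {z}"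
    using y(1) by (intro generate_subgroup_incl z.subgroup_K) simp
  show "card (generate G {y}) = card (generate G {z})" by (simp add: z.card_K y.card_K)
qed

lemma exists_central_outside:
  assumes "S \<subseteq> center G" "card S < p\<^sup>2"
  shows "\<exists>z\<in>center G. z \<notin> S"
proof (rule ccontr)
  assume "\<not> ?thesis"
  then have "S = center G" using assms by blast
  then show False using assms card_center by simp
qed

text \<open>An element \<open>g\<close> acting trivially lies in every conjugate of
  \<open>B1\<close> and of \<open>B2\<close>. Its commutators then lie in both subgroups and in the
  center, hence in the trivial intersection of the two subgroups of order \<open>p\<close>; so
  \<open>g\<close> is central, and the same intersection shows that it is trivial.\<close>

lemma exists_faithful_rep: "\<exists>\<rho>. faithful_quasi_permutation_rep G (2 * p ^ 3) \<rho>"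
proof -
  have p1: "1 < p" "p < p\<^sup>2" "(1::nat) < p\<^sup>2" using p_gt_2 one_less_power[of p 2] by (simp_all add: power2_eq_square)
  obtain z1 where z1: "z1 \<in> center G" "z1 \<noteq> \<one>"
    using exists_central_outside[of "{\<one>}"] subgroup.one_closed[OF subgroup_center] p1 by auto
  interpret K1: central_subgroup G p "generate G {z1}" by (rule central_subgroup_generate[OF z1])
  obtain z2 where z2: "z2 \<in> center G" "z2 \<notin> generate G {z1}"
    using exists_central_outside[OF K1.K_central] K1.card_K p1 by auto
  have z2_1: "z2 \<noteq> \<one>" using z2 subgroup.one_closed[OF K1.subgroup_K] by auto
  interpret K2: central_subgroup G p "generate G {z2}" by (rule central_subgroup_generate[OF z2(1) z2_1])
  have inter: "y = \<one>" if "y \<in> generate G {z1}" "y \<in> generate G {z2}" for y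
  proof (rule ccontr)
    assume "y \<noteq> \<one>"
    then have "generate G {z1} = generate G {z2}"
      using generate_eq[OF z1, of y] generate_eq[OF z2(1) z2_1, of y] that by simp
    moreover have "z2 \<in> generate G {z2}" by (intro generate.incl) simp
    ultimately show False using z2(2) by simp
  qed
  obtain B1 where B1: "subgroup B1 G" "B1 \<inter> center G = generate G {z1}" "card B1 = p ^ 3"
    using K1.exists_large_subgroup by blast
  obtain B2 where B2: "subgroup B2 G" "B2 \<inter> center G = generate G {z2}" "card B2 = p ^ 3"
    using K2.exists_large_subgroup by blast
  have ne: "B1 \<noteq> B2"
  proof
    assume "B1 = B2"
    then have "z2 \<in> generate G {z1}" using B1(2) B2(2) generate.incl[of z2 "{z2}" G] by simp
    then show False using z2(2) by simp
  qed
  let ?X = "rcosets B1 \<union> rcosets B2"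
  have card_rcosets: "card (rcosets B) = p ^ 3 \<and> finite (rcosets B)" if "subgroup B G" "card B = p ^ 3" for B
  proof -
    have "card (rcosets B) * p ^ 3 = p ^ 3 * p ^ 3"
      using lagrange[OF that(1)] that(2) order_G by (simp flip: power_add)
    then have "card (rcosets B) = p ^ 3" using p_gt_2 by (simp only: mult_cancel2) simp
    moreover have "finite (rcosets B)" using finite_G by (simp add: RCOSETS_def)
    ultimately show ?thesis ..
  qed
  have "card ?X = 2 * p ^ 3"
    using card_rcosets[OF B1(1,3)] card_rcosets[OF B2(1,3)] rcosets_disjoint_if_neq[OF B1(1) B2(1) ne]
    by (subst card_Un_disjoint) simp_all
  moreover have "\<exists>\<rho>. faithful_quasi_permutation_rep G (card ?X) \<rho>"
  proof (rule coset_permutation_rep)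
    show "finite ?X" using card_rcosets B1 B2 by simp
    have sub: "B1 \<subseteq> carrier G" "B2 \<subseteq> carrier G"
      by (rule subgroup.subset[OF B1(1)], rule subgroup.subset[OF B2(1)])
    then show "C \<subseteq> carrier G" if "C \<in> ?X" for C
      using that rcosets_part_G[OF B1(1)] rcosets_part_G[OF B2(1)] by blast
    show "C #> g \<in> ?X" if C: "C \<in> ?X" and g: "g \<in> carrier G" for C g
      using C
    proof
      assume "C \<in> rcosets B1"
      then obtain x where "x \<in> carrier G" "C = B1 #> x" by (auto simp: RCOSETS_def)
      then show ?thesis using g sub by (simp add: coset_mult_assoc rcosetsI)
    next
      assume "C \<in> rcosets B2"
      then obtain x where "x \<in> carrier G" "C = B2 #> x" by (auto simp: RCOSETS_def)
      then show ?thesis using g sub by (simp add: coset_mult_assoc rcosetsI)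
    qed
    show "g = \<one>" if g: "g \<in> carrier G" and fix_all: "\<And>C. C \<in> ?X \<Longrightarrow> C #> g = C" for g
    proof -
      \<comment> \<open>Fixing the coset \<open>B #> x\<close> means that the conjugate of
        \<open>g\<close> by \<open>x\<close> belongs to \<open>B\<close>.\<close>
      have conj: "x \<otimes> g \<otimes> inv x \<in> B" if x: "x \<in> carrier G" and B: "subgroup B G" "B = B1 \<or> B = B2" for x B
      proof -
        have Bc: "B \<subseteq> carrier G" using sub B by blast
        have "B #> x \<in> ?X" using x B(2) Bc rcosetsI by blast
        then have "B #> x #> g = B #> x" by (rule fix_all)
        then have "B #> (x \<otimes> g) = B #> x" using x g Bc by (simp add: coset_mult_assoc)
        then show ?thesis using rcoset_eq_iff[OF B(1), of "x \<otimes> g" x] x g by simp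
      qed
      have gB: "g \<in> B1 \<inter> B2" using conj[OF one_closed B1(1)] conj[OF one_closed B2(1)] g by simp
      have triv: "w = \<one>" if "w \<in> B1 \<inter> B2" "w \<in> center G" for w
        using inter[of w] that B1(2) B2(2) by blast
      have "x \<otimes> g = g \<otimes> x" if x: "x \<in> carrier G" for x
      proof -
        have "x \<otimes> g \<otimes> inv x \<otimes> inv g \<in> B1" "x \<otimes> g \<otimes> inv x \<otimes> inv g \<in> B2"
          using conj[OF x B1(1)] conj[OF x B2(1)] gB
            subgroup.m_closed[OF B1(1)] subgroup.m_closed[OF B2(1)]
            subgroup.m_inv_closed[OF B1(1)] subgroup.m_inv_closed[OF B2(1)] by auto
        moreover have "x \<otimes> g \<otimes> inv x \<otimes> inv g = commutator G (inv x) (inv g)"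
          using x g by (simp add: commutator_def)
        ultimately have "commutator G (inv x) (inv g) = \<one>"
          using commutator_central[of "inv x" "inv g"] x g by (intro triv) simp_all
        then have "x \<otimes> g \<otimes> inv x \<otimes> inv g = \<one>" using x g by (simp add: commutator_def)
        then show ?thesis using x g by (simp add: inv_solve_right')
      qed
      then have "g \<in> center G" using g by (simp add: center_def)
      then show "g = \<one>" using triv gB by blast
    qed
  qed
  ultimately show ?thesis by simp
qed

end

section \<open>The lower bound\<close>

locale faithful_qp_rep = semi_extraspecial G p for G (structure) and p +
  fixes n :: nat and \<rho> :: "'a \<Rightarrow> complex mat"
  assumes rep: "faithful_quasi_permutation_rep G n \<rho>"
begin

lemma \<rho>_carrier: "g \<in> carrier G \<Longrightarrow> \<rho> g \<in> carrier_mat n n"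
  using rep unfolding faithful_quasi_permutation_rep_def hom_def GL_def units_of_def Units_def
  by (auto simp: ring_mat_simps)

lemma \<rho>_mult: "g \<in> carrier G \<Longrightarrow> h \<in> carrier G \<Longrightarrow> \<rho> (g \<otimes> h) = \<rho> g * \<rho> h"
  using rep unfolding faithful_quasi_permutation_rep_def hom_def GL_def units_of_def
  by (simp add: ring_mat_simps)

lemma \<rho>_inj: "g \<in> carrier G \<Longrightarrow> h \<in> carrier G \<Longrightarrow> \<rho> g = \<rho> h \<Longrightarrow> g = h"
  using rep unfolding faithful_quasi_permutation_rep_def inj_on_def by blast

lemma \<rho>_one: "\<rho> \<one> = 1\<^sub>m n"
proof -
  interpret R: ring "ring_mat TYPE(complex) n ()" by (rule ring_mat)
  have "group (GL n)" unfolding GL_def by (rule R.units_group)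
  then have "\<rho> \<one> = \<one>\<^bsub>GL n\<^esub>"
    using rep is_group by (intro hom_one) (simp_all add: faithful_quasi_permutation_rep_def)
  then show ?thesis by (simp add: GL_def units_of_def ring_mat_simps)
qed

text \<open>Values in \<open>nat\<close> build in the nonnegativity of the character, on which the
  final estimate rests.\<close>

definition \<chi> :: "'a \<Rightarrow> nat" where
  "\<chi> g = (SOME k. mat_trace (\<rho> g) = of_nat k)"

lemma trace_eq_\<chi>:
  assumes "g \<in> carrier G"
  shows "mat_trace (\<rho> g) = of_nat (\<chi> g)"
proof -
  have "mat_trace (\<rho> g) \<in> \<nat>"
    using rep assms by (simp add: faithful_quasi_permutation_rep_def quasi_permutation_mat_def)
  then obtain k where "mat_trace (\<rho> g) = of_nat k" by (elim Nats_cases)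
  then show ?thesis unfolding \<chi>_def by (rule someI)
qed

lemma \<chi>_one: "\<chi> \<one> = n"
proof -
  have "mat_trace (1\<^sub>m n :: complex mat) = of_nat n" by (simp add: mat_trace_def)
  then have "(of_nat (\<chi> \<one>) :: complex) = of_nat n"
    using trace_eq_\<chi>[of \<one>] by (simp add: \<rho>_one)
  then show ?thesis by (simp only: of_nat_eq_iff)
qed

text \<open>Noncentral elements are conjugate to all their translates by central elements.\<close>

lemma \<chi>_mult_central:
  assumes g: "g \<in> carrier G" "g \<notin> center G" and z: "z \<in> center G"
  shows "\<chi> (g \<otimes> z) = \<chi> g"
proof -
  obtain h where h: "h \<in> carrier G" "commutator G g h = z"
    using commutator_surjective[OF g z] by blast
  have zc: "z \<in> carrier G" using center_carrier[OF z] .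
  have "inv h \<otimes> (g \<otimes> h) = inv h \<otimes> (h \<otimes> (g \<otimes> z))"
    using mult_commutator[OF g(1) h(1)] h g zc by (simp add: m_assoc)
  also have "\<dots> = g \<otimes> z" using h g zc by (simp add: m_assoc[symmetric])
  finally have "mat_trace (\<rho> (g \<otimes> z)) = mat_trace (\<rho> (inv h) * \<rho> (g \<otimes> h))"
    using h g by (simp flip: \<rho>_mult)
  also have "\<dots> = mat_trace (\<rho> (g \<otimes> h) * \<rho> (inv h))"
    using h g by (intro mat_trace_mult_commute[of _ n n]) (simp_all add: \<rho>_carrier)
  also have "\<dots> = mat_trace (\<rho> g)"
    using h g by (simp add: \<rho>_mult[symmetric] m_assoc)
  finally have "(of_nat (\<chi> (g \<otimes> z)) :: complex) = of_nat (\<chi> g)"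
    using g zc by (simp add: trace_eq_\<chi>)
  then show ?thesis by (simp only: of_nat_eq_iff)
qed

section \<open>Sums of the character over cosets in the center\<close>

lemma mat_trace_smult: "mat_trace (c \<cdot>\<^sub>m A) = c * mat_trace A" if "A \<in> carrier_mat n n" for A :: "complex mat"
  using that by (simp add: mat_trace_def sum_distrib_left)

lemma center_int_pow_cong:
  assumes z: "z \<in> center G" and "[i = j] (mod int p)"
  shows "z [^] i = z [^] j"
proof -
  have zc: "z \<in> carrier G" using center_carrier[OF z] .
  have "int p dvd i - j" using assms(2) by (simp add: cong_iff_dvd_diff)
  then obtain k where "i - j = int p * k" by (elim dvdE)
  then have k: "i = j + int p * k" by simp
  have "z [^] (int p * k) = (z [^] int p) [^] k" using zc by (simp only: int_pow_pow)
  also have "\<dots> = \<one>" by (simp only: int_pow_int center_exponent[OF z] int_pow_one)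
  finally show ?thesis using zc by (simp add: k int_pow_mult)
qed

text \<open>The center is the direct product of \<open>K\<close> and the cyclic group of order
  \<open>p\<close> generated by \<open>u\<close>. Integer exponents match the carrier of
  \<open>integer_mod_group p\<close>.\<close>

lemma center_decomposition:
  assumes "central_subgroup G p K" and u: "u \<in> center G" "u \<notin> K"
  shows "bij_betw (\<lambda>(k, i). k \<otimes> u [^] i) (K \<times> {0..<int p}) (center G)"
proof -
  interpret K: central_subgroup G p K by (rule assms(1))
  have uc: "u \<in> carrier G" using center_carrier[OF u(1)] .
  have inj: "inj_on (\<lambda>(k, i). k \<otimes> u [^] i) (K \<times> {0..<int p})"
  proof (rule inj_onI)
    fix s t assume st: "s \<in> K \<times> {0..<int p}" "t \<in> K \<times> {0..<int p}"
      "(case s of (k, i) \<Rightarrow> k \<otimes> u [^] i) = (case t of (k, i) \<Rightarrow> k \<otimes> u [^] i)"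
    obtain k i l j where s: "s = (k, i)" and t: "t = (l, j)" by (cases s, cases t)
    have *: "k \<in> K" "l \<in> K" "0 \<le> i" "i < int p" "0 \<le> j" "j < int p" "k \<otimes> u [^] i = l \<otimes> u [^] j"
      using st by (simp_all add: s t)
    have kl: "k \<in> carrier G" "l \<in> carrier G" using * K.K_carrier by auto
    have "k \<otimes> u [^] i \<otimes> u [^] (- j) = l \<otimes> u [^] j \<otimes> u [^] (- j)" using *(7) by simp
    then have "k \<otimes> u [^] (i - j) = l"
      using kl uc by (simp add: m_assoc int_pow_mult[symmetric])
    then have "u [^] (i - j) = inv k \<otimes> l" using kl uc by (simp add: inv_solve_left)
    then have mem: "u [^] (i - j) \<in> K"
      using * subgroup.m_closed[OF K.subgroup_K subgroup.m_inv_closed[OF K.subgroup_K]] by simp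
    have "u [^] int p \<in> K"
      using center_exponent[OF u(1)] subgroup.one_closed[OF K.subgroup_K] by (simp add: int_pow_int)
    then have "\<not> coprime (i - j) (int p)"
      using mem_if_coprime_pows_mem[OF K.subgroup_K uc mem] u(2) by blast
    then have "int p dvd i - j"
      using prime_imp_coprime[of "int p" "i - j"] prime coprime_commute by auto
    then have "i = j" using * by (metis dvd_imp_mod_0 mod_eq_dvd_iff mod_pos_pos_trivial)
    then show "s = t" using *(7) kl uc by (simp add: s t)
  qed
  have sub: "(\<lambda>(k, i). k \<otimes> u [^] i) ` (K \<times> {0..<int p}) \<subseteq> center G"
    using K.K_central subgroup.m_closed[OF subgroup_center] subgroup_int_pow_closed[OF subgroup_center u(1)]
    by auto
  have "(\<lambda>(k, i). k \<otimes> u [^] i) ` (K \<times> {0..<int p}) = center G"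
    using card_image[OF inj] sub finite_center
    by (intro card_subset_eq) (simp_all add: card_cartesian_product K.card_K card_center power2_eq_square)
  then show ?thesis using inj by (simp add: bij_betw_def)
qed

lemma sum_int_range: "(\<Sum>i\<in>{0..<int m}. f i) = (\<Sum>i<m. f (int i))"
proof -
  have "{0..<int m} = int ` {..<m}"
    by (simp add: image_int_atLeastLessThan flip: atLeast0LessThan)
  then show ?thesis by (simp add: sum.reindex)
qed

text \<open>Twisting \<open>\<rho>\<close> on \<open>B \<times> \<langle>u\<rangle>\<close> by a character that is trivial on \<open>B\<close>, the noncentral elements of \<open>B\<close>
  contribute nothing to the sum of the traces.\<close>

lemma coset_transform:
  assumes "central_subgroup G p K" and u: "u \<in> center G"
    and r: "\<not> int p dvd r"
  shows "\<exists>N. (\<Sum>i<p. of_nat (\<Sum>k\<in>K. \<chi> (k \<otimes> u [^] int i)) * unity_root p (r * int i)) = of_nat (p ^ 4 * N)"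
proof -
  interpret K: central_subgroup G p K by (rule assms(1))
  have uc: "u \<in> carrier G" using center_carrier[OF u] .
  have upow: "u [^] i \<in> center G" for i :: int by (rule subgroup_int_pow_closed[OF subgroup_center u])
  have p0: "p > 0" using p_gt_2 by simp
  obtain B where B: "subgroup B G" "K \<subseteq> B" "B \<inter> center G = K" "card B = p ^ 3"
    using K.exists_large_subgroup by blast
  have Bc: "b \<in> carrier G" if "b \<in> B" for b using subgroup.mem_carrier[OF B(1) that] .
  have finB: "finite B" using finite_G Bc by (meson finite_subset subsetI)
  \<comment> \<open>The external product maps to \<open>G\<close> by
    \<open>(b, i) \<mapsto> b \<otimes> u [^] i\<close>. On it the twist by the \<open>r\<close>-th
    character of the second factor is directly available, and its order supplies the factor
    \<open>p ^ 4\<close>.\<close>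
  define I where "I = G\<lparr>carrier := B\<rparr> \<times>\<times> integer_mod_group p"
  define \<sigma> where "\<sigma> = (\<lambda>(b, i). unity_root p (r * i) \<cdot>\<^sub>m \<rho> (b \<otimes> u [^] (i :: int)))"
  have carrier_I: "carrier I = B \<times> {0..<int p}"
    using p0 by (simp add: I_def DirProd_def carrier_integer_mod_group)
  have order_I: "Coset.order I = p ^ 4"
    by (simp add: Coset.order_def carrier_I card_cartesian_product B(4) power4_eq_xxxx power3_eq_cube)
  interpret I: finite_matrix_rep I \<sigma> n
  proof (intro finite_matrix_rep.intro finite_matrix_rep_axioms.intro)
    show "group I"
      unfolding I_def by (intro DirProd_group subgroup_imp_group[OF B(1)] group_integer_mod_group)
    show "finite (carrier I)" using finB by (simp add: carrier_I)
    show "\<sigma> x \<in> carrier_mat n n" if "x \<in> carrier I" for x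
      using that Bc uc by (auto simp: carrier_I \<sigma>_def intro!: \<rho>_carrier smult_carrier_mat)
    fix x y assume "x \<in> carrier I" "y \<in> carrier I"
    then obtain b i c j where x: "x = (b, i)" "b \<in> B" and y: "y = (c, j)" "c \<in> B"
      by (auto simp: carrier_I)
    have bc: "b \<in> carrier G" "c \<in> carrier G" using x y Bc by auto
    have "b \<otimes> c \<otimes> u [^] ((i + j) mod int p) = b \<otimes> c \<otimes> (u [^] i \<otimes> u [^] j)"
      using center_int_pow_cong[OF u, of "(i + j) mod int p" "i + j"] uc by (simp add: int_pow_mult)
    also have "\<dots> = b \<otimes> (c \<otimes> u [^] i) \<otimes> u [^] j" using bc uc by (simp add: m_assoc)
    also have "c \<otimes> u [^] i = u [^] i \<otimes> c" by (rule HOL.sym, rule center_commute[OF upow bc(2)])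
    also have "b \<otimes> (u [^] i \<otimes> c) \<otimes> u [^] j = (b \<otimes> u [^] i) \<otimes> (c \<otimes> u [^] j)" using bc uc by (simp add: m_assoc)
    finally have prod: "b \<otimes> c \<otimes> u [^] ((i + j) mod int p) = (b \<otimes> u [^] i) \<otimes> (c \<otimes> u [^] j)" .
    have "[r * ((i + j) mod int p) = r * (i + j)] (mod int p)" by (intro cong_mult cong_refl) simp
    then have root: "unity_root p (r * ((i + j) mod int p)) = unity_root p (r * i) * unity_root p (r * j)"
      using unity_root_cong[OF p0] by (simp add: unity_root_add[symmetric] distrib_left)
    have "x \<otimes>\<^bsub>I\<^esub> y = (b \<otimes> c, (i + j) mod int p)" by (simp add: I_def x y)
    then have "\<sigma> (x \<otimes>\<^bsub>I\<^esub> y)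
        = unity_root p (r * ((i + j) mod int p)) \<cdot>\<^sub>m \<rho> (b \<otimes> c \<otimes> u [^] ((i + j) mod int p))"
      by (simp only: \<sigma>_def prod.case)
    also have "\<dots> = (unity_root p (r * i) * unity_root p (r * j)) \<cdot>\<^sub>m (\<rho> (b \<otimes> u [^] i) * \<rho> (c \<otimes> u [^] j))"
      unfolding root prod using bc uc \<rho>_mult[of "b \<otimes> u [^] i" "c \<otimes> u [^] j"] by simp
    also have "\<dots> = \<sigma> x * \<sigma> y"
    proof -
      have c: "\<rho> (b \<otimes> u [^] i) \<in> carrier_mat n n" "\<rho> (c \<otimes> u [^] j) \<in> carrier_mat n n"
        using bc uc by (simp_all add: \<rho>_carrier)
      have smult_smult: "k \<cdot>\<^sub>m (l \<cdot>\<^sub>m A) = (k * l) \<cdot>\<^sub>m A" for k l :: complex and A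
        by (rule eq_matI) (simp_all add: mult.assoc)
      show ?thesis
        unfolding \<sigma>_def x y prod.case mult_smult_assoc_mat[OF c(1) smult_carrier_mat[OF c(2)]]
          mult_smult_distrib[OF c] smult_smult ..
    qed
    finally show "\<sigma> (x \<otimes>\<^bsub>I\<^esub> y) = \<sigma> x * \<sigma> y" .
  qed
  obtain N where N: "(\<Sum>x\<in>carrier I. mat_trace (\<sigma> x)) = of_nat (p ^ 4 * N)"
    using I.sum_trace_eq_order_mult unfolding order_I by blast
  have "(\<Sum>x\<in>carrier I. mat_trace (\<sigma> x))
      = (\<Sum>b\<in>B. \<Sum>i\<in>{0..<int p}. unity_root p (r * i) * of_nat (\<chi> (b \<otimes> u [^] i)))"
    unfolding carrier_I sum.cartesian_product
    by (intro sum.cong HOL.refl) (auto simp: \<sigma>_def \<rho>_carrier mat_trace_smult trace_eq_\<chi> Bc uc)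
  also have "\<dots> = (\<Sum>b\<in>B. \<Sum>i<p. of_nat (\<chi> (b \<otimes> u [^] int i)) * unity_root p (r * int i))"
    by (simp only: sum_int_range mult.commute)
  also have "\<dots> = (\<Sum>b\<in>K. \<Sum>i<p. of_nat (\<chi> (b \<otimes> u [^] int i)) * unity_root p (r * int i))"
  proof (rule sum.mono_neutral_right[OF finB B(2)], rule ballI)
    \<comment> \<open>Here \<open>b\<close> is noncentral, so \<chi> is constant along
      \<open>b \<otimes> u [^] i\<close>, and the sum over \<open>i\<close> is a vanishing sum of
      roots of unity.\<close>
    fix b assume b: "b \<in> B - K"
    then have "b \<notin> center G" using B(3) by blast
    then have "(\<Sum>i<p. of_nat (\<chi> (b \<otimes> u [^] int i)) * unity_root p (r * int i))
        = of_nat (\<chi> b) * (\<Sum>i<p. unity_root p (int i * r))"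
      using b Bc upow by (simp add: \<chi>_mult_central sum_distrib_left mult.commute)
    then show "(\<Sum>i<p. of_nat (\<chi> (b \<otimes> u [^] int i)) * unity_root p (r * int i)) = 0"
      using r by (simp add: sum_unity_root[OF p0])
  qed
  also have "\<dots> = (\<Sum>i<p. of_nat (\<Sum>k\<in>K. \<chi> (k \<otimes> u [^] int i)) * unity_root p (r * int i))"
    by (subst sum.swap) (simp add: sum_distrib_right)
  finally show ?thesis using N by metis
qed

text \<open>Let \<open>C i\<close> be the sum of \<chi> over the coset of \<open>u [^] i\<close>.
  All transform values of \<open>C\<close> are integers, so \<open>C i = C 1\<close> for
  \<open>0 < i < p\<close>, and the value at \<open>r = 1\<close> gives
  \<open>C 0 - C 1 = p ^ 4 * N\<close>. The claim follows since the sum over the center is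
  \<open>C 0 + (p - 1) * C 1\<close>.\<close>

lemma central_sum_eq:
  assumes "central_subgroup G p K"
  shows "\<exists>N. p * (\<Sum>z\<in>K. \<chi> z) = (\<Sum>z\<in>center G. \<chi> z) + (p - 1) * p ^ 4 * N"
proof -
  interpret K: central_subgroup G p K by (rule assms)
  have p0: "p > 0" and p1: "p > 1" using p_gt_2 by simp_all
  have "p < p\<^sup>2" using p1 by (simp add: power2_eq_square)
  then obtain u where u: "u \<in> center G" "u \<notin> K"
    using exists_central_outside[OF K.K_central] K.card_K by auto
  define C where "C i = (\<Sum>k\<in>K. \<chi> (k \<otimes> u [^] int i))" for i
  have ex: "\<exists>m. (\<Sum>i<p. of_int (int (C i)) * unity_root p (int r * int i)) = of_int m" if "r < p" for r
  proof (cases "r = 0")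
    case True
    then have "(\<Sum>i<p. of_int (int (C i)) * unity_root p (int r * int i)) = of_int (\<Sum>i<p. int (C i))"
      by simp
    then show ?thesis by blast
  next
    case False
    then have "\<not> int p dvd int r" using that by (auto dest: zdvd_imp_le)
    from coset_transform[OF assms u(1) this, folded C_def] obtain N where
      "(\<Sum>i<p. of_nat (C i) * unity_root p (int r * int i)) = of_nat (p ^ 4 * N)" by (elim exE)
    then show ?thesis by (intro exI[of _ "int (p ^ 4 * N)"]) simp
  qed
  define m where "m r = (SOME m. (\<Sum>i<p. of_int (int (C i)) * unity_root p (int r * int i)) = of_int m)" for r
  have m: "(\<Sum>i<p. of_int (int (C i)) * unity_root p (int r * int i)) = of_int (m r)" if "r < p" for r
    unfolding m_def by (rule someI_ex[OF ex[OF that]])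
  have C1: "C i = C 1" if "0 < i" "i < p" for i
    using integer_transform_const[OF prime m that] by simp
  have split: "(\<Sum>i<p. f i) = f 0 + (\<Sum>i = 1..<p. f i)" for f :: "nat \<Rightarrow> 'x :: comm_monoid_add"
    using p0 by (simp add: sum.atLeast_Suc_lessThan flip: atLeast0LessThan)
  have "\<not> int p dvd 1" using p1 by simp
  from coset_transform[OF assms u(1) this, folded C_def] obtain N where N:
    "(\<Sum>i<p. of_nat (C i) * unity_root p (int i)) = of_nat (p ^ 4 * N)"
    unfolding mult_1 by (elim exE)
  have "(\<Sum>i<p. unity_root p (int i)) = 0" using sum_unity_root[OF p0, of 1] p1 by simp
  then have roots: "(\<Sum>i = 1..<p. unity_root p (int i)) = -1"
    unfolding split by (simp add: eq_neg_iff_add_eq_0 add.commute)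
  have "(\<Sum>i<p. of_nat (C i) * unity_root p (int i)) = of_nat (C 0) + (\<Sum>i = 1..<p. of_nat (C i) * unity_root p (int i))"
    unfolding split by simp
  also have "(\<Sum>i = 1..<p. of_nat (C i) * unity_root p (int i)) = (\<Sum>i = 1..<p. of_nat (C 1) * unity_root p (int i))"
  proof (rule sum.cong[OF HOL.refl])
    fix i assume "i \<in> {1..<p}"
    then have "C i = C 1" by (intro C1) simp_all
    then show "of_nat (C i) * unity_root p (int i) = of_nat (C 1) * unity_root p (int i)" by simp
  qed
  also have "\<dots> = - of_nat (C 1)"
    unfolding sum_distrib_left[symmetric] roots by simp
  finally have "(of_nat (C 0) :: complex) = of_nat (C 1 + p ^ 4 * N)"
    using N by (simp add: algebra_simps)
  then have C0: "C 0 = C 1 + p ^ 4 * N" by (simp only: of_nat_eq_iff)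
  have "(\<Sum>z\<in>center G. \<chi> z) = (\<Sum>(k, i)\<in>K \<times> {0..<int p}. \<chi> (k \<otimes> u [^] i))"
    using sum.reindex_bij_betw[OF center_decomposition[OF assms u], of \<chi>]
    by (simp add: case_prod_unfold)
  also have "\<dots> = (\<Sum>i<p. C i)"
    unfolding sum.cartesian_product[symmetric] sum_int_range C_def by (rule sum.swap)
  also have "\<dots> = C 0 + (\<Sum>i = 1..<p. C 1)"
    unfolding split by (intro arg_cong2[where f = "(+)"] sum.cong HOL.refl C1) simp_all
  finally have S: "(\<Sum>z\<in>center G. \<chi> z) = C 0 + (p - 1) * C 1" by simp
  have "(\<Sum>z\<in>K. \<chi> z) = C 0" using K.K_carrier by (simp add: C_def)
  moreover obtain p' where "p = Suc p'" using p0 by (cases p) auto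
  ultimately have "p * (\<Sum>z\<in>K. \<chi> z) = (\<Sum>z\<in>center G. \<chi> z) + (p - 1) * p ^ 4 * N"
    unfolding S by (simp only: C0) (simp add: algebra_simps)
  then show ?thesis by blast
qed

text \<open>Equality would make \<open>K\<close> act trivially, against faithfulness.\<close>

lemma sum_\<chi>_neq_maximal:
  assumes "central_subgroup G p K"
  shows "(\<Sum>z\<in>K. \<chi> z) \<noteq> p * n"
proof
  assume max: "(\<Sum>z\<in>K. \<chi> z) = p * n"
  interpret K: central_subgroup G p K by (rule assms)
  let ?K = "G\<lparr>carrier := K\<rparr>"
  have finK: "finite K" using K.card_K p_gt_2 by (intro card_ge_0_finite) simp
  interpret R: finite_matrix_rep ?K \<rho> n
    by (intro finite_matrix_rep.intro finite_matrix_rep_axioms.intro subgroup_imp_group[OF K.subgroup_K])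
      (simp_all add: finK K.K_carrier \<rho>_carrier \<rho>_mult)
  have "(\<Sum>z\<in>K. mat_trace (\<rho> z)) = of_nat (\<Sum>z\<in>K. \<chi> z)"
    by (simp add: trace_eq_\<chi> K.K_carrier)
  then have sum: "(\<Sum>z\<in>carrier ?K. mat_trace (\<rho> z)) = of_nat (Coset.order ?K * n)"
    by (simp add: max Coset.order_def K.card_K)
  have "K \<subseteq> {\<one>}"
  proof
    fix z assume z: "z \<in> K"
    then have "\<rho> z = \<rho> \<one>"
      using R.trivial_if_sum_trace_maximal[OF sum] by (simp add: \<rho>_one)
    then show "z \<in> {\<one>}" using \<rho>_inj[of z \<one>] K.K_carrier[OF z] by simp
  qed
  then have "card K \<le> 1" using card_mono[of "{\<one>}" K] by simp
  then show False using K.card_K p_gt_2 by simp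
qed

text \<open>The number \<open>N\<^sub>K\<close> of the introduction; the equation determines it
  because \<open>(p - 1) * p ^ 4\<close> is positive.\<close>

definition central_mult :: "'a set \<Rightarrow> nat" where
  "central_mult K = (SOME N. p * (\<Sum>z\<in>K. \<chi> z) = (\<Sum>z\<in>center G. \<chi> z) + (p - 1) * p ^ 4 * N)"

lemma mult_eq:
  assumes "central_subgroup G p K"
  shows "p * (\<Sum>z\<in>K. \<chi> z) = (\<Sum>z\<in>center G. \<chi> z) + (p - 1) * p ^ 4 * central_mult K"
  unfolding central_mult_def by (rule someI_ex[OF central_sum_eq[OF assms]])

text \<open>Sums over the subgroups of order \<open>p\<close> of the center are written as sums over
  their nontrivial elements, where each subgroup is counted \<open>p - 1\<close> times.\<close>

abbreviation "Z \<equiv> center G - {\<one>}"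
abbreviation "cyc z \<equiv> generate G {z}"

lemma cyc: "z \<in> Z \<Longrightarrow> central_subgroup G p (cyc z)"
  by (rule central_subgroup_generate) auto

lemma cyc_card: "z \<in> Z \<Longrightarrow> card (cyc z) = p"
  using cyc central_subgroup.card_K by blast

lemma cyc_subset: "z \<in> Z \<Longrightarrow> cyc z \<subseteq> center G"
  using cyc central_subgroup.K_central by blast

lemma one_in_cyc: "\<one> \<in> cyc z"
  by (rule generate.one)

lemma self_in_cyc: "z \<in> cyc z"
  by (rule generate.incl) simp

lemma cyc_eq: "z \<in> Z \<Longrightarrow> y \<in> cyc z - {\<one>} \<Longrightarrow> cyc y = cyc z"
  using generate_eq by auto

lemma cyc_sum_diff:
  assumes "z \<in> Z"
  shows "sum f (cyc z) = f \<one> + sum f (cyc z - {\<one>})"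
proof -
  have "finite (cyc z)" using cyc_card[OF assms] p_gt_2 by (intro card_ge_0_finite) simp
  then show ?thesis by (rule sum.remove) (rule one_in_cyc)
qed

lemma card_cyc_diff: "z \<in> Z \<Longrightarrow> card (cyc z - {\<one>}) = p - 1"
  by (simp add: cyc_card one_in_cyc)

text \<open>Sum \<open>mult_eq\<close> over all nontrivial central \<open>z\<close>. The relation
  \<open>y \<in> cyc z\<close> is symmetric on \<open>Z\<close>, so in the double sum each
  nontrivial \<chi> value occurs \<open>p - 1\<close> times, while \<open>\<chi> \<one> = n\<close>
  occurs once for every \<open>z\<close>. Dividing by \<open>p - 1\<close> gives the
  formula.\<close>

lemma sum_mult:
  "p\<^sup>2 * n = (\<Sum>z\<in>center G. \<chi> z) + p ^ 4 * (\<Sum>z\<in>Z. central_mult (cyc z))"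
proof -
  define S where "S = (\<Sum>z\<in>center G. \<chi> z)"
  define M where "M = (\<Sum>z\<in>Z. central_mult (cyc z))"
  have finZ: "finite Z" using finite_center by simp
  have one: "\<one> \<in> center G" by (rule subgroup.one_closed[OF subgroup_center])
  have cardZ: "card Z = p\<^sup>2 - 1" using finite_center one card_center by simp
  have S: "S = n + (\<Sum>z\<in>Z. \<chi> z)"
    unfolding S_def by (subst sum.remove[OF finite_center one]) (simp add: \<chi>_one)
  have cyc_diff: "cyc z - {\<one>} = {y \<in> Z. y \<in> cyc z}" if "z \<in> Z" for z
    using cyc_subset[OF that] by blast
  have sym: "y \<in> cyc z \<longleftrightarrow> z \<in> cyc y" if "y \<in> Z" "z \<in> Z" for y z
    using cyc_eq[of z y] cyc_eq[of y z] that self_in_cyc by auto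
  have "(\<Sum>z\<in>Z. \<Sum>y\<in>cyc z - {\<one>}. \<chi> y) = (\<Sum>z\<in>Z. \<Sum>y | y \<in> Z \<and> y \<in> cyc z. \<chi> y)"
    by (intro sum.cong HOL.refl cyc_diff)
  also have "\<dots> = (\<Sum>y\<in>Z. \<Sum>z | z \<in> Z \<and> y \<in> cyc z. \<chi> y)"
    by (rule sum.swap_restrict[OF finZ finZ])
  also have "\<dots> = (\<Sum>y\<in>Z. \<Sum>z\<in>cyc y - {\<one>}. \<chi> y)"
    using sym by (intro sum.cong HOL.refl) (auto simp: cyc_diff)
  also have "\<dots> = (\<Sum>y\<in>Z. (p - 1) * \<chi> y)" by (intro sum.cong) (simp_all add: card_cyc_diff)
  finally have swap: "(\<Sum>z\<in>Z. \<Sum>y\<in>cyc z - {\<one>}. \<chi> y) = (p - 1) * (\<Sum>y\<in>Z. \<chi> y)"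
    by (simp add: sum_distrib_left)
  have "(\<Sum>z\<in>Z. p * (\<Sum>y\<in>cyc z. \<chi> y)) = (\<Sum>z\<in>Z. S + (p - 1) * p ^ 4 * central_mult (cyc z))"
    unfolding S_def by (intro sum.cong HOL.refl mult_eq cyc)
  moreover have "(\<Sum>z\<in>Z. p * (\<Sum>y\<in>cyc z. \<chi> y)) = (\<Sum>z\<in>Z. p * (n + (\<Sum>y\<in>cyc z - {\<one>}. \<chi> y)))"
    by (intro sum.cong HOL.refl) (simp add: cyc_sum_diff \<chi>_one)
  ultimately have eq: "p * ((p\<^sup>2 - 1) * n + (p - 1) * (\<Sum>y\<in>Z. \<chi> y)) = (p\<^sup>2 - 1) * S + (p - 1) * p ^ 4 * M"
    using swap cardZ by (simp add: sum.distrib M_def flip: sum_distrib_left)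
  obtain r where r: "p = Suc r" "r > 0" using p_gt_2 by (cases p) auto
  have p2: "p\<^sup>2 - 1 = r * (p + 1)" by (simp add: r power2_eq_square)
  have "r * (p * ((p + 1) * n + (\<Sum>y\<in>Z. \<chi> y))) = r * ((p + 1) * S + p ^ 4 * M)"
    using eq unfolding p2 by (simp add: r(1) algebra_simps)
  then have "p * ((p + 1) * n + (\<Sum>y\<in>Z. \<chi> y)) = (p + 1) * S + p ^ 4 * M"
    using r(2) by (simp only: mult_cancel1) simp
  then have "p\<^sup>2 * n = S + p ^ 4 * M"
    unfolding S by (simp add: algebra_simps power2_eq_square)
  then show ?thesis by (simp add: S_def M_def)
qed

lemma sum_mult_cyc: "z \<in> Z \<Longrightarrow> (\<Sum>y\<in>cyc z - {\<one>}. central_mult (cyc y)) = (p - 1) * central_mult (cyc z)"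
proof -
  assume z: "z \<in> Z"
  have "(\<Sum>y\<in>cyc z - {\<one>}. central_mult (cyc y)) = (\<Sum>y\<in>cyc z - {\<one>}. central_mult (cyc z))"
    by (intro sum.cong HOL.refl arg_cong[where f = central_mult] cyc_eq[OF z])
  then show ?thesis by (simp add: card_cyc_diff[OF z])
qed

text \<open>If only the multiplicity of \<open>cyc z\<close> could be nonzero, then
  \<open>sum_mult\<close> and \<open>mult_eq\<close> together would give \<chi> the maximal sum
  \<open>p * n\<close> on \<open>cyc z\<close>.\<close>

lemma exists_mult_pos:
  assumes z: "z \<in> Z"
  shows "\<exists>y\<in>Z. y \<notin> cyc z \<and> central_mult (cyc y) > 0"
proof (rule ccontr)
  assume "\<not> ?thesis"
  then have zero: "central_mult (cyc y) = 0" if "y \<in> Z - cyc z" for y using that by auto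
  have "(\<Sum>y\<in>Z. central_mult (cyc y)) = (\<Sum>y\<in>cyc z - {\<one>}. central_mult (cyc y))"
  proof (rule sum.mono_neutral_right)
    show "\<forall>y\<in>Z - (cyc z - {\<one>}). central_mult (cyc y) = 0" by (intro ballI zero) blast
  qed (use cyc_subset[OF z] finite_center in auto)
  then have "(\<Sum>y\<in>Z. central_mult (cyc y)) = (p - 1) * central_mult (cyc z)" by (simp only: sum_mult_cyc[OF z])
  then have "p * (p * n) = p * (\<Sum>y\<in>cyc z. \<chi> y)"
    using sum_mult mult_eq[OF cyc[OF z]] by (simp add: power2_eq_square mult.assoc mult.left_commute)
  then have "(\<Sum>y\<in>cyc z. \<chi> y) = p * n" using p_gt_2 by simp
  then show False using sum_\<chi>_neq_maximal[OF cyc[OF z]] by simp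
qed

lemma degree_lower_bound: "2 * p ^ 3 \<le> n"
proof -
  define S where "S = (\<Sum>z\<in>center G. \<chi> z)"
  have one: "\<one> \<in> center G" by (rule subgroup.one_closed[OF subgroup_center])
  have p1: "1 < p\<^sup>2" "2 * p < p\<^sup>2" using p_gt_2 one_less_power[of p 2] by (simp_all add: power2_eq_square)
  obtain z0 where z0: "z0 \<in> Z" using exists_central_outside[of "{\<one>}"] one p1 by auto
  obtain z1 where z1: "z1 \<in> Z" "central_mult (cyc z1) > 0" using exists_mult_pos[OF z0] by blast
  obtain z2 where z2: "z2 \<in> Z" "z2 \<notin> cyc z1" "central_mult (cyc z2) > 0" using exists_mult_pos[OF z1(1)] by blast
  have "card (cyc z1 \<union> cyc z2) \<le> 2 * p"
    using card_Un_le[of "cyc z1" "cyc z2"] cyc_card z1 z2 by simp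
  \<comment> \<open>Two subgroups of order \<open>p\<close> cannot cover the center, since
    \<open>2 * p < p\<^sup>2\<close> for \<open>p > 2\<close>. The third subgroup is used for its
    nonnegative character values, and its own multiplicity cancels.\<close>
  then obtain z3 where z3: "z3 \<in> center G" "z3 \<notin> cyc z1" "z3 \<notin> cyc z2"
    using exists_central_outside[of "cyc z1 \<union> cyc z2"] cyc_subset z1 z2 p1 by force
  have z3Z: "z3 \<in> Z" using z3 one_in_cyc[of z1] by auto
  define C where "C z = cyc z - {\<one>}" for z
  have disj: "C y \<inter> C z = {}" if "y \<in> Z" "z \<in> Z" "y \<notin> cyc z" for y z
  proof (rule ccontr)
    assume "C y \<inter> C z \<noteq> {}"
    then obtain w where "w \<in> C y" "w \<in> C z" by blast
    then have "cyc y = cyc z" using cyc_eq[OF that(1), of w] cyc_eq[OF that(2), of w] by (simp add: C_def)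
    then show False using that(3) self_in_cyc[of y] by simp
  qed
  have CZ: "C z \<subseteq> Z" if "z \<in> Z" for z using cyc_subset[OF that] by (auto simp: C_def)
  have finC: "finite (C z)" if "z \<in> Z" for z
    using CZ[OF that] finite_center by (meson finite_Diff finite_subset)
  let ?f = "\<lambda>z. central_mult (cyc z)"
  \<comment> \<open>The summand 2 stands for the multiplicities of the first two subgroups, which
    are at least 1 each.\<close>
  have "(p - 1) * (2 + ?f z3) \<le> (p - 1) * ?f z1 + (p - 1) * ?f z2 + (p - 1) * ?f z3"
    unfolding distrib_left[symmetric] using z1(2) z2(3) by (intro mult_left_mono) simp_all
  also have "\<dots> = sum ?f (C z1) + sum ?f (C z2) + sum ?f (C z3)"
    using sum_mult_cyc z1(1) z2(1) z3Z by (simp add: C_def)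
  also have "\<dots> = sum ?f (C z1 \<union> C z2 \<union> C z3)"
  proof -
    have "(C z1 \<union> C z2) \<inter> C z3 = {}"
      using disj[OF z3Z z1(1) z3(2)] disj[OF z3Z z2(1) z3(3)] by blast
    moreover have "C z1 \<inter> C z2 = {}" using disj[OF z2(1) z1(1) z2(2)] by blast
    ultimately show ?thesis
      using finC[OF z1(1)] finC[OF z2(1)] finC[OF z3Z] by (simp add: sum.union_disjoint)
  qed
  also have "\<dots> \<le> sum ?f Z"
    using CZ[OF z1(1)] CZ[OF z2(1)] CZ[OF z3Z] finite_center by (intro sum_mono2) auto
  finally have le: "(p - 1) * (2 + ?f z3) \<le> sum ?f Z" .
  \<comment> \<open>The sum of \<chi> over \<open>cyc z3\<close> is at least
    \<open>\<chi> \<one> = n\<close>. Comparing \<open>mult_eq\<close> for this subgroup with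
    \<open>sum_mult\<close> and dividing by \<open>p * (p - 1)\<close> yields the bound.\<close>
  have "p * n + p ^ 4 * ((p - 1) * 2) \<le> p * (\<Sum>z\<in>cyc z3. \<chi> z) + p ^ 4 * ((p - 1) * 2)"
    using cyc_sum_diff[OF z3Z, of \<chi>] by (simp add: \<chi>_one)
  also have "\<dots> = S + p ^ 4 * ((p - 1) * (2 + ?f z3))"
    unfolding mult_eq[OF cyc[OF z3Z]] S_def by (simp only: ring_distribs mult_ac add_ac)
  also have "\<dots> \<le> S + p ^ 4 * sum ?f Z" using le by (intro add_left_mono mult_left_mono) simp_all
  also have "\<dots> = p\<^sup>2 * n" using sum_mult by (simp add: S_def)
  finally have main: "p * n + p ^ 4 * ((p - 1) * 2) \<le> p\<^sup>2 * n" .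
  obtain r where r: "p = Suc r" "r > 0" using p_gt_2 by (cases p) auto
  have "p\<^sup>2 * n = p * n + p * r * n" by (simp add: r power2_eq_square algebra_simps)
  moreover have "p ^ 4 * ((p - 1) * 2) = p * r * (2 * p ^ 3)"
  proof -
    have "p - 1 = r" using r(1) by simp
    then show ?thesis by (simp only: power4_eq_xxxx power3_eq_cube mult_ac)
  qed
  ultimately have "p * r * (2 * p ^ 3) \<le> p * r * n" using main by linarith
  then show ?thesis using r p_gt_2 by (simp only: mult_le_cancel1) simp
qed

end

section \<open>The group \<open>\<phi>\<^sub>1\<^sub>5(1\<^sup>6)\<close>\<close>

fun exponent_sum :: "gen15 word \<Rightarrow> gen15 \<Rightarrow> int" where
  "exponent_sum [] x = 0"
| "exponent_sum ((y, e) # u) x = (if y = x then if e then 1 else -1 else 0) + exponent_sum u x"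

text \<open>Bilinear and deliberately not antisymmetric: antisymmetrising gives the commutator form.
  No generator is paired with itself, so powers of a single generator acquire no extra central
  term.\<close>

definition form1 :: "(gen15 \<Rightarrow> int) \<Rightarrow> (gen15 \<Rightarrow> int) \<Rightarrow> int" where
  "form1 a b = a \<alpha>1 * b \<alpha>2 + a \<alpha>3 * b \<alpha>4"

definition form2 :: "int \<Rightarrow> (gen15 \<Rightarrow> int) \<Rightarrow> (gen15 \<Rightarrow> int) \<Rightarrow> int" where
  "form2 q a b = a \<alpha>1 * b \<alpha>3 + q * a \<alpha>2 * b \<alpha>4"

text \<open>With these cocycles \<open>u \<mapsto> (exponent_sum u, beta1 u, beta2 q u)\<close> is a homomorphism from words to a
  central extension of \<open>\<int>\<^sup>4\<close> by \<open>\<int>\<^sup>2\<close>, which modulo \<open>p\<close> satisfies the relations.\<close>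

fun beta1 :: "gen15 word \<Rightarrow> int" where
  "beta1 [] = 0"
| "beta1 (l # u) = exponent_sum [l] \<beta>1 + beta1 u + form1 (exponent_sum [l]) (exponent_sum u)"

fun beta2 :: "int \<Rightarrow> gen15 word \<Rightarrow> int" where
  "beta2 q [] = 0"
| "beta2 q (l # u) = exponent_sum [l] \<beta>2 + beta2 q u + form2 q (exponent_sum [l]) (exponent_sum u)"

lemma exponent_sum_append [simp]: "exponent_sum (u @ v) x = exponent_sum u x + exponent_sum v x"
  by (induction u x rule: exponent_sum.induct) simp_all

lemma exponent_sum_Cons: "exponent_sum (l # u) x = exponent_sum [l] x + exponent_sum u x"
  using exponent_sum_append[of "[l]" u x] by simp

lemma beta1_append [simp]: "beta1 (u @ v) = beta1 u + beta1 v + form1 (exponent_sum u) (exponent_sum v)"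
proof (induction u)
  case (Cons l u)
  then show ?case by (simp add: form1_def exponent_sum_Cons[of l u] algebra_simps)
qed (simp add: form1_def)

lemma beta2_append [simp]: "beta2 q (u @ v) = beta2 q u + beta2 q v + form2 q (exponent_sum u) (exponent_sum v)"
proof (induction u)
  case (Cons l u)
  then show ?case by (simp add: form2_def exponent_sum_Cons[of l u] algebra_simps)
qed (simp add: form2_def)

lemma pow_word_Suc: "pow_word u (Suc n) = u @ pow_word u n"
  by (simp add: pow_word_def)

lemma exponent_sum_pow_gen: "exponent_sum (pow_word (gen_word y) n) x = (if y = x then int n else 0)"
  by (induction n) (simp_all add: pow_word_def gen_word_def)

lemma beta1_pow_gen: "beta1 (pow_word (gen_word y) n) = (if y = \<beta>1 then int n else 0)"
  by (induction n) (simp_all add: pow_word_Suc exponent_sum_pow_gen form1_def, simp_all add: pow_word_def gen_word_def form1_def)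

lemma beta2_pow_gen: "beta2 q (pow_word (gen_word y) n) = (if y = \<beta>2 then int n else 0)"
  by (induction n) (simp_all add: pow_word_Suc exponent_sum_pow_gen form2_def, simp_all add: pow_word_def gen_word_def form2_def)

lemmas word_invariant_simps =
  exponent_sum_pow_gen[unfolded gen_word_def] beta1_pow_gen[unfolded gen_word_def]
  beta2_pow_gen[unfolded gen_word_def] form1_def form2_def comm_word_def inv_word_def gen_word_def

text \<open>These invariants show that the presentation does not collapse: they separate the powers
  of \<beta>1 and \<beta>2 modulo \<open>p\<close>.\<close>

lemma word_eq_invariants:
  assumes "word_eq (phi15_relations p) u v"
  defines "q \<equiv> int (least_primroot p)"
  shows "(\<forall>x\<in>{\<alpha>1, \<alpha>2, \<alpha>3, \<alpha>4}. [exponent_sum u x = exponent_sum v x] (mod int p)) \<and>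
    [beta1 u = beta1 v] (mod int p) \<and> [beta2 q u = beta2 q v] (mod int p)"
  using assms(1)
proof induction
  case (refl u)
  then show ?case by simp
next
  case (sym u v)
  then show ?case by (simp add: cong_sym_eq)
next
  case (trans u v w)
  then show ?case by (auto intro: cong_trans)
next
  case (append u u' v v')
  then show ?case by (auto simp: form1_def form2_def intro!: cong_add cong_mult)
next
  case (cancel x e)
  then show ?case by (cases x; cases e) (simp_all add: form1_def form2_def)
next
  case (relation u v)
  let ?c = "\<lambda>x y. comm_word (gen_word x) (gen_word y)"
  consider "(u, v) \<in> {(?c \<alpha>1 \<alpha>2, gen_word \<beta>1), (?c \<alpha>3 \<alpha>4, gen_word \<beta>1), (?c \<alpha>1 \<alpha>3, gen_word \<beta>2),
        (?c \<alpha>2 \<alpha>4, pow_word (gen_word \<beta>2) (least_primroot p))}"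
    | "(u, v) \<in> {(pow_word (gen_word x) p, []) | x. True}"
    | "(u, v) \<in> {(?c x y, []) | x y. {x, y} \<notin> {{\<alpha>1, \<alpha>2}, {\<alpha>3, \<alpha>4}, {\<alpha>1, \<alpha>3}, {\<alpha>2, \<alpha>4}}}"
    using relation unfolding phi15_relations_def Let_def by (elim UnE)
  then show ?case
  proof cases
    case 1
    then show ?thesis
      by (elim insertE emptyE Pair_inject) (simp_all add: word_invariant_simps q_def)
  next
    case 2
    then obtain x where "(u, v) = (pow_word (gen_word x) p, [])" by (elim CollectE exE conjE)
    then show ?thesis by (simp add: exponent_sum_pow_gen beta1_pow_gen beta2_pow_gen cong_0_iff)
  next
    case 3
    then obtain x y where "(u, v) = (?c x y, [])"
        "{x, y} \<notin> {{\<alpha>1, \<alpha>2}, {\<alpha>3, \<alpha>4}, {\<alpha>1, \<alpha>3}, {\<alpha>2, \<alpha>4}}"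
      by (elim CollectE exE conjE)
    then show ?thesis
      by (cases x; cases y) (simp_all add: word_invariant_simps doubleton_eq_iff)
  qed
qed

text \<open>If \<open>p\<close> does not divide \<open>y\<close>, then it does not divide
  \<open>x\<close> either. Raising the congruence to the power \<open>(p - 1) / 2\<close> and using
  Fermat gives \<open>q\<close> an order dividing \<open>(p - 1) / 2\<close>, which is impossible
  for a primitive root.\<close>

lemma least_primroot_nonresidue:
  assumes p: "Factorial_Ring.prime p" "odd p"
    and xy: "[x\<^sup>2 = int (least_primroot p) * y\<^sup>2] (mod int p)"
  shows "int p dvd x \<and> int p dvd y"
proof -
  have p2: "p > 2" using p prime_ge_2_nat[OF p(1)] by (cases "p = 2") auto
  define q where "q = least_primroot p"
  obtain g where "residue_primroot p g"
    using prime_primitive_root_exists[of p] p p2 by auto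
  then have "0 < g \<and> residue_primroot p g" using p2 by (cases g) auto
  then have q: "residue_primroot p q"
    unfolding q_def least_primroot_def by (rule LeastI2[where a = g]) simp_all
  then have cop: "coprime p q" and ord: "ord p q = p - 1"
    using p by (auto simp: residue_primroot_def totient_prime)
  have pp: "Factorial_Ring.prime (int p)" using p by simp
  show ?thesis
  proof (cases "int p dvd y")
    case True
    then have "int p dvd x\<^sup>2"
      using cong_dvd_iff[OF xy] by (simp add: power2_eq_square)
    then show ?thesis using True prime_dvd_power[OF pp] by blast
  next
    case False
    have res: "residues (int p)" using p2 by unfold_locales simp
    have fermat: "[z ^ (p - 1) = 1] (mod int p)" if "\<not> int p dvd z" for z
    proof -
      have "coprime z (int p)"
        using prime_imp_coprime[OF pp that] by (simp add: coprime_commute)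
      from residues.euler_theorem[OF res this] show ?thesis using p by (simp add: totient_prime)
    qed
    have "\<not> int p dvd x"
    proof
      assume "int p dvd x"
      then have "int p dvd int q * y\<^sup>2"
        using cong_dvd_iff[OF xy] by (simp add: power2_eq_square q_def)
      then have "int p dvd int q"
        using False prime_dvd_power[OF pp] by (auto simp only: prime_dvd_mult_iff[OF pp])
      then have "p dvd q" by simp
      then have "p = 1" using cop by (simp add: coprime_absorb_left)
      then show False using p2 by simp
    qed
    define m where "m = (p - 1) div 2"
    have m: "p - 1 = 2 * m" using p(2) by (auto simp: m_def elim!: oddE)
    have "[(x\<^sup>2) ^ m = (int q * y\<^sup>2) ^ m] (mod int p)"
      using xy by (simp add: cong_pow q_def)
    then have "[x ^ (p - 1) = int q ^ m * y ^ (p - 1)] (mod int p)"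
      by (simp only: m power_mult power_mult_distrib)
    moreover have "[int q ^ m * y ^ (p - 1) = int q ^ m * 1] (mod int p)"
      by (intro cong_mult fermat False) simp
    ultimately have "[int q ^ m = 1] (mod int p)"
      using fermat[OF \<open>\<not> int p dvd x\<close>] by (metis cong_sym cong_trans mult.right_neutral)
    then have "[q ^ m = 1] (mod p)" by (simp flip: cong_int_iff)
    then have "ord p q dvd m" by (simp only: ord_divides)
    then have "2 * m dvd m" by (simp only: ord m)
    moreover have "m > 0" using m p2 by linarith
    ultimately show ?thesis by (auto dest: dvd_imp_le)
  qed
qed

definition alt_form1 :: "(gen15 \<Rightarrow> int) \<Rightarrow> (gen15 \<Rightarrow> int) \<Rightarrow> int" where
  "alt_form1 a b = form1 a b - form1 b a"

definition alt_form2 :: "int \<Rightarrow> (gen15 \<Rightarrow> int) \<Rightarrow> (gen15 \<Rightarrow> int) \<Rightarrow> int" where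
  "alt_form2 q a b = form2 q a b - form2 q b a"

lemmas form_alt_defs = alt_form1_def alt_form2_def form1_def form2_def

text \<open>The \<open>2 \<times> 2\<close> minors of the two forms contracted with \<open>a\<close> include \<open>(a \<alpha>3)\<^sup>2 - q (a \<alpha>2)\<^sup>2\<close> and
  \<open>(a \<alpha>1)\<^sup>2 - q (a \<alpha>4)\<^sup>2\<close>; since \<open>q\<close> is not a square one of them is invertible.\<close>

lemma forms_surjective:
  assumes p: "Factorial_Ring.prime p" "odd p"
    and a: "\<exists>x\<in>{\<alpha>1, \<alpha>2, \<alpha>3, \<alpha>4}. \<not> int p dvd a x"
  defines "q \<equiv> int (least_primroot p)"
  shows "\<exists>b. [alt_form1 a b = m] (mod int p) \<and> [alt_form2 q a b = n] (mod int p)"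
proof -
  have pp: "Factorial_Ring.prime (int p)" using p by simp
  have inv: "\<exists>d'. [(x\<^sup>2 - q * y\<^sup>2) * d' = 1] (mod int p)" if "\<not> int p dvd x \<or> \<not> int p dvd y" for x y
  proof -
    have "\<not> int p dvd x\<^sup>2 - q * y\<^sup>2"
      using least_primroot_nonresidue[OF p, of x y] that by (auto simp: cong_iff_dvd_diff q_def)
    then have "coprime (x\<^sup>2 - q * y\<^sup>2) (int p)"
      using prime_imp_coprime[OF pp] coprime_commute by blast
    then show ?thesis using cong_solve_coprime_int by blast
  qed
  show ?thesis
  proof (cases "int p dvd a \<alpha>2 \<and> int p dvd a \<alpha>3")
    case False
    then obtain d where d: "[((a \<alpha>3)\<^sup>2 - q * (a \<alpha>2)\<^sup>2) * d = 1] (mod int p)"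
      using inv[of "a \<alpha>3" "a \<alpha>2"] by auto
    \<comment> \<open>Cramer's rule for the two equations in the coordinates \<alpha>1 and
      \<alpha>4, with \<open>d\<close> the inverse of the determinant modulo
      \<open>p\<close>.\<close>
    define b where "b = (\<lambda>x. case x of \<alpha>1 \<Rightarrow> d * (q * a \<alpha>2 * m - a \<alpha>3 * n) | \<alpha>4 \<Rightarrow> d * (a \<alpha>3 * m - a \<alpha>2 * n) | _ \<Rightarrow> 0)"
    have "alt_form1 a b = ((a \<alpha>3)\<^sup>2 - q * (a \<alpha>2)\<^sup>2) * d * m" "alt_form2 q a b = ((a \<alpha>3)\<^sup>2 - q * (a \<alpha>2)\<^sup>2) * d * n"
      by (simp_all add: form_alt_defs b_def power2_eq_square algebra_simps)
    then have "[alt_form1 a b = 1 * m] (mod int p)" "[alt_form2 q a b = 1 * n] (mod int p)"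
      using cong_scalar_right[OF d] by simp_all
    then show ?thesis by auto
  next
    case True
    then obtain d where d: "[((a \<alpha>1)\<^sup>2 - q * (a \<alpha>4)\<^sup>2) * d = 1] (mod int p)"
      using inv[of "a \<alpha>1" "a \<alpha>4"] a by auto
    \<comment> \<open>Cramer's rule again, now in the coordinates \<alpha>2 and \<alpha>3.\<close>
    define b where "b = (\<lambda>x. case x of \<alpha>2 \<Rightarrow> d * (a \<alpha>1 * m + a \<alpha>4 * n) | \<alpha>3 \<Rightarrow> d * (q * a \<alpha>4 * m + a \<alpha>1 * n) | _ \<Rightarrow> 0)"
    have "alt_form1 a b = ((a \<alpha>1)\<^sup>2 - q * (a \<alpha>4)\<^sup>2) * d * m" "alt_form2 q a b = ((a \<alpha>1)\<^sup>2 - q * (a \<alpha>4)\<^sup>2) * d * n"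
      by (simp_all add: form_alt_defs b_def power2_eq_square algebra_simps)
    then have "[alt_form1 a b = 1 * m] (mod int p)" "[alt_form2 q a b = 1 * n] (mod int p)"
      using cong_scalar_right[OF d] by simp_all
    then show ?thesis by auto
  qed
qed

lemma inv_word_class: "inv\<^bsub>presented_group R\<^esub> word_class R u = word_class R (inv_word u)"
proof -
  interpret group "presented_group R" by (rule group_presented_group)
  have carr: "word_class R w \<in> carrier (presented_group R)" for w by (simp add: presented_group_def)
  show ?thesis
  proof (rule inv_equality)
    show "word_class R (inv_word u) \<otimes>\<^bsub>presented_group R\<^esub> word_class R u = \<one>\<^bsub>presented_group R\<^esub>"
      unfolding presented_group_mult by (simp add: presented_group_def word_class_eq_iff word_eq_inv_word)
  qed (rule carr)+
qed

section \<open>The defining relations read in the presented group\<close>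

locale phi15 =
  fixes p :: nat
  assumes prime: "Factorial_Ring.prime p" and odd: "odd p"
begin

abbreviation "H \<equiv> phi15_group p"
abbreviation "cls \<equiv> word_class (phi15_relations p)"
abbreviation "q \<equiv> int (least_primroot p)"

definition gen :: "gen15 \<Rightarrow> gen15 word set" where
  "gen x = cls (gen_word x)"

sublocale group H
  unfolding phi15_group_def by (rule group_presented_group)

lemma p_pos: "p > 0" using prime by (rule prime_gt_0_nat)

lemma carrier_eq: "carrier H = range cls"
  by (simp add: phi15_group_def presented_group_def)

lemma cls_carrier [simp]: "cls u \<in> carrier H"
  by (simp add: carrier_eq)

lemma gen_carrier [simp]: "gen x \<in> carrier H"
  by (simp add: gen_def)

lemma cls_append: "cls (u @ v) = cls u \<otimes>\<^bsub>H\<^esub> cls v"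
  by (simp add: phi15_group_def presented_group_mult)

lemma cls_Nil: "cls [] = \<one>\<^bsub>H\<^esub>"
  by (simp add: phi15_group_def presented_group_def)

lemma cls_inv_word: "cls (inv_word u) = inv\<^bsub>H\<^esub> cls u"
  by (simp add: phi15_group_def inv_word_class)

lemma cls_comm_word: "cls (comm_word u v) = commutator H (cls u) (cls v)"
  by (simp add: comm_word_def cls_append cls_inv_word commutator_def m_assoc)

lemma cls_pow_word: "cls (pow_word u n) = cls u [^]\<^bsub>H\<^esub> n"
proof (induction n)
  case (Suc n)
  have "cls (pow_word u (Suc n)) = cls u \<otimes>\<^bsub>H\<^esub> cls u [^]\<^bsub>H\<^esub> n"
    by (simp add: pow_word_Suc cls_append Suc)
  then show ?case by (simp only: nat_pow_Suc2[OF cls_carrier])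
qed (simp add: pow_word_def cls_Nil)

lemma cls_relation: "(u, v) \<in> phi15_relations p \<Longrightarrow> cls u = cls v"
  by (simp add: word_class_eq_iff word_eq.relation)

lemma cls_Cons: "cls ((x, e) # u) = (if e then gen x else inv\<^bsub>H\<^esub> gen x) \<otimes>\<^bsub>H\<^esub> cls u"
proof -
  have "cls [(x, False)] = inv\<^bsub>H\<^esub> gen x"
    using cls_inv_word[of "gen_word x"] by (simp add: gen_def gen_word_def inv_word_def)
  then have "cls [(x, e)] = (if e then gen x else inv\<^bsub>H\<^esub> gen x)"
    by (cases e) (simp_all add: gen_def gen_word_def)
  then show ?thesis using cls_append[of "[(x, e)]" u] by simp
qed

lemma gen_pow_p: "gen x [^]\<^bsub>H\<^esub> p = \<one>\<^bsub>H\<^esub>"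
proof -
  have "(pow_word (gen_word x) p, []) \<in> phi15_relations p"
    unfolding phi15_relations_def Let_def by blast
  from cls_relation[OF this] show ?thesis by (simp add: gen_def cls_pow_word cls_Nil)
qed

lemma commutator_gen_trivial:
  assumes "{x, y} \<notin> {{\<alpha>1, \<alpha>2}, {\<alpha>3, \<alpha>4}, {\<alpha>1, \<alpha>3}, {\<alpha>2, \<alpha>4}}"
  shows "commutator H (gen x) (gen y) = \<one>\<^bsub>H\<^esub>"
proof -
  have "(comm_word (gen_word x) (gen_word y), []) \<in> phi15_relations p"
    unfolding phi15_relations_def Let_def using assms by (intro UnI2) blast
  from cls_relation[OF this] show ?thesis by (simp add: gen_def cls_comm_word cls_Nil)
qed

lemma commutator_gen_listed:
  "commutator H (gen \<alpha>1) (gen \<alpha>2) = gen \<beta>1"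
  "commutator H (gen \<alpha>3) (gen \<alpha>4) = gen \<beta>1"
  "commutator H (gen \<alpha>1) (gen \<alpha>3) = gen \<beta>2"
  "commutator H (gen \<alpha>2) (gen \<alpha>4) = gen \<beta>2 [^]\<^bsub>H\<^esub> least_primroot p"
proof -
  let ?R = "phi15_relations p"
  let ?c = "\<lambda>x y. comm_word (gen_word x) (gen_word y)"
  have "(?c \<alpha>1 \<alpha>2, gen_word \<beta>1) \<in> ?R" "(?c \<alpha>3 \<alpha>4, gen_word \<beta>1) \<in> ?R" "(?c \<alpha>1 \<alpha>3, gen_word \<beta>2) \<in> ?R"
    "(?c \<alpha>2 \<alpha>4, pow_word (gen_word \<beta>2) (least_primroot p)) \<in> ?R"
    unfolding phi15_relations_def Let_def by (intro UnI1, simp)+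
  from this[THEN cls_relation]
  show "commutator H (gen \<alpha>1) (gen \<alpha>2) = gen \<beta>1"
    "commutator H (gen \<alpha>3) (gen \<alpha>4) = gen \<beta>1"
    "commutator H (gen \<alpha>1) (gen \<alpha>3) = gen \<beta>2"
    "commutator H (gen \<alpha>2) (gen \<alpha>4) = gen \<beta>2 [^]\<^bsub>H\<^esub> least_primroot p"
    by (simp_all add: gen_def cls_comm_word cls_pow_word)
qed

lemma gen_beta_central:
  assumes "y \<in> {\<beta>1, \<beta>2}"
  shows "gen y \<in> center H"
proof -
  have comm: "gen y \<otimes>\<^bsub>H\<^esub> gen x = gen x \<otimes>\<^bsub>H\<^esub> gen y" for x
  proof -
    have "commutator H (gen y) (gen x) = \<one>\<^bsub>H\<^esub>"
      using assms by (intro commutator_gen_trivial) (auto simp: doubleton_eq_iff)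
    then show ?thesis by (simp add: commutator_eq_one_iff)
  qed
  have comm': "gen y \<otimes>\<^bsub>H\<^esub> inv\<^bsub>H\<^esub> gen x = inv\<^bsub>H\<^esub> gen x \<otimes>\<^bsub>H\<^esub> gen y" for x
    using commutation_inv_left[of "gen x" "gen y" "\<one>\<^bsub>H\<^esub>"] comm[of x]
    by (simp add: subgroup.one_closed[OF subgroup_center])
  have "gen y \<otimes>\<^bsub>H\<^esub> cls u = cls u \<otimes>\<^bsub>H\<^esub> gen y" for u
  proof (induction u)
    case Nil
    show ?case by (simp add: cls_Nil)
  next
    case (Cons l u)
    obtain x e where l: "l = (x, e)" by (cases l)
    define g where "g = (if e then gen x else inv\<^bsub>H\<^esub> gen x)"
    have g: "g \<in> carrier H" "gen y \<otimes>\<^bsub>H\<^esub> g = g \<otimes>\<^bsub>H\<^esub> gen y"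
      using comm comm' by (simp_all add: g_def)
    have "gen y \<otimes>\<^bsub>H\<^esub> (g \<otimes>\<^bsub>H\<^esub> cls u) = g \<otimes>\<^bsub>H\<^esub> (gen y \<otimes>\<^bsub>H\<^esub> cls u)"
      using g by (simp add: m_assoc[symmetric])
    then show ?case
      using g Cons by (simp add: l cls_Cons g_def[symmetric] m_assoc)
  qed
  then show ?thesis using gen_carrier by (auto simp: center_def carrier_eq)
qed

end

text \<open>Two maps with the same fibres have images of the same size. This lets cosets of the
  center be counted by exponent sums of words.\<close>

lemma card_image_eq_card_image:
  assumes "\<And>x y. x \<in> A \<Longrightarrow> y \<in> A \<Longrightarrow> f x = f y \<longleftrightarrow> g x = g y"
  shows "card (f ` A) = card (g ` A)"
proof -
  have "bij_betw (\<lambda>b. g (inv_into A f b)) (f ` A) (g ` A)"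
  proof (rule bij_betwI')
    fix b b' assume "b \<in> f ` A" "b' \<in> f ` A"
    then show "g (inv_into A f b) = g (inv_into A f b') \<longleftrightarrow> b = b'"
      by (metis assms f_inv_into_f inv_into_into)
  next
    fix b assume "b \<in> f ` A"
    then show "g (inv_into A f b) \<in> g ` A" by (simp add: inv_into_into)
  next
    fix c assume "c \<in> g ` A"
    then obtain x where x: "x \<in> A" "c = g x" by blast
    then have "g (inv_into A f (f x)) = g x"
      using assms[of "inv_into A f (f x)" x] f_inv_into_f[of "f x" f A] by (simp add: inv_into_into)
    then show "\<exists>b\<in>f ` A. c = g (inv_into A f b)" using x by (intro bexI[of _ "f x"]) simp_all
  qed
  then show ?thesis by (rule bij_betw_same_card)
qed

lemma exponent_sum_inv_word: "exponent_sum (inv_word u) x = - exponent_sum u x"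
proof (induction u)
  case (Cons l u)
  then show ?case by (cases l) (simp add: inv_word_def)
qed (simp add: inv_word_def)

section \<open>Commutators, center and derived subgroup of the presented group\<close>

context phi15
begin

definition beta_elem :: "int \<Rightarrow> int \<Rightarrow> gen15 word set" where
  "beta_elem m n = gen \<beta>1 [^]\<^bsub>H\<^esub> m \<otimes>\<^bsub>H\<^esub> gen \<beta>2 [^]\<^bsub>H\<^esub> n"

lemma gen_beta_pow_central: "y \<in> {\<beta>1, \<beta>2} \<Longrightarrow> gen y [^]\<^bsub>H\<^esub> (n :: int) \<in> center H"
  by (intro subgroup_int_pow_closed[OF subgroup_center] gen_beta_central)

lemma beta_elem_central: "beta_elem m n \<in> center H"
  unfolding beta_elem_def by (intro subgroup.m_closed[OF subgroup_center] gen_beta_pow_central) simp_all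

lemma beta_elem_carrier [simp]: "beta_elem m n \<in> carrier H"
  by (rule center_carrier[OF beta_elem_central])

lemma beta_elem_add: "beta_elem m n \<otimes>\<^bsub>H\<^esub> beta_elem m' n' = beta_elem (m + m') (n + n')"
proof -
  let ?a = "gen \<beta>1 [^]\<^bsub>H\<^esub> m" and ?b = "gen \<beta>2 [^]\<^bsub>H\<^esub> n"
  let ?a' = "gen \<beta>1 [^]\<^bsub>H\<^esub> m'" and ?b' = "gen \<beta>2 [^]\<^bsub>H\<^esub> n'"
  have "?b \<otimes>\<^bsub>H\<^esub> ?a' = ?a' \<otimes>\<^bsub>H\<^esub> ?b"
    by (intro center_commute gen_beta_pow_central) simp_all
  then have "?a \<otimes>\<^bsub>H\<^esub> (?b \<otimes>\<^bsub>H\<^esub> ?a') \<otimes>\<^bsub>H\<^esub> ?b' = ?a \<otimes>\<^bsub>H\<^esub> (?a' \<otimes>\<^bsub>H\<^esub> ?b) \<otimes>\<^bsub>H\<^esub> ?b'"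
    by simp
  then show ?thesis by (simp add: beta_elem_def int_pow_mult m_assoc)
qed

lemma beta_elem_0 [simp]: "beta_elem 0 0 = \<one>\<^bsub>H\<^esub>"
  by (simp add: beta_elem_def)

lemma inv_beta_elem: "inv\<^bsub>H\<^esub> beta_elem m n = beta_elem (- m) (- n)"
  by (rule inv_equality) (simp_all add: beta_elem_add)

text \<open>The exponents are kept as integers, so inverting, swapping and multiplying act on them
  by negation and addition, exactly as on the alternating forms.\<close>

definition commute_up_to :: "gen15 word set \<Rightarrow> gen15 word set \<Rightarrow> int \<Rightarrow> int \<Rightarrow> bool" where
  "commute_up_to x y m n \<longleftrightarrow> x \<in> carrier H \<and> y \<in> carrier H \<and> x \<otimes>\<^bsub>H\<^esub> y = y \<otimes>\<^bsub>H\<^esub> x \<otimes>\<^bsub>H\<^esub> beta_elem m n"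

lemma commute_up_to_swap: "commute_up_to x y m n \<Longrightarrow> commute_up_to y x (- m) (- n)"
  unfolding commute_up_to_def inv_beta_elem[symmetric] using commutation_swap[OF _ _ beta_elem_central] by blast

lemma commute_up_to_inv: "commute_up_to x y m n \<Longrightarrow> commute_up_to (inv\<^bsub>H\<^esub> x) y (- m) (- n)"
  unfolding commute_up_to_def inv_beta_elem[symmetric] using commutation_inv_left[OF _ _ beta_elem_central] inv_closed by blast

lemma commute_up_to_mult: "commute_up_to x y m n \<Longrightarrow> commute_up_to x' y m' n' \<Longrightarrow> commute_up_to (x \<otimes>\<^bsub>H\<^esub> x') y (m + m') (n + n')"
  unfolding commute_up_to_def beta_elem_add[symmetric]
  using commutation_mult_left[OF _ _ _ beta_elem_central beta_elem_central] m_closed by blast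

lemma commute_up_to_one: "y \<in> carrier H \<Longrightarrow> commute_up_to \<one>\<^bsub>H\<^esub> y 0 0"
  by (simp add: commute_up_to_def)

lemma commute_up_toI: "x \<in> carrier H \<Longrightarrow> y \<in> carrier H \<Longrightarrow> commutator H x y = beta_elem m n \<Longrightarrow> commute_up_to x y m n"
  using mult_commutator[of x y] by (simp add: commute_up_to_def)

lemma commute_up_to_commutator: "commute_up_to x y m n \<Longrightarrow> commutator H x y = beta_elem m n"
  unfolding commute_up_to_def by (intro commutator_eqI) auto

lemma commute_up_to_gen:
  "commute_up_to (gen x) (gen y) (alt_form1 (exponent_sum (gen_word x)) (exponent_sum (gen_word y)))
     (alt_form2 q (exponent_sum (gen_word x)) (exponent_sum (gen_word y)))"
proof -
  have L: "commute_up_to (gen \<alpha>1) (gen \<alpha>2) 1 0" "commute_up_to (gen \<alpha>3) (gen \<alpha>4) 1 0"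
    "commute_up_to (gen \<alpha>1) (gen \<alpha>3) 0 1" "commute_up_to (gen \<alpha>2) (gen \<alpha>4) 0 q"
    by (rule commute_up_toI; simp add: commutator_gen_listed beta_elem_def int_pow_int)+
  note S = L[THEN commute_up_to_swap]
  have T: "commute_up_to (gen x) (gen y) 0 0"
    if "{x, y} \<notin> {{\<alpha>1, \<alpha>2}, {\<alpha>3, \<alpha>4}, {\<alpha>1, \<alpha>3}, {\<alpha>2, \<alpha>4}}" for x y
    using commutator_gen_trivial[OF that] by (intro commute_up_toI) simp_all
  show ?thesis
    using L S by (cases x; cases y) (simp_all add: form_alt_defs gen_word_def T doubleton_eq_iff)
qed

text \<open>Linearity in the first argument for a fixed \<open>y\<close>, whose role in the forms is
  played by \<open>b\<close>. Used twice, with a swap in between, it passes from generators to words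
  in both arguments.\<close>

lemma commute_up_to_cls_induct:
  assumes "\<And>x. commute_up_to (gen x) y (alt_form1 (exponent_sum (gen_word x)) b) (alt_form2 q (exponent_sum (gen_word x)) b)"
  shows "commute_up_to (cls u) y (alt_form1 (exponent_sum u) b) (alt_form2 q (exponent_sum u) b)"
proof (induction u)
  case Nil
  have "y \<in> carrier H" using assms by (auto simp: commute_up_to_def)
  then show ?case by (simp add: cls_Nil commute_up_to_one form_alt_defs)
next
  case (Cons l u)
  obtain x e where l: "l = (x, e)" by (cases l)
  show ?case
  proof (cases e)
    case True
    have eq: "exponent_sum (l # u) = (\<lambda>z. exponent_sum (gen_word x) z + exponent_sum u z)"
      using True by (auto simp: l gen_word_def)
    show ?thesis
      using commute_up_to_mult[OF assms[of x] Cons] True unfolding eq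
      by (simp add: l cls_Cons form_alt_defs algebra_simps)
  next
    case False
    have eq: "exponent_sum (l # u) = (\<lambda>z. - exponent_sum (gen_word x) z + exponent_sum u z)"
      using False by (auto simp: l gen_word_def)
    show ?thesis
      using commute_up_to_mult[OF commute_up_to_inv[OF assms[of x]] Cons] False unfolding eq
      by (simp add: l cls_Cons form_alt_defs algebra_simps)
  qed
qed

lemma commute_up_to_cls:
  "commute_up_to (cls u) (cls v) (alt_form1 (exponent_sum u) (exponent_sum v)) (alt_form2 q (exponent_sum u) (exponent_sum v))"
proof (rule commute_up_to_cls_induct)
  fix x
  have "commute_up_to (cls v) (gen x) (alt_form1 (exponent_sum v) (exponent_sum (gen_word x))) (alt_form2 q (exponent_sum v) (exponent_sum (gen_word x)))"
    by (rule commute_up_to_cls_induct[OF commute_up_to_gen])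
  from commute_up_to_swap[OF this]
  show "commute_up_to (gen x) (cls v) (alt_form1 (exponent_sum (gen_word x)) (exponent_sum v)) (alt_form2 q (exponent_sum (gen_word x)) (exponent_sum v))"
    by (simp add: alt_form1_def alt_form2_def)
qed

lemmas commutator_cls = commute_up_to_commutator[OF commute_up_to_cls]

lemma gen_int_pow_cong:
  assumes "[m = n] (mod int p)"
  shows "gen x [^]\<^bsub>H\<^esub> m = gen x [^]\<^bsub>H\<^esub> n"
proof -
  have "int p dvd m - n" using assms by (simp add: cong_iff_dvd_diff)
  then obtain k where "m - n = int p * k" by (elim dvdE)
  then have k: "m = n + int p * k" by simp
  have "gen x [^]\<^bsub>H\<^esub> (int p * k) = (gen x [^]\<^bsub>H\<^esub> int p) [^]\<^bsub>H\<^esub> k"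
    by (simp only: int_pow_pow gen_carrier)
  also have "\<dots> = \<one>\<^bsub>H\<^esub>"
    by (simp only: int_pow_int gen_pow_p int_pow_one)
  finally have "gen x [^]\<^bsub>H\<^esub> (int p * k) = \<one>\<^bsub>H\<^esub>" .
  then show ?thesis by (simp add: k int_pow_mult)
qed

lemma beta_elem_cong: "[m = m'] (mod int p) \<Longrightarrow> [n = n'] (mod int p) \<Longrightarrow> beta_elem m n = beta_elem m' n'"
  by (simp add: beta_elem_def gen_int_pow_cong[of m m'] gen_int_pow_cong[of n n'])

text \<open>The word with natural exponents \<open>a\<close> and \<open>b\<close> representing this
  element has invariants \<open>a\<close> and \<open>b\<close>, which must agree modulo
  \<open>p\<close> with those of the empty word.\<close>

lemma beta_elem_eq_oneD:
  assumes "beta_elem m n = \<one>\<^bsub>H\<^esub>"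
  shows "int p dvd m \<and> int p dvd n"
proof -
  define a where "a = nat (m mod int p)"
  define b where "b = nat (n mod int p)"
  have ab: "[m = int a] (mod int p)" "[n = int b] (mod int p)"
    using p_pos by (simp_all add: a_def b_def cong_def)
  let ?w = "pow_word (gen_word \<beta>1) a @ pow_word (gen_word \<beta>2) b"
  have "cls ?w = beta_elem (int a) (int b)"
    by (simp add: cls_append cls_pow_word beta_elem_def gen_def int_pow_int)
  also have "\<dots> = cls []" using beta_elem_cong[OF ab] assms by (simp add: cls_Nil)
  finally have "word_eq (phi15_relations p) ?w []" by (simp add: word_class_eq_iff)
  from word_eq_invariants[OF this] have "[int a = 0] (mod int p)" "[int b = 0] (mod int p)"
    by (simp_all add: form1_def form2_def exponent_sum_pow_gen beta1_pow_gen beta2_pow_gen)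
  with ab show ?thesis by (metis cong_0_iff cong_trans)
qed

lemma beta_elem_eq_iff: "beta_elem m n = beta_elem m' n' \<longleftrightarrow> [m = m'] (mod int p) \<and> [n = n'] (mod int p)"
proof
  assume "beta_elem m n = beta_elem m' n'"
  then have "beta_elem m n \<otimes>\<^bsub>H\<^esub> inv\<^bsub>H\<^esub> beta_elem m' n' = \<one>\<^bsub>H\<^esub>" by simp
  then have "beta_elem (m - m') (n - n') = \<one>\<^bsub>H\<^esub>" by (simp add: inv_beta_elem beta_elem_add)
  from beta_elem_eq_oneD[OF this] show "[m = m'] (mod int p) \<and> [n = n'] (mod int p)"
    by (simp add: cong_iff_dvd_diff)
qed (use beta_elem_cong in blast)

lemma exists_word_exponent_sum: "\<exists>v. \<forall>x\<in>{\<alpha>1, \<alpha>2, \<alpha>3, \<alpha>4}. [exponent_sum v x = b x] (mod int p)"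
proof -
  define w where "w = (\<lambda>x. pow_word (gen_word x) (nat (b x mod int p)))"
  have w: "exponent_sum (w x) y = (if x = y then b x mod int p else 0)" for x y
    using p_pos by (simp add: w_def exponent_sum_pow_gen)
  have "\<forall>x\<in>{\<alpha>1, \<alpha>2, \<alpha>3, \<alpha>4}. exponent_sum (w \<alpha>1 @ w \<alpha>2 @ w \<alpha>3 @ w \<alpha>4) x = b x mod int p"
    by (simp add: w)
  then show ?thesis by (intro exI[of _ "w \<alpha>1 @ w \<alpha>2 @ w \<alpha>3 @ w \<alpha>4"]) (simp add: cong_def)
qed

lemma commutator_cls_surjective:
  assumes "\<exists>x\<in>{\<alpha>1, \<alpha>2, \<alpha>3, \<alpha>4}. \<not> int p dvd exponent_sum u x"
  shows "\<exists>v. commutator H (cls u) (cls v) = beta_elem m n"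
proof -
  obtain b where b: "[alt_form1 (exponent_sum u) b = m] (mod int p)" "[alt_form2 q (exponent_sum u) b = n] (mod int p)"
    using forms_surjective[OF prime odd assms] by blast
  obtain v where v: "\<forall>x\<in>{\<alpha>1, \<alpha>2, \<alpha>3, \<alpha>4}. [exponent_sum v x = b x] (mod int p)"
    using exists_word_exponent_sum by blast
  have "[alt_form1 (exponent_sum u) (exponent_sum v) = alt_form1 (exponent_sum u) b] (mod int p)"
    "[alt_form2 q (exponent_sum u) (exponent_sum v) = alt_form2 q (exponent_sum u) b] (mod int p)"
    unfolding form_alt_defs using v by (intro cong_diff cong_add cong_mult cong_refl; simp)+
  then have "commutator H (cls u) (cls v) = beta_elem m n"
    unfolding commutator_cls using b cong_trans by (intro beta_elem_cong) blast+
  then show ?thesis by blast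
qed

text \<open>If some exponent sum is not divisible by \<open>p\<close>, then \<beta>1 is a commutator
  with the element, and it is nontrivial. Otherwise both forms vanish modulo \<open>p\<close>
  against every word.\<close>

lemma center_cls_iff: "cls u \<in> center H \<longleftrightarrow> (\<forall>x\<in>{\<alpha>1, \<alpha>2, \<alpha>3, \<alpha>4}. int p dvd exponent_sum u x)"
proof
  assume c: "cls u \<in> center H"
  show "\<forall>x\<in>{\<alpha>1, \<alpha>2, \<alpha>3, \<alpha>4}. int p dvd exponent_sum u x"
  proof (rule ccontr)
    assume "\<not> ?thesis"
    then obtain v where "commutator H (cls u) (cls v) = beta_elem 1 0"
      using commutator_cls_surjective[of u 1 0] by blast
    moreover have "commutator H (cls u) (cls v) = \<one>\<^bsub>H\<^esub>"
      using c by (simp add: center_iff_commutator)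
    ultimately have "int p dvd 1" using beta_elem_eq_oneD by metis
    then show False using prime_gt_1_nat[OF prime] by simp
  qed
next
  assume d: "\<forall>x\<in>{\<alpha>1, \<alpha>2, \<alpha>3, \<alpha>4}. int p dvd exponent_sum u x"
  have "beta_elem (alt_form1 (exponent_sum u) (exponent_sum v)) (alt_form2 q (exponent_sum u) (exponent_sum v)) = beta_elem 0 0" for v
    using d by (intro beta_elem_cong) (simp_all add: form_alt_defs cong_0_iff)
  then show "cls u \<in> center H"
    by (auto simp: center_iff_commutator carrier_eq commutator_cls)
qed

lemma commutator_in_beta_elem: "x \<in> carrier H \<Longrightarrow> y \<in> carrier H \<Longrightarrow> \<exists>m n. commutator H x y = beta_elem m n"
  unfolding carrier_eq using commutator_cls by (elim rangeE) auto

lemma noncentral_commutator_surjective: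
  assumes "x \<in> carrier H" "x \<notin> center H"
  shows "\<exists>y\<in>carrier H. commutator H x y = beta_elem m n"
proof -
  obtain u where u: "x = cls u" using assms(1) by (auto simp: carrier_eq)
  then have "\<exists>x\<in>{\<alpha>1, \<alpha>2, \<alpha>3, \<alpha>4}. \<not> int p dvd exponent_sum u x"
    using assms(2) by (simp add: center_cls_iff)
  then obtain v where "commutator H (cls u) (cls v) = beta_elem m n"
    using commutator_cls_surjective by blast
  then show ?thesis using u by (intro bexI[of _ "cls v"]) simp_all
qed

lemma derived_eq: "derived H (carrier H) = (\<lambda>(m, n). beta_elem m n) ` ({0..<int p} \<times> {0..<int p})" (is "_ = ?N")
proof -
  have beta_elem_in: "beta_elem m n \<in> ?N" for m n
  proof -
    have "beta_elem m n = beta_elem (m mod int p) (n mod int p)" by (intro beta_elem_cong) simp_all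
    moreover have "(m mod int p, n mod int p) \<in> {0..<int p} \<times> {0..<int p}" using p_pos by simp
    ultimately show ?thesis by force
  qed
  have N: "?N = {z. \<exists>m n. z = beta_elem m n}"
  proof
    show "?N \<subseteq> {z. \<exists>m n. z = beta_elem m n}" by auto
    show "{z. \<exists>m n. z = beta_elem m n} \<subseteq> ?N" using beta_elem_in by blast
  qed
  have "subgroup ?N H"
    unfolding N
  proof (rule subgroupI)
    fix a b assume "a \<in> {z. \<exists>m n. z = beta_elem m n}" "b \<in> {z. \<exists>m n. z = beta_elem m n}"
    then show "a \<otimes>\<^bsub>H\<^esub> b \<in> {z. \<exists>m n. z = beta_elem m n}" "inv\<^bsub>H\<^esub> a \<in> {z. \<exists>m n. z = beta_elem m n}"
      using beta_elem_add inv_beta_elem by blast+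
  qed auto
  then have "derived H (carrier H) \<subseteq> ?N"
    unfolding N using commutator_in_beta_elem by (intro derived_subset) simp_all
  moreover have "?N \<subseteq> derived H (carrier H)"
  proof
    fix z assume "z \<in> ?N"
    then obtain m n where z: "z = beta_elem m n" by auto
    \<comment> \<open>One noncentral element suffices, because its commutators already exhaust the
      right-hand side.\<close>
    have "gen \<alpha>1 \<notin> center H"
      using prime_gt_1_nat[OF prime] by (simp add: gen_def center_cls_iff gen_word_def)
    then obtain y where "y \<in> carrier H" "commutator H (gen \<alpha>1) y = z"
      using noncentral_commutator_surjective[of "gen \<alpha>1" m n] z by auto
    then show "z \<in> derived H (carrier H)" using commutator_in_derived[of "gen \<alpha>1" y] by simp
  qed
  ultimately show ?thesis by blast
qed

lemma derived_central: "derived H (carrier H) \<subseteq> center H"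
  using beta_elem_central by (auto simp: derived_eq)

lemma card_derived: "card (derived H (carrier H)) = p\<^sup>2"
proof -
  have "inj_on (\<lambda>(m, n). beta_elem m n) ({0..<int p} \<times> {0..<int p})"
    by (auto simp: inj_on_def beta_elem_eq_iff cong_def)
  then show ?thesis by (simp add: derived_eq card_image power2_eq_square)
qed

lemma derived_exponent:
  assumes "z \<in> derived H (carrier H)"
  shows "z [^]\<^bsub>H\<^esub> p = \<one>\<^bsub>H\<^esub>"
proof -
  obtain m n where z: "z = beta_elem m n" using assms by (auto simp: derived_eq)
  have "beta_elem m n [^]\<^bsub>H\<^esub> k = beta_elem (int k * m) (int k * n)" for k :: nat
    by (induction k) (simp_all add: beta_elem_add algebra_simps)
  then have "z [^]\<^bsub>H\<^esub> p = beta_elem (int p * m) (int p * n)" by (simp add: z)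
  also have "\<dots> = beta_elem 0 0" by (intro beta_elem_cong) (simp_all add: cong_0_iff)
  finally show ?thesis by simp
qed

lemma card_center_quotient: "card (carrier (H Mod center H)) = p ^ 4"
proof -
  \<comment> \<open>The coset of a word modulo the center is determined by the four \<alpha>
    exponent sums modulo \<open>p\<close>, and all tuples occur.\<close>
  define F where "F = (\<lambda>u. (exponent_sum u \<alpha>1 mod int p, exponent_sum u \<alpha>2 mod int p, exponent_sum u \<alpha>3 mod int p, exponent_sum u \<alpha>4 mod int p))"
  let ?P = "{0..<int p}"
  have eq: "F u = F v \<longleftrightarrow> center H #>\<^bsub>H\<^esub> cls u = center H #>\<^bsub>H\<^esub> cls v" for u v
  proof -
    have "center H #>\<^bsub>H\<^esub> cls u = center H #>\<^bsub>H\<^esub> cls v \<longleftrightarrow> cls u \<otimes>\<^bsub>H\<^esub> inv\<^bsub>H\<^esub> cls v \<in> center H"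
      by (rule rcoset_eq_iff[OF subgroup_center]) simp_all
    also have "cls u \<otimes>\<^bsub>H\<^esub> inv\<^bsub>H\<^esub> cls v = cls (u @ inv_word v)"
      by (simp only: cls_append cls_inv_word)
    also have "\<dots> \<in> center H \<longleftrightarrow> (\<forall>x\<in>{\<alpha>1, \<alpha>2, \<alpha>3, \<alpha>4}. int p dvd exponent_sum u x - exponent_sum v x)"
      unfolding center_cls_iff exponent_sum_append exponent_sum_inv_word by simp
    also have "\<dots> \<longleftrightarrow> F u = F v"
      by (simp only: F_def prod.inject mod_eq_dvd_iff ball_simps simp_thms)
    finally show ?thesis by (rule HOL.sym)
  qed
  have "carrier (H Mod center H) = (\<lambda>u. center H #>\<^bsub>H\<^esub> cls u) ` UNIV"
    by (auto simp: FactGroup_def RCOSETS_def carrier_eq)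
  then have "card (carrier (H Mod center H)) = card (F ` UNIV)"
    using card_image_eq_card_image[of UNIV F, OF eq] by simp
  also have "F ` UNIV = ?P \<times> ?P \<times> ?P \<times> ?P"
  proof
    show "F ` UNIV \<subseteq> ?P \<times> ?P \<times> ?P \<times> ?P" using p_pos by (auto simp: F_def)
    show "?P \<times> ?P \<times> ?P \<times> ?P \<subseteq> F ` UNIV"
    proof
      fix t assume "t \<in> ?P \<times> ?P \<times> ?P \<times> ?P"
      then obtain a b c d where t: "t = (a, b, c, d)" and P: "a \<in> ?P" "b \<in> ?P" "c \<in> ?P" "d \<in> ?P" by auto
      obtain v where "\<forall>x\<in>{\<alpha>1, \<alpha>2, \<alpha>3, \<alpha>4}. [exponent_sum v x = (case x of \<alpha>1 \<Rightarrow> a | \<alpha>2 \<Rightarrow> b | \<alpha>3 \<Rightarrow> c | _ \<Rightarrow> d)] (mod int p)"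
        using exists_word_exponent_sum[of "\<lambda>x. case x of \<alpha>1 \<Rightarrow> a | \<alpha>2 \<Rightarrow> b | \<alpha>3 \<Rightarrow> c | _ \<Rightarrow> d"] by blast
      then have "F v = t" using P by (simp add: F_def t cong_def)
      then show "t \<in> F ` UNIV" by blast
    qed
  qed
  also have "card (?P \<times> ?P \<times> ?P \<times> ?P) = p ^ 4"
    by (simp add: card_cartesian_product power4_eq_xxxx)
  finally show ?thesis .
qed

end

section \<open>Transfer along isoclinism\<close>

lemma (in group) rcosets_eq_image: "carrier (G Mod K) = (\<lambda>x. K #> x) ` carrier G"
  by (auto simp: FactGroup_def RCOSETS_def)

text \<open>The order of the center follows from the order of \<open>G\<close> and the index
  \<open>p ^ 4\<close> carried over by \<theta>. The derived subgroup is central and, by \<phi>,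
  also of order \<open>p\<^sup>2\<close>, so it equals the center. Exponent and surjectivity of
  commutators can then be pulled back through \<phi>.\<close>

lemma in_Phi15_semi_extraspecial:
  fixes G (structure)
  assumes "Factorial_Ring.prime p" "odd p" "in_Phi15 p G"
  shows "semi_extraspecial G p"
proof -
  interpret H: phi15 p using assms by unfold_locales
  let ?H = "phi15_group p"
  interpret G: group G using assms(3) by (simp add: in_Phi15_def)
  have ord: "Coset.order G = p ^ 6" and iso: "isoclinic G ?H"
    using assms(3) by (simp_all add: in_Phi15_def)
  let ?Z = "center G" and ?ZH = "center ?H"
  let ?D = "derived G (carrier G)" and ?DH = "derived ?H (carrier ?H)"
  obtain \<theta> \<phi> where \<theta>: "\<theta> \<in> Group.iso (G Mod ?Z) (?H Mod ?ZH)"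
    and \<phi>: "\<phi> \<in> Group.iso (G\<lparr>carrier := ?D\<rparr>) (?H\<lparr>carrier := ?DH\<rparr>)"
    and comp: "\<And>g1 g2 h1 h2. g1 \<in> carrier G \<Longrightarrow> g2 \<in> carrier G \<Longrightarrow> h1 \<in> carrier ?H \<Longrightarrow> h2 \<in> carrier ?H \<Longrightarrow>
      \<theta> (?Z #> g1) = ?ZH #>\<^bsub>?H\<^esub> h1 \<Longrightarrow> \<theta> (?Z #> g2) = ?ZH #>\<^bsub>?H\<^esub> h2 \<Longrightarrow>
      \<phi> (commutator G g1 g2) = commutator ?H h1 h2"
    using iso unfolding isoclinic_def by blast
  have \<theta>_hom: "\<theta> \<in> hom (G Mod ?Z) (?H Mod ?ZH)"
    and \<theta>_bij: "bij_betw \<theta> (carrier (G Mod ?Z)) (carrier (?H Mod ?ZH))"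
    using \<theta> by (auto simp: Group.iso_def)
  have \<phi>_hom: "\<phi> \<in> hom (G\<lparr>carrier := ?D\<rparr>) (?H\<lparr>carrier := ?DH\<rparr>)" and \<phi>_bij: "bij_betw \<phi> ?D ?DH"
    using \<phi> by (auto simp: Group.iso_def)
  have to_H: "\<exists>h\<in>carrier ?H. \<theta> (?Z #> g) = ?ZH #>\<^bsub>?H\<^esub> h" if "g \<in> carrier G" for g
  proof -
    have "\<theta> (?Z #> g) \<in> carrier (?H Mod ?ZH)"
      using bij_betwE[OF \<theta>_bij] that by (simp add: G.rcosets_eq_image)
    then show ?thesis unfolding H.rcosets_eq_image by auto
  qed
  have to_G: "\<exists>g\<in>carrier G. \<theta> (?Z #> g) = ?ZH #>\<^bsub>?H\<^esub> h" if "h \<in> carrier ?H" for h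
  proof -
    have "?ZH #>\<^bsub>?H\<^esub> h \<in> \<theta> ` carrier (G Mod ?Z)"
      unfolding bij_betw_imp_surj_on[OF \<theta>_bij] H.rcosets_eq_image using that by blast
    then show ?thesis unfolding G.rcosets_eq_image by auto
  qed
  have fin: "finite (carrier G)"
    using ord H.p_pos by (metis Coset.order_def card.infinite power_not_zero less_numeral_extra(3))
  have card_Z: "card ?Z = p\<^sup>2"
  proof -
    have "card (rcosets ?Z) = p ^ 4"
      using bij_betw_same_card[OF \<theta>_bij] H.card_center_quotient by (simp add: FactGroup_def)
    then have "p ^ 4 * card ?Z = p ^ 4 * p\<^sup>2"
      using G.lagrange[OF G.subgroup_center] ord by (simp flip: power_add)
    then show ?thesis using H.p_pos by (simp only: mult_cancel1 power_eq_0_iff) simp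
  qed
  \<comment> \<open>The products \<open>h k\<close> and \<open>k h\<close> lie in one coset of the
    center because commutators in the presented group are central. As \<theta> is an injective
    homomorphism, the same holds for \<open>x y\<close> and \<open>y x\<close>.\<close>
  have comm_Z: "commutator G x y \<in> ?Z" if xy: "x \<in> carrier G" "y \<in> carrier G" for x y
  proof -
    obtain h k where hk: "h \<in> carrier ?H" "\<theta> (?Z #> x) = ?ZH #>\<^bsub>?H\<^esub> h"
      "k \<in> carrier ?H" "\<theta> (?Z #> y) = ?ZH #>\<^bsub>?H\<^esub> k" using to_H xy by metis
    have mult: "\<theta> (?Z #> (a \<otimes> b)) = ?ZH #>\<^bsub>?H\<^esub> (c \<otimes>\<^bsub>?H\<^esub> d)"
      if "a \<in> carrier G" "b \<in> carrier G" "c \<in> carrier ?H" "d \<in> carrier ?H"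
        "\<theta> (?Z #> a) = ?ZH #>\<^bsub>?H\<^esub> c" "\<theta> (?Z #> b) = ?ZH #>\<^bsub>?H\<^esub> d" for a b c d
    proof -
      have "\<theta> ((?Z #> a) \<otimes>\<^bsub>G Mod ?Z\<^esub> (?Z #> b)) = \<theta> (?Z #> a) \<otimes>\<^bsub>?H Mod ?ZH\<^esub> \<theta> (?Z #> b)"
        using that by (intro hom_mult[OF \<theta>_hom]) (auto simp: G.rcosets_eq_image)
      then show ?thesis
        using that by (simp add: FactGroup_def normal.rcos_sum[OF G.normal_center] normal.rcos_sum[OF H.normal_center])
    qed
    have "commutator ?H h k \<in> ?ZH"
      using hk H.commutator_in_derived H.derived_central by blast
    moreover have "h \<otimes>\<^bsub>?H\<^esub> k \<otimes>\<^bsub>?H\<^esub> inv\<^bsub>?H\<^esub> (k \<otimes>\<^bsub>?H\<^esub> h) = commutator ?H h k"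
    proof -
      have "h \<otimes>\<^bsub>?H\<^esub> k = commutator ?H h k \<otimes>\<^bsub>?H\<^esub> (k \<otimes>\<^bsub>?H\<^esub> h)"
        using H.mult_commutator[of h k] H.center_commute[OF \<open>commutator ?H h k \<in> ?ZH\<close>, of "k \<otimes>\<^bsub>?H\<^esub> h"] hk by simp
      then show ?thesis using hk by (simp add: H.inv_solve_right')
    qed
    ultimately have "?ZH #>\<^bsub>?H\<^esub> (h \<otimes>\<^bsub>?H\<^esub> k) = ?ZH #>\<^bsub>?H\<^esub> (k \<otimes>\<^bsub>?H\<^esub> h)"
      using hk by (simp add: H.rcoset_eq_iff[OF H.subgroup_center])
    then have "\<theta> (?Z #> (x \<otimes> y)) = \<theta> (?Z #> (y \<otimes> x))"
      using mult[of x y h k] mult[of y x k h] xy hk by simp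
    then have "?Z #> (x \<otimes> y) = ?Z #> (y \<otimes> x)"
      using bij_betw_imp_inj_on[OF \<theta>_bij] xy by (auto simp: inj_on_def G.rcosets_eq_image)
    then have z: "x \<otimes> y \<otimes> inv (y \<otimes> x) \<in> ?Z"
      using xy by (simp add: G.rcoset_eq_iff[OF G.subgroup_center])
    \<comment> \<open>The quotient just shown to be central has the inverse on the right; being
      central, it can be moved across and identified with \<open>commutator G x y\<close>.\<close>
    have "x \<otimes> y = x \<otimes> y \<otimes> inv (y \<otimes> x) \<otimes> (y \<otimes> x)"
      using xy by (simp add: G.m_assoc del: G.inv_mult_group)
    also have "\<dots> = y \<otimes> x \<otimes> (x \<otimes> y \<otimes> inv (y \<otimes> x))"
      using G.center_commute[OF z] xy by simp
    finally have "commutator G x y = x \<otimes> y \<otimes> inv (y \<otimes> x)"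
      using xy by (intro G.commutator_eqI) simp_all
    then show ?thesis using z by simp
  qed
  have D_eq: "?D = ?Z"
  proof (rule card_subset_eq)
    show "finite ?Z" using fin G.center_carrier by (meson finite_subset subsetI)
    show "?D \<subseteq> ?Z" using comm_Z by (intro G.derived_subset G.subgroup_center)
    show "card ?D = card ?Z" using bij_betw_same_card[OF \<phi>_bij] by (simp add: card_Z H.card_derived)
  qed
  show ?thesis
  proof
    show "Factorial_Ring.prime p" "odd p" by (rule assms)+
    show "Coset.order G = p ^ 6" by (rule ord)
    show "card ?Z = p\<^sup>2" by (rule card_Z)
    show "commutator G x y \<in> ?Z" if "x \<in> carrier G" "y \<in> carrier G" for x y using that by (rule comm_Z)
  next
    fix z assume z: "z \<in> ?Z"
    let ?D' = "G\<lparr>carrier := ?D\<rparr>" and ?DH' = "?H\<lparr>carrier := ?DH\<rparr>"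
    have D: "subgroup ?D G" unfolding D_eq by (rule G.subgroup_center)
    have DH: "subgroup ?DH ?H" by (intro H.derived_is_subgroup) simp
    interpret hom: group_hom ?D' ?DH' \<phi>
      using \<phi>_hom by (intro group_hom.intro group_hom_axioms.intro G.subgroup_imp_group[OF D] H.subgroup_imp_group[OF DH])
    have zD: "z \<in> ?D" using z D_eq by simp
    have "\<phi> (z [^]\<^bsub>?D'\<^esub> p) = \<phi> z [^]\<^bsub>?DH'\<^esub> p" using zD by (intro hom.hom_nat_pow) simp
    also have "\<dots> = \<phi> z [^]\<^bsub>?H\<^esub> p" by (simp add: nat_pow_def)
    also have "\<dots> = \<one>\<^bsub>?DH'\<^esub>" using H.derived_exponent bij_betwE[OF \<phi>_bij] zD by simp
    also have "\<dots> = \<phi> \<one>" using hom.hom_one by simp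
    finally have "\<phi> (z [^] p) = \<phi> \<one>" by (simp add: nat_pow_def)
    moreover have "z [^] p \<in> ?D" using zD D G.subgroup_int_pow_closed[OF D zD, of "int p"] by (simp add: int_pow_int)
    ultimately show "z [^] p = \<one>"
      using bij_betw_imp_inj_on[OF \<phi>_bij] subgroup.one_closed[OF D] by (auto simp: inj_on_def)
  next
    fix x z assume x: "x \<in> carrier G" "x \<notin> ?Z" and z: "z \<in> ?Z"
    obtain h where h: "h \<in> carrier ?H" "\<theta> (?Z #> x) = ?ZH #>\<^bsub>?H\<^esub> h" using to_H x by blast
    \<comment> \<open>The injective map \<theta> sends the trivial coset to the trivial coset, so it
      cannot send the coset of the noncentral \<open>x\<close> there.\<close>
    have "h \<notin> ?ZH"
    proof
      assume "h \<in> ?ZH"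
      then have "\<theta> (?Z #> x) = ?ZH" using h H.coset_join2 H.subgroup_center by metis
      moreover have "\<theta> ?Z = ?ZH"
        using hom_one[OF \<theta>_hom normal.factorgroup_is_group[OF G.normal_center]
            normal.factorgroup_is_group[OF H.normal_center]]
        by (simp add: FactGroup_def)
      moreover have "?Z = ?Z #> \<one>" by (simp add: G.coset_mult_one G.center_carrier subsetI)
      ultimately have "?Z #> x = ?Z #> \<one>"
        using bij_betw_imp_inj_on[OF \<theta>_bij] x
        by (metis G.one_closed G.rcosets_eq_image imageI inj_onD)
      then show False using x by (simp add: G.rcoset_eq_iff[OF G.subgroup_center])
    qed
    have zD: "z \<in> ?D" using z D_eq by simp
    then have "\<phi> z \<in> ?DH" using bij_betwE[OF \<phi>_bij] by blast
    then obtain m n where "\<phi> z = H.beta_elem m n" by (auto simp: H.derived_eq)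
    then obtain k where k: "k \<in> carrier ?H" "commutator ?H h k = \<phi> z"
      using H.noncentral_commutator_surjective[OF h(1) \<open>h \<notin> ?ZH\<close>, of m n] by auto
    obtain y where y: "y \<in> carrier G" "\<theta> (?Z #> y) = ?ZH #>\<^bsub>?H\<^esub> k" using to_G k by blast
    have "\<phi> (commutator G x y) = \<phi> z" using comp[OF x(1) y(1) h(1) k(1) h(2) y(2)] k by simp
    then have "commutator G x y = z"
      using bij_betw_imp_inj_on[OF \<phi>_bij] zD comm_Z[OF x(1) y(1)] D_eq by (auto simp: inj_on_def)
    then show "\<exists>y\<in>carrier G. commutator G x y = z" using y by blast
  qed
qed

theorem corollary25:
  fixes G :: "('a, 'b) monoid_scheme" and p :: nat
  assumes "prime p" and "odd p"
    and "in_Phi15 p G"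
  shows "quasi_permutation_degree G = 2 * p ^ 3"
proof -
  interpret semi_extraspecial G p by (rule in_Phi15_semi_extraspecial[OF assms])
  show ?thesis
    unfolding quasi_permutation_degree_def
  proof (rule Least_equality)
    show "0 < 2 * p ^ 3 \<and> (\<exists>\<rho>. faithful_quasi_permutation_rep G (2 * p ^ 3) \<rho>)"
      using exists_faithful_rep p_gt_2 by simp
  next
    fix n assume "0 < n \<and> (\<exists>\<rho>. faithful_quasi_permutation_rep G n \<rho>)"
    then obtain \<rho> where "faithful_quasi_permutation_rep G n \<rho>" by blast
    then interpret faithful_qp_rep G p n \<rho> by unfold_locales
    show "2 * p ^ 3 \<le> n" by (rule degree_lower_bound)
  qed
qed

end
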